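(* Let $\mathbf{g}$ be a Riemannian 2-metric for which the isometric embedding system into Euclidean $\mathbb{R}^3$ is Darboux integrable. If the system is elliptic, then there are local coordinates $(u,v)$ in which the metric takes one of the following forms: 1. $\mathbf{g}=\cosh^4u\,(du)^2+\sinh^2u\,(dv)^2$, $u>0$; 2. $\mathbf{g}=\sinh^4u\,(du)^2+\cosh^2u\,(dv)^2$; 3. $\mathbf{g}=u^2\left((du)^2+(dv)^2\right)$, $u>0$. If the system is hyperbolic, then the metric takes the following form: 4. $\mathbf{g}=\cos^4u\,(du)^2+\sin^2u\,(dv)^2$, $0<u<\pi/2$.
   Context: $M$ is a connected, oriented smooth surface with Riemannian metric $\mathbf{g}$ whose Gauss curvature $K$ is either everywhere positive (the system is then called elliptic) or everywhere negative (the system is then called hyperbolic). $\mathcal{F}_M$ is the oriented orthonormal frame bundle of $M$, with canonical 1-forms $\eta^1,\eta^2$ and connection form $\eta^1_2=-\eta^2_1$ satisfying $d\eta^1=-\eta^1_2\wedge\eta^2$, $d\eta^2=-\eta^2_1\wedge\eta^1$, $d\eta^1_2=K\,\eta^1\wedge\eta^2$. $\mathcal{F}_{\mathbb{R}^3}$ is the orthonormal frame bundle of Euclidean $\mathbb{R}^3$, with basepoint map $\rho$, frame vectors $e_i$, and forms $\omega^i$, $\omega^i_j=-\omega^j_i$ defined by $d\rho=e_i\omega^i$, $de_i=e_j\omega^j_i$. Isometric embedding system: $\mathcal{I}$ is the Pfaffian exterior differential system on $\mathcal{F}_M\times\mathcal{F}_{\mathbb{R}^3}$ generated by $$\theta_0=\omega^3,\quad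 \theta_1=\omega^1-\eta^1,\quad \theta_2=\omega^2-\eta^2,\quad \theta_3=\omega^1_2-\eta^1_2 .$$ Darboux integrability. Put $k=\sqrt{|K|}$. If $K<0$, the singular systems are $V_\pm=\operatorname{span}\{\theta_0,\theta_1,\theta_2,\theta_3,\omega^3_1\mp k\eta^2,\omega^3_2\pm k\eta^1\}$; if $K>0$, they are the complex subbundle $W=\operatorname{span}_{\mathbb{C}}\{\theta_0,\theta_1,\theta_2,\theta_3,\omega^3_1-\mathrm{i}k\eta^2,\omega^3_2+\mathrm{i}k\eta^1\}$ of the complexified cotangent bundle and its conjugate $\overline{W}$. $\mathcal{I}$ is Darboux integrable if, locally, each of the two singular systems contains a (real, respectively complex) Frobenius subbundle of rank at least $2$ that intersects the span of $\theta_0,\theta_1,\theta_2,\theta_3$ only in $0$.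
   Formalization: Forms 1, 2 and 4 are asserted up to one constant factor c>0 (Darboux integrability is unchanged by rescaling g), and forms 1 and 4 only around points where dK is nonzero, the critical points of K being shown isolated (these metrics extend smoothly over u=0). *)

theory Defs
  imports "HOL-Analysis.Analysis"
begin

section \<open>Smooth maps and oriented Riemannian surfaces\<close>

text \<open>\<^term>\<open>smooth_on\<close> is meant for open subsets of finite-dimensional spaces only.\<close>

primrec Ck_on :: "nat \<Rightarrow> 'a::real_normed_vector set \<Rightarrow> ('a \<Rightarrow> 'b::real_normed_vector) \<Rightarrow> bool" where
  "Ck_on 0 S f \<longleftrightarrow> continuous_on S f"
| "Ck_on (Suc n) S f \<longleftrightarrow>
     (\<forall>x\<in>S. f differentiable (at x)) \<and> (\<forall>v. Ck_on n S (\<lambda>x. frechet_derivative f (at x) v))"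

definition smooth_on :: "'a::real_normed_vector set \<Rightarrow> ('a \<Rightarrow> 'b::real_normed_vector) \<Rightarrow> bool" where
  "smooth_on S f \<longleftrightarrow> (\<forall>n. Ck_on n S f)"

type_synonym 'p chart = "'p set \<times> ('p \<Rightarrow> real^2)"

definition chart_on :: "'p topology \<Rightarrow> 'p chart \<Rightarrow> bool" where
  "chart_on X = (\<lambda>(U, \<phi>). openin X U \<and> open (\<phi> ` U) \<and>
     homeomorphic_map (subtopology X U) (top_of_set (\<phi> ` U)) \<phi>)"

definition overlap :: "'p chart \<Rightarrow> 'p chart \<Rightarrow> (real^2) set" where
  "overlap = (\<lambda>(U, \<phi>) (V, \<psi>). \<phi> ` (U \<inter> V))"

definition transition :: "'p chart \<Rightarrow> 'p chart \<Rightarrow> real^2 \<Rightarrow> real^2" where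
  "transition = (\<lambda>(U, \<phi>) (V, \<psi>). \<psi> \<circ> inv_into U \<phi>)"

definition smoothly_compatible :: "'p chart \<Rightarrow> 'p chart \<Rightarrow> bool" where
  "smoothly_compatible c d \<longleftrightarrow>
     smooth_on (overlap c d) (transition c d) \<and> smooth_on (overlap d c) (transition d c)"

text \<open>\<open>metric S c x\<close> is the matrix \<open>(g\<^sub>i\<^sub>j)\<close> of the Riemannian metric at the point with
  coordinates \<open>x\<close> in the chart \<open>c\<close>. Only its values on the image of \<open>c\<close> matter.\<close>

record 'p riem_surface =
  space :: "'p topology"
  atlas :: "'p chart set"
  metric :: "'p chart \<Rightarrow> real^2 \<Rightarrow> real^2^2"

definition oriented_smooth_surface :: "('p, 'm) riem_surface_scheme \<Rightarrow> bool" where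
  "oriented_smooth_surface S \<longleftrightarrow>
     Hausdorff_space (space S) \<and> second_countable (space S) \<and>
     (\<forall>c\<in>atlas S. chart_on (space S) c) \<and> (\<Union>c\<in>atlas S. fst c) = topspace (space S) \<and>
     (\<forall>c\<in>atlas S. \<forall>d\<in>atlas S. smoothly_compatible c d \<and>
        (\<forall>x\<in>overlap c d. det (matrix (frechet_derivative (transition c d) (at x))) > 0))"

definition riemannian_metric :: "('p, 'm) riem_surface_scheme \<Rightarrow> bool" where
  "riemannian_metric S \<longleftrightarrow>
     (\<forall>c\<in>atlas S. smooth_on (snd c ` fst c) (metric S c) \<and>
        (\<forall>x\<in>snd c ` fst c. transpose (metric S c x) = metric S c x \<and>
           (\<forall>a. a \<noteq> 0 \<longrightarrow> a \<bullet> (metric S c x *v a) > 0))) \<and>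
     (\<forall>c\<in>atlas S. \<forall>d\<in>atlas S. \<forall>x\<in>overlap c d. \<forall>a b.
        let D = frechet_derivative (transition c d) (at x) in
        a \<bullet> (metric S c x *v b) = D a \<bullet> (metric S d (transition c d x) *v D b))"

definition oriented_riemannian_surface :: "('p, 'm) riem_surface_scheme \<Rightarrow> bool" where
  "oriented_riemannian_surface S \<longleftrightarrow> oriented_smooth_surface S \<and> riemannian_metric S"

section \<open>Levi-Civita connection and Gauss curvature in a chart\<close>

text \<open>Here \<open>g\<close> is the matrix of the metric in one chart, as a function of the coordinates.\<close>

definition partial :: "2 \<Rightarrow> (real^2 \<Rightarrow> real) \<Rightarrow> real^2 \<Rightarrow> real" where
  "partial i f x = frechet_derivative f (at x) (axis i 1)"

text \<open>\<open>christoffel g k a b x\<close> is \<open>\<Gamma>\<close> with upper index \<open>k\<close> and lower indices \<open>a\<close>, \<open>b\<close>.\<close>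

definition christoffel :: "(real^2 \<Rightarrow> real^2^2) \<Rightarrow> 2 \<Rightarrow> 2 \<Rightarrow> 2 \<Rightarrow> real^2 \<Rightarrow> real" where
  "christoffel g k a b x = (1/2) * (\<Sum>l\<in>UNIV. matrix_inv (g x) $ k $ l *
     (partial a (\<lambda>y. g y $ l $ b) x + partial b (\<lambda>y. g y $ l $ a) x
      - partial l (\<lambda>y. g y $ a $ b) x))"

definition christoffel_map :: "(real^2 \<Rightarrow> real^2^2) \<Rightarrow> real^2 \<Rightarrow> real^2 \<Rightarrow> real^2 \<Rightarrow> real^2" where
  "christoffel_map g x v w =
     (\<chi> k. \<Sum>a\<in>UNIV. \<Sum>b\<in>UNIV. christoffel g k a b x * v $ a * w $ b)"

text \<open>\<open>curvature_component g l x\<close> is component \<open>l\<close> of \<open>R(\<partial>\<^sub>1,\<partial>\<^sub>2)\<partial>\<^sub>2\<close>, where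
  \<open>R(X,Y)Z = \<nabla>\<^sub>X\<nabla>\<^sub>YZ - \<nabla>\<^sub>Y\<nabla>\<^sub>XZ - \<nabla>\<^bsub>[X,Y]\<^esub>Z\<close>; with this sign round spheres have \<open>K > 0\<close>.\<close>

definition curvature_component :: "(real^2 \<Rightarrow> real^2^2) \<Rightarrow> 2 \<Rightarrow> real^2 \<Rightarrow> real" where
  "curvature_component g l x =
     partial 1 (christoffel g l 2 2) x - partial 2 (christoffel g l 1 2) x
     + (\<Sum>m\<in>UNIV. christoffel g m 2 2 x * christoffel g l 1 m x
                 - christoffel g m 1 2 x * christoffel g l 2 m x)"

definition gauss_curvature :: "(real^2 \<Rightarrow> real^2^2) \<Rightarrow> real^2 \<Rightarrow> real" where
  "gauss_curvature g x = (\<Sum>l\<in>UNIV. g x $ 1 $ l * curvature_component g l x) / det (g x)"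

definition elliptic :: "('p, 'm) riem_surface_scheme \<Rightarrow> bool" where
  "elliptic S \<longleftrightarrow> (\<forall>c\<in>atlas S. \<forall>x\<in>snd c ` fst c. gauss_curvature (metric S c) x > 0)"

definition hyperbolic :: "('p, 'm) riem_surface_scheme \<Rightarrow> bool" where
  "hyperbolic S \<longleftrightarrow> (\<forall>c\<in>atlas S. \<forall>x\<in>snd c ` fst c. gauss_curvature (metric S c) x < 0)"

section \<open>The frame bundles and their canonical forms\<close>

text \<open>A point \<open>((x,E),(r,F))\<close> consists of coordinates \<open>x\<close> of a point of the surface, the
  coordinate components \<open>E $ 1\<close>, \<open>E $ 2\<close> of an oriented orthonormal tangent frame, a basepoint
  \<open>r\<close> in Euclidean space and an orthonormal frame \<open>F $ 1\<close>, \<open>F $ 2\<close>, \<open>F $ 3\<close> there. The product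
  of the two frame bundles over a chart domain thus is a 9-dimensional submanifold of an
  18-dimensional vector space, and differential forms on it are written as restrictions of
  forms on open subsets of that vector space. Every smooth form on the submanifold is locally
  such a restriction; two restrictions agree at \<open>z\<close> when they agree on the tangent space.\<close>

type_synonym frames = "((real^2) \<times> (real^2^2)) \<times> ((real^3) \<times> (real^3^3))"

type_synonym 'k form1 = "frames \<Rightarrow> frames \<Rightarrow> 'k"

definition surface_frames :: "(real^2) set \<Rightarrow> (real^2 \<Rightarrow> real^2^2) \<Rightarrow> ((real^2) \<times> (real^2^2)) set" where
  "surface_frames \<Omega> g = {(x, E). x \<in> \<Omega> \<and> det E > 0 \<and>
     (\<forall>i j. E $ i \<bullet> (g x *v E $ j) = (if i = j then 1 else 0))}"

definition euclidean_frames :: "((real^3) \<times> (real^3^3)) set" where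
  "euclidean_frames = {(r, F). \<forall>i j. F $ i \<bullet> F $ j = (if i = j then 1 else 0)}"

definition frame_product :: "(real^2) set \<Rightarrow> (real^2 \<Rightarrow> real^2^2) \<Rightarrow> frames set" where
  "frame_product \<Omega> g = surface_frames \<Omega> g \<times> euclidean_frames"

definition tangent_space :: "'a::real_normed_vector set \<Rightarrow> 'a \<Rightarrow> 'a set" where
  "tangent_space P z = {v. \<exists>\<gamma>::real \<Rightarrow> 'a. \<gamma> 0 = z \<and> (\<forall>t. \<gamma> t \<in> P) \<and>
     (\<gamma> has_vector_derivative v) (at 0)}"

definition eta :: "(real^2 \<Rightarrow> real^2^2) \<Rightarrow> 2 \<Rightarrow> real form1" where
  "eta g i = (\<lambda>((x, E), _) ((dx, dE), _). E $ i \<bullet> (g x *v dx))"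

text \<open>The connection form \<open>\<eta>\<^sup>1\<^sub>2\<close> is the \<open>e\<^sub>1\<close>-component of the covariant derivative of \<open>e\<^sub>2\<close>.\<close>

definition eta12 :: "(real^2 \<Rightarrow> real^2^2) \<Rightarrow> real form1" where
  "eta12 g = (\<lambda>((x, E), _) ((dx, dE), _).
     E $ 1 \<bullet> (g x *v (dE $ 2 + christoffel_map g x dx (E $ 2))))"

text \<open>\<open>omega i\<close> and \<open>omega2 i j\<close> are the coefficients in \<open>d\<rho> = e\<^sub>i \<omega>\<^sup>i\<close> and
  \<open>de\<^sub>j = e\<^sub>i \<omega>\<^sup>i\<^sub>j\<close>.\<close>

definition omega :: "3 \<Rightarrow> real form1" where
  "omega i = (\<lambda>(_, (r, F)) (_, (dr, dF)). F $ i \<bullet> dr)"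

definition omega2 :: "3 \<Rightarrow> 3 \<Rightarrow> real form1" where
  "omega2 i j = (\<lambda>(_, (r, F)) (_, (dr, dF)). F $ i \<bullet> dF $ j)"

definition root_curvature :: "(real^2 \<Rightarrow> real^2^2) \<Rightarrow> frames \<Rightarrow> real" where
  "root_curvature g = (\<lambda>((x, E), _). sqrt \<bar>gauss_curvature g x\<bar>)"

section \<open>The isometric embedding system and its singular systems\<close>

definition isometric_embedding_system :: "(real^2 \<Rightarrow> real^2^2) \<Rightarrow> real form1 list" where
  "isometric_embedding_system g =
     [omega 3,
      \<lambda>z v. omega 1 z v - eta g 1 z v,
      \<lambda>z v. omega 2 z v - eta g 2 z v,
      \<lambda>z v. omega2 1 2 z v - eta12 g z v]"

text \<open>For \<open>\<epsilon> = 1\<close> and \<open>\<epsilon> = - 1\<close> these are the generators of \<open>V\<^sub>+\<close> and \<open>V\<^sub>-\<close>.\<close>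

definition hyperbolic_system :: "real \<Rightarrow> (real^2 \<Rightarrow> real^2^2) \<Rightarrow> real form1 list" where
  "hyperbolic_system \<epsilon> g = isometric_embedding_system g @
     [\<lambda>z v. omega2 3 1 z v - \<epsilon> * root_curvature g z * eta g 2 z v,
      \<lambda>z v. omega2 3 2 z v + \<epsilon> * root_curvature g z * eta g 1 z v]"

definition complexify :: "real form1 \<Rightarrow> complex form1" where
  "complexify A = (\<lambda>z v. complex_of_real (A z v))"

definition elliptic_system :: "(real^2 \<Rightarrow> real^2^2) \<Rightarrow> complex form1 list" where
  "elliptic_system g = map complexify (isometric_embedding_system g) @
     [\<lambda>z v. omega2 3 1 z v - \<i> * root_curvature g z * eta g 2 z v,
      \<lambda>z v. omega2 3 2 z v + \<i> * root_curvature g z * eta g 1 z v]"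

definition conjugate_system :: "complex form1 list \<Rightarrow> complex form1 list" where
  "conjugate_system As = map (\<lambda>A z v. cnj (A z v)) As"

section \<open>Darboux integrability\<close>

definition smooth_form :: "frames set \<Rightarrow> 'k::real_normed_field form1 \<Rightarrow> bool" where
  "smooth_form N A \<longleftrightarrow> (\<forall>z\<in>N. linear (A z)) \<and> (\<forall>v. smooth_on N (\<lambda>z. A z v))"

definition combination ::
    "(nat \<Rightarrow> 'k) \<Rightarrow> 'k::real_normed_field form1 list \<Rightarrow> 'k form1" where
  "combination b As z v = (\<Sum>j<length As. b j * (As ! j) z v)"

definition exterior_derivative ::
    "'k::real_normed_field form1 \<Rightarrow> frames \<Rightarrow> frames \<Rightarrow> frames \<Rightarrow> 'k" where
  "exterior_derivative A z v w =
     frechet_derivative (\<lambda>y. A y w) (at z) v - frechet_derivative (\<lambda>y. A y v) (at z) w"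

definition independent_at :: "frames set \<Rightarrow> frames \<Rightarrow> 'k::real_normed_field form1 list \<Rightarrow> bool" where
  "independent_at P z As \<longleftrightarrow>
     (\<forall>b. (\<forall>v\<in>tangent_space P z. combination b As z v = 0) \<longrightarrow> (\<forall>j<length As. b j = 0))"

definition in_span_at ::
    "frames set \<Rightarrow> frames \<Rightarrow> 'k::real_normed_field form1 list \<Rightarrow> 'k form1 \<Rightarrow> bool" where
  "in_span_at P z Bs A \<longleftrightarrow>
     (\<exists>b. \<forall>v\<in>tangent_space P z. A z v = combination b Bs z v)"

definition transverse_at ::
    "frames set \<Rightarrow> frames \<Rightarrow> 'k::real_normed_field form1 list \<Rightarrow> 'k form1 list \<Rightarrow> bool" where
  "transverse_at P z As Bs \<longleftrightarrow>
     (\<forall>a b. (\<forall>v\<in>tangent_space P z. combination a As z v = combination b Bs z v) \<longrightarrow>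
            (\<forall>v\<in>tangent_space P z. combination a As z v = 0))"

text \<open>The Frobenius condition \<open>dA\<^sub>j = \<Sum>\<^sub>l \<beta>\<^sub>l \<and> A\<^sub>l\<close> on the tangent space, for every \<open>j\<close>. Where
  the \<open>A\<^sub>l\<close> are independent, the covectors \<open>\<beta>\<^sub>l\<close> can be chosen to depend smoothly on \<open>z\<close>.\<close>

definition frobenius_at :: "frames set \<Rightarrow> frames \<Rightarrow> 'k::real_normed_field form1 list \<Rightarrow> bool" where
  "frobenius_at P z As \<longleftrightarrow>
     (\<forall>j<length As. \<exists>\<beta> :: nat \<Rightarrow> frames \<Rightarrow> 'k. (\<forall>l<length As. linear (\<beta> l)) \<and>
        (\<forall>v\<in>tangent_space P z. \<forall>w\<in>tangent_space P z.
           exterior_derivative (As ! j) z v w =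
             (\<Sum>l<length As. \<beta> l v * (As ! l) z w - \<beta> l w * (As ! l) z v)))"

text \<open>Locally on \<open>P\<close>, the span of \<open>Vs\<close> contains a Frobenius subbundle (with local frame \<open>As\<close>)
  of rank at least 2 that meets the span of \<open>\<theta>s\<close> only in 0.\<close>

definition contains_transverse_frobenius ::
    "frames set \<Rightarrow> 'k::real_normed_field form1 list \<Rightarrow> 'k form1 list \<Rightarrow> bool" where
  "contains_transverse_frobenius P Vs \<theta>s \<longleftrightarrow>
     (\<forall>z\<^sub>0\<in>P. \<exists>N As. open N \<and> z\<^sub>0 \<in> N \<and> length As \<ge> 2 \<and> (\<forall>A\<in>set As. smooth_form N A) \<and>
        (\<forall>z\<in>N \<inter> P. independent_at P z As \<and> (\<forall>A\<in>set As. in_span_at P z Vs A) \<and>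
           frobenius_at P z As \<and> transverse_at P z As \<theta>s))"

definition darboux_integrable :: "('p, 'm) riem_surface_scheme \<Rightarrow> bool" where
  "darboux_integrable S \<longleftrightarrow>
     (\<forall>c\<in>atlas S.
        let g = metric S c; P = frame_product (snd c ` fst c) g;
            \<theta>s = isometric_embedding_system g
        in (hyperbolic S \<longrightarrow>
              contains_transverse_frobenius P (hyperbolic_system 1 g) \<theta>s \<and>
              contains_transverse_frobenius P (hyperbolic_system (- 1) g) \<theta>s) \<and>
           (elliptic S \<longrightarrow>
              contains_transverse_frobenius P (elliptic_system g) (map complexify \<theta>s) \<and>
              contains_transverse_frobenius P (conjugate_system (elliptic_system g))
                (map complexify \<theta>s)))"

section \<open>Normal forms of the metric\<close>

definition coordinate_system :: "('p, 'm) riem_surface_scheme \<Rightarrow> 'p chart \<Rightarrow> bool" where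
  "coordinate_system S d \<longleftrightarrow>
     chart_on (space S) d \<and> (\<forall>c\<in>atlas S. smoothly_compatible c d)"

text \<open>Around \<open>p\<close> there are coordinates \<open>(u,v)\<close>, with \<open>u\<close> ranging in \<open>R\<close>, such that the metric
  is \<open>\<mu> (A(u) du\<^sup>2 + B(u) dv\<^sup>2)\<close>. The constant \<open>\<mu> > 0\<close> is needed because replacing the metric by a
  constant multiple, and dilating Euclidean space accordingly, leaves the singular systems
  unchanged: Darboux integrability cannot detect the scale of the metric.\<close>

definition metric_has_form_at ::
    "('p, 'm) riem_surface_scheme \<Rightarrow> 'p \<Rightarrow> real \<Rightarrow> real set \<Rightarrow> (real \<Rightarrow> real) \<Rightarrow> (real \<Rightarrow> real) \<Rightarrow> bool"
  where
  "metric_has_form_at S p \<mu> R A B \<longleftrightarrow>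
     (\<exists>d. coordinate_system S d \<and> p \<in> fst d \<and> (\<forall>q\<in>fst d. snd d q $ 1 \<in> R) \<and>
        (\<forall>c\<in>atlas S. \<forall>x\<in>overlap c d. \<forall>a.
           let u = transition c d x $ 1; D = frechet_derivative (transition c d) (at x) a in
           a \<bullet> (metric S c x *v a) = \<mu> * (A u * (D $ 1)\<^sup>2 + B u * (D $ 2)\<^sup>2)))"

definition curvature_critical :: "('p, 'm) riem_surface_scheme \<Rightarrow> 'p \<Rightarrow> bool" where
  "curvature_critical S p \<longleftrightarrow>
     (\<exists>c\<in>atlas S. p \<in> fst c \<and>
        (gauss_curvature (metric S c) has_derivative (\<lambda>_. 0)) (at (snd c p)))"

definition metric_has_form ::
    "('p, 'm) riem_surface_scheme \<Rightarrow> real \<Rightarrow> real set \<Rightarrow> (real \<Rightarrow> real) \<Rightarrow> (real \<Rightarrow> real) \<Rightarrow> bool"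
  where
  "metric_has_form S \<mu> R A B \<longleftrightarrow> (\<forall>p\<in>topspace (space S). metric_has_form_at S p \<mu> R A B)"

text \<open>The metrics \<open>cosh\<^sup>4u du\<^sup>2 + sinh\<^sup>2u dv\<^sup>2\<close> and \<open>cos\<^sup>4u du\<^sup>2 + sin\<^sup>2u dv\<^sup>2\<close> extend smoothly,
  in polar coordinates \<open>(u,v)\<close>, to the centre \<open>u = 0\<close>, and so do their Frobenius subbundles.
  At such a centre the curvature is critical and there are no coordinates of the required kind,
  so the set of critical points, which is discrete, has to be left out.\<close>

definition metric_has_form_off_centres ::
    "('p, 'm) riem_surface_scheme \<Rightarrow> real \<Rightarrow> real set \<Rightarrow> (real \<Rightarrow> real) \<Rightarrow> (real \<Rightarrow> real) \<Rightarrow> bool"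
  where
  "metric_has_form_off_centres S \<mu> R A B \<longleftrightarrow>
     (\<forall>p\<in>topspace (space S). \<not> curvature_critical S p \<longrightarrow> metric_has_form_at S p \<mu> R A B) \<and>
     (\<forall>p\<in>topspace (space S). \<exists>N. openin (space S) N \<and> p \<in> N \<and>
        (\<forall>q\<in>N - {p}. \<not> curvature_critical S q))"

end

theory Submission
  imports Defs
begin

text \<open>Along a fixed orthonormal frame field of the surface, either singular system is annihilated by two
  lifts of the coordinate fields, whose other components are left-invariant fields of the Euclidean
  frame bundle. The common kernel of a Frobenius subbundle is closed under brackets. Bracketing the
  two lifts, and then the results, yields elements of the complexified Euclidean Lie algebra, and
  since the subbundle is transverse of rank at least two, the pure rotations in the kernel form at
  most a line, which is not orthogonal to \<open>\<omega>\<^sup>1\<^sub>2\<close>. This forces, for \<open>f = (1/4) ln \<bar>K\<bar>\<close>, the Hessian equation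
  \<open>\<nabla>\<^sup>2f = 3 df\<^sup>2 - K g\<close>.

  By this equation \<open>l = r\<^sup>6 \<bar>df\<bar>\<^sup>2 - \<sigma> r\<^sup>2\<close>, where \<open>r = exp (- f)\<close> and \<open>\<sigma>\<close> is the sign of \<open>K\<close>, is constant, the
  form \<open>*df / (r\<^sup>3 \<bar>df\<bar>\<^sup>2)\<close> is closed, and zeros of \<open>df\<close> are nondegenerate, hence isolated. Elsewhere
  a primitive \<open>v\<close> of that form and a function \<open>u\<close> of \<open>r\<close> are the required coordinates; the sign of \<open>l\<close>
  decides between the normal forms.\<close>

section \<open>Smooth functions\<close>

text \<open>The only information about the subbundle is its rank modulo the generators; the bundle
  itself is never computed. What can be exploited is a growing list of vectors that all its forms
  must kill. The computation stays finite because the structure is invariant under Euclidean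
  motions: all coefficients depend on the surface point alone, so over a fixed point only linear
  algebra in a six-dimensional Lie algebra is left. The three motions obtained there have
  translation parts spanning all translations, which is why every further bracket can be corrected
  to a pure rotation.

  The real and the complex system are treated together over a normed field, with \<kappa> = c sqrt
  |K| and \<kappa>^2 = - K. The curvature enters the bracket of the lifts twice, through the
  derivative of the connection form and as \<kappa>^2 from the Euclidean rotations, and the two
  contributions add. The factor 1/4 in f makes sqrt |K| = exp (2 f); the 3 in the Hessian equation
  is this 2 plus 1 from a bracket of rotations, and it produces the exponents 6 and 3 of r.\<close>

lemma Ck_on_has_derivative:
  assumes "Ck_on (Suc n) S f" "x \<in> S"
  shows "(f has_derivative frechet_derivative f (at x)) (at x)"
  using assms by (auto simp: frechet_derivative_works[symmetric])

lemma Ck_on_SucD: "Ck_on (Suc n) S f \<Longrightarrow> Ck_on n S f"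
proof (induction n arbitrary: f)
  case 0
  then show ?case
    by (auto intro!: differentiable_imp_continuous_on simp: differentiable_on_def
        differentiable_at_withinI)
next
  case (Suc n)
  then show ?case by (metis Ck_on.simps(2))
qed

lemma Ck_on_antimono: "m \<le> n \<Longrightarrow> Ck_on n S f \<Longrightarrow> Ck_on m S f"
  by (induction rule: dec_induct) (auto dest: Ck_on_SucD simp del: Ck_on.simps)

lemma Ck_on_imp_continuous_on: "Ck_on n S f \<Longrightarrow> continuous_on S f"
  using Ck_on_antimono[of 0 n S f] by simp

lemma Ck_on_subset: "Ck_on n S f \<Longrightarrow> T \<subseteq> S \<Longrightarrow> Ck_on n T f"
  by (induction n arbitrary: f) (auto intro: continuous_on_subset)

text \<open>No differentiability is assumed: \<open>frechet_derivative\<close> is a choice among all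
  derivatives, and both functions have the same ones, so the choices agree.\<close>

lemma frechet_derivative_cong_open:
  assumes "open S" "x \<in> S" "\<And>y. y \<in> S \<Longrightarrow> f y = g y"
  shows "frechet_derivative f (at x) = frechet_derivative g (at x)"
proof -
  have "(f has_derivative D) (at x) \<longleftrightarrow> (g has_derivative D) (at x)" for D
    using has_derivative_transform_within_open[OF _ assms(1,2)] assms(3) by metis
  then show ?thesis unfolding frechet_derivative_def by simp
qed

lemma Ck_on_cong:
  assumes "open S" "\<And>x. x \<in> S \<Longrightarrow> f x = g x" "Ck_on n S f"
  shows "Ck_on n S g"
  using assms(2,3)
proof (induction n arbitrary: f g)
  case 0
  then show ?case using continuous_on_cong[of S S f g] by auto
next
  case (Suc n)
  have "g differentiable (at x)" if "x \<in> S" for x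
    using Suc.prems that assms(1) unfolding differentiable_def
    by (metis Ck_on.simps(2) differentiable_def has_derivative_transform_within_open)
  moreover have "Ck_on n S (\<lambda>x. frechet_derivative g (at x) v)" for v
    using Suc.IH[of "\<lambda>x. frechet_derivative f (at x) v" "\<lambda>x. frechet_derivative g (at x) v"]
      Suc.prems frechet_derivative_cong_open[OF assms(1)]
    by (metis Ck_on.simps(2))
  ultimately show ?case by simp
qed

text \<open>Lets the inductions below run on an explicit derivative formula instead of the choice
  operator \<open>frechet_derivative\<close>.\<close>

lemma Ck_on_SucI:
  assumes "open S" "\<And>x. x \<in> S \<Longrightarrow> (f has_derivative f' x) (at x)"
    and "\<And>v. Ck_on n S (\<lambda>x. f' x v)"
  shows "Ck_on (Suc n) S f"
proof -
  have "frechet_derivative f (at x) = f' x" if "x \<in> S" for x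
    using assms(2)[OF that] frechet_derivative_at by metis
  then have "Ck_on n S (\<lambda>x. frechet_derivative f (at x) v)" for v
    by (intro Ck_on_cong[OF assms(1) _ assms(3)[of v]]) auto
  then show ?thesis using assms(2) by (auto simp: differentiable_def)
qed

section \<open>Closure of differentiability classes under sums, products and composition\<close>

lemma Ck_on_const: "Ck_on n S (\<lambda>_. c)"
proof (induction n arbitrary: c)
  case (Suc n)
  then show ?case by (simp del: One_nat_def)
qed auto

lemma Ck_on_linear_compose:
  assumes "open S" "bounded_linear L" "Ck_on n S f"
  shows "Ck_on n S (\<lambda>x. L (f x))"
  using assms(3)
proof (induction n arbitrary: f)
  case 0
  then show ?case using assms(2) by (auto intro: bounded_linear.continuous_on)
next
  case (Suc n)
  show ?case
  proof (rule Ck_on_SucI[OF assms(1)])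
    show "((\<lambda>x. L (f x)) has_derivative (\<lambda>v. L (frechet_derivative f (at x) v))) (at x)"
      if "x \<in> S" for x
      using bounded_linear.has_derivative[OF assms(2) Ck_on_has_derivative[OF Suc.prems that]] .
    show "Ck_on n S (\<lambda>x. L (frechet_derivative f (at x) v))" for v
      using Suc.IH Suc.prems by simp
  qed
qed

lemma Ck_on_add:
  assumes "open S" "Ck_on n S f" "Ck_on n S g"
  shows "Ck_on n S (\<lambda>x. f x + g x)"
  using assms(2,3)
proof (induction n arbitrary: f g)
  case 0
  then show ?case by (auto intro: continuous_intros)
next
  case (Suc n)
  show ?case
  proof (rule Ck_on_SucI[OF assms(1)])
    show "((\<lambda>x. f x + g x) has_derivative
        (\<lambda>v. frechet_derivative f (at x) v + frechet_derivative g (at x) v)) (at x)" if "x \<in> S" for x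
      using Ck_on_has_derivative Suc.prems that by (blast intro: has_derivative_add)
    show "Ck_on n S (\<lambda>x. frechet_derivative f (at x) v + frechet_derivative g (at x) v)" for v
      using Suc by simp
  qed
qed

lemma Ck_on_bilinear:
  assumes "open S" "bounded_bilinear B" "Ck_on n S f" "Ck_on n S g"
  shows "Ck_on n S (\<lambda>x. B (f x) (g x))"
  using assms(3,4)
proof (induction n arbitrary: f g)
  case 0
  then show ?case using assms(2) by (auto intro: bounded_bilinear.continuous_on)
next
  case (Suc n)
  show ?case
  proof (rule Ck_on_SucI[OF assms(1)])
    show "((\<lambda>x. B (f x) (g x)) has_derivative
        (\<lambda>v. B (f x) (frechet_derivative g (at x) v) + B (frechet_derivative f (at x) v) (g x))) (at x)"
      if "x \<in> S" for x
      using bounded_bilinear.FDERIV[OF assms(2) Ck_on_has_derivative[OF Suc.prems(1) that]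
          Ck_on_has_derivative[OF Suc.prems(2) that]] .
    show "Ck_on n S (\<lambda>x. B (f x) (frechet_derivative g (at x) v) + B (frechet_derivative f (at x) v) (g x))" for v
      using Suc.prems by (intro Ck_on_add[OF assms(1)] Suc.IH) (auto intro: Ck_on_SucD)
  qed
qed

lemma Ck_on_sum:
  assumes "open S" "\<And>i. i \<in> I \<Longrightarrow> Ck_on n S (f i)"
  shows "Ck_on n S (\<lambda>x. \<Sum>i\<in>I. f i x)"
  using assms(2)
proof (induction I rule: infinite_finite_induct)
  case (insert i I)
  then show ?case by (simp add: Ck_on_add[OF assms(1)])
qed (simp_all add: Ck_on_const del: Ck_on.simps)

lemma Ck_on_mult:
  fixes f g :: "'a::real_normed_vector \<Rightarrow> 'b::real_normed_algebra"
  shows "open S \<Longrightarrow> Ck_on n S f \<Longrightarrow> Ck_on n S g \<Longrightarrow> Ck_on n S (\<lambda>x. f x * g x)"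
  by (rule Ck_on_bilinear[OF _ bounded_bilinear_mult])

lemma Ck_on_uminus: "open S \<Longrightarrow> Ck_on n S f \<Longrightarrow> Ck_on n S (\<lambda>x. - f x)"
  by (rule Ck_on_linear_compose[OF _ bounded_linear_minus[OF bounded_linear_ident]])

lemma Ck_on_diff:
  "open S \<Longrightarrow> Ck_on n S f \<Longrightarrow> Ck_on n S g \<Longrightarrow> Ck_on n S (\<lambda>x. f x - g x)"
  using Ck_on_add[of S n f "\<lambda>x. - g x"] Ck_on_uminus[of S n g] by simp

text \<open>In the chain rule a varying linear map is applied to a varying vector, which is not a
  product of functions covered by the induction. Expanding the vector in the basis of the
  intermediate Euclidean space makes it a finite sum of such products.\<close>

lemma Ck_on_compose:
  fixes f :: "'a::real_normed_vector \<Rightarrow> 'b::euclidean_space"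
    and g :: "'b \<Rightarrow> 'c::real_normed_vector"
  assumes "open S" "open T" "\<And>x. x \<in> S \<Longrightarrow> f x \<in> T" "Ck_on n S f" "Ck_on n T g"
  shows "Ck_on n S (\<lambda>x. g (f x))"
  using assms(4,5)
proof (induction n arbitrary: g)
  case 0
  then show ?case using assms(3) by (auto intro: continuous_on_compose2)
next
  case (Suc n)
  show ?case
  proof (rule Ck_on_SucI[OF assms(1)])
    fix x assume x: "x \<in> S"
    have g: "(g has_derivative frechet_derivative g (at (f x))) (at (f x))"
      using Ck_on_has_derivative Suc.prems(2) assms(3) x by blast
    interpret lin: linear "frechet_derivative g (at (f x))"
      using g by (rule has_derivative_linear)
    have eq: "frechet_derivative g (at (f x)) w =
        (\<Sum>b\<in>Basis. (w \<bullet> b) *\<^sub>R frechet_derivative g (at (f x)) b)" for w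
      by (subst euclidean_representation[symmetric, of w])
        (simp only: lin.sum lin.scale)
    have "((\<lambda>x. g (f x)) has_derivative
        (\<lambda>v. frechet_derivative g (at (f x)) (frechet_derivative f (at x) v))) (at x)"
      by (rule has_derivative_compose[OF Ck_on_has_derivative[OF Suc.prems(1) x] g])
    then show "((\<lambda>x. g (f x)) has_derivative
        (\<lambda>v. \<Sum>b\<in>Basis. (frechet_derivative f (at x) v \<bullet> b) *\<^sub>R frechet_derivative g (at (f x)) b)) (at x)"
      by (subst (asm) eq)
  next
    fix v
    have "Ck_on n S f" using Suc.prems(1) by (rule Ck_on_SucD)
    then have "Ck_on n S (\<lambda>x. frechet_derivative g (at (f x)) b)" for b
      using Suc.IH[of "\<lambda>y. frechet_derivative g (at y) b"] Suc.prems(2) by simp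
    moreover have "Ck_on n S (\<lambda>x. frechet_derivative f (at x) v \<bullet> b)" for b
      using Suc.prems(1) by (intro Ck_on_linear_compose[OF assms(1) bounded_linear_inner_left]) simp
    ultimately show "Ck_on n S (\<lambda>x. \<Sum>b\<in>Basis. (frechet_derivative f (at x) v \<bullet> b) *\<^sub>R
        frechet_derivative g (at (f x)) b)"
      by (intro Ck_on_sum Ck_on_bilinear[OF assms(1) bounded_bilinear_scaleR] assms(1))
  qed
qed

lemma Ck_on_real_SucI:
  fixes f :: "real \<Rightarrow> real"
  assumes "open S" "\<And>x. x \<in> S \<Longrightarrow> (f has_real_derivative f' x) (at x)" "Ck_on n S f'"
  shows "Ck_on (Suc n) S f"
proof (rule Ck_on_SucI[OF assms(1)])
  show "(f has_derivative (*) (f' x)) (at x)" if "x \<in> S" for x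
    using assms(2)[OF that] by (simp add: has_field_derivative_def)
  show "Ck_on n S (\<lambda>x. f' x * v)" for v
    by (intro Ck_on_mult assms(1,3) Ck_on_const)
qed

text \<open>The derivative is a polynomial in \<open>inverse\<close> itself, so each order of
  differentiability yields the next.\<close>

lemma Ck_on_inverse_real: "Ck_on n (- {0::real}) inverse"
proof (induction n)
  case (Suc n)
  have "Ck_on n (- {0::real}) (\<lambda>x. - (inverse x * inverse x))"
    using Suc by (intro Ck_on_uminus Ck_on_mult) auto
  then show ?case
    by (rule Ck_on_real_SucI[rotated 2])
      (auto intro!: derivative_eq_intros simp: divide_inverse power2_eq_square)
qed (auto intro!: continuous_intros)

lemma Ck_on_ident: "Ck_on n S (\<lambda>x. x)"
  by (cases n) (auto simp: Ck_on_const)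

lemma smooth_on_compose:
  fixes f :: "'a::real_normed_vector \<Rightarrow> 'b::euclidean_space"
  shows "open S \<Longrightarrow> open T \<Longrightarrow> (\<And>x. x \<in> S \<Longrightarrow> f x \<in> T) \<Longrightarrow> smooth_on S f \<Longrightarrow>
    smooth_on T g \<Longrightarrow> smooth_on S (\<lambda>x. g (f x))"
  unfolding smooth_on_def by (metis Ck_on_compose)

lemma smooth_on_SucI:
  assumes "open S" "\<And>x. x \<in> S \<Longrightarrow> (f has_derivative f' x) (at x)" "\<And>v. smooth_on S (\<lambda>x. f' x v)"
  shows "smooth_on S f"
  unfolding smooth_on_def
proof
  fix n show "Ck_on n S f"
    by (rule Ck_on_SucD, rule Ck_on_SucI[OF assms(1,2)]) (use assms(3) in \<open>auto simp: smooth_on_def\<close>)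
qed

lemma smooth_on_real_SucI:
  fixes f :: "real \<Rightarrow> real"
  assumes "open S" "\<And>x. x \<in> S \<Longrightarrow> (f has_real_derivative f' x) (at x)" "smooth_on S f'"
  shows "smooth_on S f"
  unfolding smooth_on_def
proof
  fix n show "Ck_on n S f"
    by (rule Ck_on_SucD, rule Ck_on_real_SucI[OF assms(1,2)]) (use assms(3) in \<open>auto simp: smooth_on_def\<close>)
qed

lemma smooth_on_cong:
  "open S \<Longrightarrow> (\<And>x. x \<in> S \<Longrightarrow> f x = g x) \<Longrightarrow> smooth_on S f \<Longrightarrow> smooth_on S g"
  unfolding smooth_on_def by (auto intro: Ck_on_cong[of S f g])

lemma smooth_on_subset: "smooth_on S f \<Longrightarrow> T \<subseteq> S \<Longrightarrow> smooth_on T f"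
  unfolding smooth_on_def by (metis Ck_on_subset)

lemma smooth_on_const: "smooth_on S (\<lambda>_. c)"
  by (simp add: smooth_on_def Ck_on_const)

lemma smooth_on_ident: "smooth_on S (\<lambda>x. x)"
  by (simp add: smooth_on_def Ck_on_ident)

lemma smooth_on_add: "open S \<Longrightarrow> smooth_on S f \<Longrightarrow> smooth_on S g \<Longrightarrow> smooth_on S (\<lambda>x. f x + g x)"
  by (simp add: smooth_on_def Ck_on_add)

lemma smooth_on_diff: "open S \<Longrightarrow> smooth_on S f \<Longrightarrow> smooth_on S g \<Longrightarrow> smooth_on S (\<lambda>x. f x - g x)"
  by (simp add: smooth_on_def Ck_on_diff)

lemma smooth_on_uminus: "open S \<Longrightarrow> smooth_on S f \<Longrightarrow> smooth_on S (\<lambda>x. - f x)"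
  by (simp add: smooth_on_def Ck_on_uminus)

lemma smooth_on_mult:
  fixes f g :: "'a::real_normed_vector \<Rightarrow> 'b::real_normed_algebra"
  shows "open S \<Longrightarrow> smooth_on S f \<Longrightarrow> smooth_on S g \<Longrightarrow> smooth_on S (\<lambda>x. f x * g x)"
  by (simp add: smooth_on_def Ck_on_mult)

lemma smooth_on_scaleR:
  "open S \<Longrightarrow> smooth_on S f \<Longrightarrow> smooth_on S g \<Longrightarrow> smooth_on S (\<lambda>x. f x *\<^sub>R g x)"
  by (simp add: smooth_on_def Ck_on_bilinear[OF _ bounded_bilinear_scaleR])

lemma smooth_on_power:
  fixes f :: "'a::real_normed_vector \<Rightarrow> 'b::real_normed_algebra_1"
  shows "open S \<Longrightarrow> smooth_on S f \<Longrightarrow> smooth_on S (\<lambda>x. f x ^ n)"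
  by (induction n) (simp_all add: smooth_on_mult smooth_on_const)

lemma smooth_on_sum:
  "open S \<Longrightarrow> (\<And>i. i \<in> I \<Longrightarrow> smooth_on S (f i)) \<Longrightarrow> smooth_on S (\<lambda>x. \<Sum>i\<in>I. f i x)"
  by (simp add: smooth_on_def Ck_on_sum)

lemma smooth_on_linear_compose:
  "open S \<Longrightarrow> bounded_linear L \<Longrightarrow> smooth_on S f \<Longrightarrow> smooth_on S (\<lambda>x. L (f x))"
  by (simp add: smooth_on_def Ck_on_linear_compose)

lemma smooth_on_frechet: "smooth_on S f \<Longrightarrow> smooth_on S (\<lambda>x. frechet_derivative f (at x) v)"
  unfolding smooth_on_def by (metis Ck_on.simps(2))

lemma smooth_on_partial: "smooth_on S f \<Longrightarrow> smooth_on S (partial i f)"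
  unfolding partial_def[abs_def] by (rule smooth_on_frechet)

lemma smooth_on_has_derivative:
  "smooth_on S f \<Longrightarrow> x \<in> S \<Longrightarrow> (f has_derivative frechet_derivative f (at x)) (at x)"
  unfolding smooth_on_def by (metis Ck_on_has_derivative)

lemma smooth_on_differentiable: "smooth_on S f \<Longrightarrow> x \<in> S \<Longrightarrow> f differentiable (at x)"
  using smooth_on_has_derivative differentiable_def by blast

lemma smooth_on_continuous: "smooth_on S f \<Longrightarrow> continuous_on S f"
  unfolding smooth_on_def by (metis Ck_on_imp_continuous_on)

lemma smooth_on_nth:
  fixes f :: "'a::real_normed_vector \<Rightarrow> 'b::real_normed_vector ^ 'n"
  shows "open S \<Longrightarrow> smooth_on S f \<Longrightarrow> smooth_on S (\<lambda>x. f x $ i)"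
  by (rule smooth_on_linear_compose[OF _ bounded_linear_vec_nth])

lemma smooth_on_vec:
  fixes f :: "'a::real_normed_vector \<Rightarrow> 'b::euclidean_space ^ 'n"
  assumes "open S" "\<And>i. smooth_on S (\<lambda>x. f x $ i)"
  shows "smooth_on S f"
proof -
  have "linear (axis i :: 'b \<Rightarrow> 'b ^ 'n)" for i
    by (rule linearI) (simp_all add: vec_eq_iff axis_def)
  then have "smooth_on S (\<lambda>x. \<Sum>i\<in>UNIV. axis i (f x $ i))"
    by (intro smooth_on_sum smooth_on_linear_compose[of _ "axis _"] assms)
      (simp_all add: linear_conv_bounded_linear)
  then show ?thesis
    by (rule smooth_on_cong[OF assms(1), rotated])
      (simp add: vec_eq_iff axis_def sum.delta cong: if_cong)
qed

lemma smooth_on_inverse: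
  fixes f :: "'a::real_normed_vector \<Rightarrow> real"
  assumes "open S" "smooth_on S f" "\<And>x. x \<in> S \<Longrightarrow> f x \<noteq> 0"
  shows "smooth_on S (\<lambda>x. inverse (f x))"
proof (rule smooth_on_compose[of S "- {0}" f])
  show "smooth_on (- {0::real}) inverse" by (simp add: smooth_on_def Ck_on_inverse_real)
qed (use assms in auto)

lemma smooth_on_divide:
  fixes f g :: "'a::real_normed_vector \<Rightarrow> real"
  shows "open S \<Longrightarrow> smooth_on S f \<Longrightarrow> smooth_on S g \<Longrightarrow> (\<And>x. x \<in> S \<Longrightarrow> g x \<noteq> 0) \<Longrightarrow>
    smooth_on S (\<lambda>x. f x / g x)"
  unfolding divide_inverse by (rule smooth_on_mult[OF _ _ smooth_on_inverse])

lemma Ck_on_sqrt: "Ck_on n {0<..} sqrt"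
proof (induction n)
  case (Suc n)
  have "Ck_on n {0<..} (\<lambda>x. inverse (sqrt x) / 2)"
    unfolding divide_inverse
    by (intro Ck_on_mult Ck_on_const open_greaterThan
        Ck_on_compose[of "{0<..}" "- {0}" sqrt n inverse, OF _ _ _ Suc Ck_on_inverse_real]) auto
  then show ?case
    by (rule Ck_on_real_SucI[rotated 2]) (simp_all add: DERIV_real_sqrt)
qed (auto intro!: continuous_intros)

lemma smooth_on_sqrt:
  assumes "open S" "smooth_on S f" "\<And>x. x \<in> S \<Longrightarrow> f x > 0"
  shows "smooth_on S (\<lambda>x. sqrt (f x))"
proof (rule smooth_on_compose[of S "{0<..}" f])
  show "smooth_on {0<..} sqrt" by (simp add: smooth_on_def Ck_on_sqrt)
qed (use assms in auto)

lemma smooth_on_ln: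
  fixes f :: "'a::real_normed_vector \<Rightarrow> real"
  assumes "open S" "smooth_on S f" "\<And>x. x \<in> S \<Longrightarrow> f x > 0"
  shows "smooth_on S (\<lambda>x. ln (f x))"
proof (rule smooth_on_compose[of S "{0<..}" f])
  show "smooth_on {0<..} (ln :: real \<Rightarrow> real)"
    by (rule smooth_on_real_SucI[of _ _ inverse])
      (use smooth_on_inverse[of "{0<..}" "\<lambda>x. x"] in \<open>auto simp: DERIV_ln smooth_on_ident\<close>)
qed (use assms in auto)

section \<open>Partial derivatives in the plane and their symmetry\<close>

lemma frechet_derivative_eq:
  "(f has_derivative f') (at x) \<Longrightarrow> frechet_derivative f (at x) = f'"
  using frechet_derivative_at by metis

lemma partial_eq: "(f has_derivative f') (at x) \<Longrightarrow> partial i f x = f' (axis i 1)"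
  unfolding partial_def by (simp add: frechet_derivative_eq)

lemma partial_cong_open:
  "open S \<Longrightarrow> x \<in> S \<Longrightarrow> (\<And>y. y \<in> S \<Longrightarrow> f y = g y) \<Longrightarrow> partial i f x = partial i g x"
  unfolding partial_def using frechet_derivative_cong_open by metis

lemma has_derivative_partial:
  fixes f :: "real^2 \<Rightarrow> real"
  assumes "f differentiable (at x)"
  shows "(f has_derivative (\<lambda>v. v $ 1 * partial 1 f x + v $ 2 * partial 2 f x)) (at x)"
proof -
  have D: "(f has_derivative frechet_derivative f (at x)) (at x)"
    using assms frechet_derivative_works by blast
  interpret lin: linear "frechet_derivative f (at x)" using D by (rule has_derivative_linear)
  have "v = v $ 1 *\<^sub>R axis 1 1 + v $ 2 *\<^sub>R axis 2 1" for v :: "real^2"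
    by (simp add: vec_eq_iff forall_2 axis_def)
  then have "frechet_derivative f (at x) v = v $ 1 * partial 1 f x + v $ 2 * partial 2 f x" for v
    unfolding partial_def by (metis lin.add lin.scale real_scaleR_def)
  then have "frechet_derivative f (at x) = (\<lambda>v. v $ 1 * partial 1 f x + v $ 2 * partial 2 f x)"
    by blast
  then show ?thesis using D by simp
qed

lemma partial_add: "f differentiable (at x) \<Longrightarrow> g differentiable (at x) \<Longrightarrow>
    partial i (\<lambda>x. f x + g x) x = partial i f x + partial i g x"
  using partial_eq[OF has_derivative_add] unfolding partial_def frechet_derivative_works by blast

lemma partial_diff: "f differentiable (at x) \<Longrightarrow> g differentiable (at x) \<Longrightarrow>
    partial i (\<lambda>x. f x - g x) x = partial i f x - partial i g x"
  using partial_eq[OF has_derivative_diff] unfolding partial_def frechet_derivative_works by blast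

lemma partial_mult:
  assumes "f differentiable (at x)" "g differentiable (at x)"
  shows "partial i (\<lambda>x. f x * g x) x = partial i f x * g x + f x * partial i g x"
  using assms[unfolded frechet_derivative_works]
  by (subst partial_eq[OF has_derivative_mult]) (auto simp: partial_def)

lemma partial_const [simp]: "partial i (\<lambda>_. c) x = 0"
  by (simp add: partial_def)

lemma partial_chain_real:
  assumes "(F has_real_derivative F') (at (f x))" "f differentiable (at x)"
  shows "partial i (\<lambda>x. F (f x)) x = F' * partial i f x"
proof -
  have "((\<lambda>x. F (f x)) has_derivative (\<lambda>v. F' * frechet_derivative f (at x) v)) (at x)"
    using has_derivative_compose[OF assms(2)[unfolded frechet_derivative_works]
        assms(1)[unfolded has_field_derivative_def]] .
  from partial_eq[OF this] show ?thesis unfolding partial_def .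
qed

lemma partial_compose:
  fixes \<tau> :: "real^2 \<Rightarrow> real^2"
  assumes "\<tau> differentiable (at x)" "f differentiable (at (\<tau> x))"
  shows "partial i (\<lambda>x. f (\<tau> x)) x =
    partial 1 f (\<tau> x) * partial i (\<lambda>x. \<tau> x $ 1) x + partial 2 f (\<tau> x) * partial i (\<lambda>x. \<tau> x $ 2) x"
proof -
  have \<tau>: "(\<tau> has_derivative frechet_derivative \<tau> (at x)) (at x)"
    using assms(1) frechet_derivative_works by blast
  have "partial i (\<lambda>x. \<tau> x $ j) x = frechet_derivative \<tau> (at x) (axis i 1) $ j" for j
    by (rule partial_eq[OF bounded_linear.has_derivative[OF bounded_linear_vec_nth \<tau>]])
  then show ?thesis
    using partial_eq[OF has_derivative_compose[OF \<tau> has_derivative_partial[OF assms(2)]], of i]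
    by (simp add: mult.commute)
qed

text \<open>Both mixed second derivatives are limits of the second difference quotient along the
  parallelogram spanned by \<open>t v\<close> and \<open>t w\<close>, by two applications of the mean value theorem.\<close>

lemma second_difference:
  fixes f :: "'a::real_normed_vector \<Rightarrow> real"
  assumes "open S" "Ck_on 2 S f" "t > 0"
    and S: "\<And>a b. 0 \<le> a \<Longrightarrow> a \<le> t \<Longrightarrow> 0 \<le> b \<Longrightarrow> b \<le> t \<Longrightarrow> x + a *\<^sub>R v + b *\<^sub>R w \<in> S"
  obtains a b where "0 \<le> a" "a \<le> t" "0 \<le> b" "b \<le> t"
    "f (x + t *\<^sub>R v + t *\<^sub>R w) - f (x + t *\<^sub>R v) - f (x + t *\<^sub>R w) + f x =
      t * t * frechet_derivative (\<lambda>y. frechet_derivative f (at y) v) (at (x + a *\<^sub>R v + b *\<^sub>R w)) w"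
proof -
  have f: "(f has_derivative frechet_derivative f (at y)) (at y)" if "y \<in> S" for y
    using assms(2) Ck_on_has_derivative that by (metis numeral_2_eq_2)
  let ?g = "\<lambda>y. frechet_derivative f (at y) v"
  have g: "(?g has_derivative frechet_derivative ?g (at y)) (at y)" if "y \<in> S" for y
    using assms(2) Ck_on_has_derivative[of 0 S ?g] that by (simp add: numeral_2_eq_2)
  let ?h = "\<lambda>a. f (x + a *\<^sub>R v + t *\<^sub>R w) - f (x + a *\<^sub>R v)"
  have "(?h has_real_derivative ?g (x + a *\<^sub>R v + t *\<^sub>R w) - ?g (x + a *\<^sub>R v)) (at a)"
    if "0 \<le> a" "a \<le> t" for a
  proof -
    have 1: "x + a *\<^sub>R v + t *\<^sub>R w \<in> S" using S[of a t] that assms(3) by simp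
    have 2: "x + a *\<^sub>R v \<in> S" using S[of a 0] that assms(3) by simp
    have l: "linear (frechet_derivative f (at y))" if "y \<in> S" for y
      using f[OF that] by (rule has_derivative_linear)
    have "((\<lambda>a. x + a *\<^sub>R v + t *\<^sub>R w) has_derivative (\<lambda>s. s *\<^sub>R v)) (at a)"
      by (auto intro!: derivative_eq_intros)
    from has_derivative_compose[OF this f[OF 1]]
    have h1: "((\<lambda>a. f (x + a *\<^sub>R v + t *\<^sub>R w)) has_derivative (\<lambda>s. ?g (x + a *\<^sub>R v + t *\<^sub>R w) * s)) (at a)"
      by (simp add: linear_scale[OF l[OF 1]] mult.commute)
    have "((\<lambda>a. x + a *\<^sub>R v) has_derivative (\<lambda>s. s *\<^sub>R v)) (at a)"
      by (auto intro!: derivative_eq_intros)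
    from has_derivative_compose[OF this f[OF 2]]
    have h2: "((\<lambda>a. f (x + a *\<^sub>R v)) has_derivative (\<lambda>s. ?g (x + a *\<^sub>R v) * s)) (at a)"
      by (simp add: linear_scale[OF l[OF 2]] mult.commute)
    show ?thesis using h1 h2 unfolding has_field_derivative_def[symmetric] by (rule DERIV_diff)
  qed
  from MVT2[OF assms(3) this] obtain a where a: "0 < a" "a < t"
    "?h t - ?h 0 = t * (?g (x + a *\<^sub>R v + t *\<^sub>R w) - ?g (x + a *\<^sub>R v))" by auto
  let ?k = "\<lambda>b. ?g (x + a *\<^sub>R v + b *\<^sub>R w)"
  have "(?k has_real_derivative frechet_derivative ?g (at (x + a *\<^sub>R v + b *\<^sub>R w)) w) (at b)"
    if "0 \<le> b" "b \<le> t" for b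
  proof -
    have 1: "x + a *\<^sub>R v + b *\<^sub>R w \<in> S" using S[of a b] that a by simp
    have "((\<lambda>b. x + a *\<^sub>R v + b *\<^sub>R w) has_derivative (\<lambda>s. s *\<^sub>R w)) (at b)"
      by (auto intro!: derivative_eq_intros)
    from has_derivative_compose[OF this g[OF 1]]
    show ?thesis
      by (simp add: linear_scale[OF has_derivative_linear[OF g[OF 1]]] mult_commute_abs
          has_field_derivative_def)
  qed
  from MVT2[OF assms(3) this] obtain b where b: "0 < b" "b < t"
    "?k t - ?k 0 = t * frechet_derivative ?g (at (x + a *\<^sub>R v + b *\<^sub>R w)) w" by auto
  show ?thesis
    by (rule that[of a b]) (use a b in auto)
qed

text \<open>The second difference is symmetric in v and w, so the two mixed derivatives take a
  common value at two points of a small parallelogram. Continuity carries this equality to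
  x.\<close>

lemma mixed_derivatives_commute:
  fixes f :: "'a::real_normed_vector \<Rightarrow> real"
  assumes "open S" "Ck_on 2 S f" "x \<in> S"
  shows "frechet_derivative (\<lambda>y. frechet_derivative f (at y) v) (at x) w =
         frechet_derivative (\<lambda>y. frechet_derivative f (at y) w) (at x) v"
proof (rule ccontr)
  let ?F = "\<lambda>y. frechet_derivative (\<lambda>y. frechet_derivative f (at y) v) (at y) w"
  let ?G = "\<lambda>y. frechet_derivative (\<lambda>y. frechet_derivative f (at y) w) (at y) v"
  assume ne: "?F x \<noteq> ?G x"
  define e where "e = \<bar>?F x - ?G x\<bar> / 2"
  have e: "e > 0" using ne by (simp add: e_def)
  have "continuous_on S ?F" "continuous_on S ?G" using assms(2) by (simp_all add: numeral_2_eq_2)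
  then have cont: "isCont ?F x" "isCont ?G x"
    using assms(1,3) continuous_on_eq_continuous_at by blast+
  have "\<forall>\<^sub>F y in nhds x. dist (?F y) (?F x) < e" "\<forall>\<^sub>F y in nhds x. dist (?G y) (?G x) < e"
    using cont e by (auto simp: isCont_def tendsto_iff eventually_at_filter eventually_mono
        elim!: eventually_mono)
  then have "\<forall>\<^sub>F y in nhds x. y \<in> S \<and> dist (?F y) (?F x) < e \<and> dist (?G y) (?G x) < e"
    using assms(1,3) by (auto intro!: eventually_conj eventually_nhds_in_open)
  then obtain d where d: "d > 0"
    "\<And>y. dist y x < d \<Longrightarrow> y \<in> S \<and> dist (?F y) (?F x) < e \<and> dist (?G y) (?G x) < e"
    unfolding eventually_nhds_metric by blast
  \<comment> \<open>The whole parallelogram then lies in the ball of radius d; the 1 keeps the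
    denominator positive when v and w both vanish.\<close>
  define t where "t = d / (2 * (norm v + norm w + 1))"
  have nn: "norm v + norm w + 1 > 0" by (smt (verit) norm_ge_zero)
  have t: "t > 0" using d(1) nn by (simp add: t_def)
  have near: "dist (x + a *\<^sub>R v + b *\<^sub>R w) x < d" if "0 \<le> a" "a \<le> t" "0 \<le> b" "b \<le> t" for a b
  proof -
    have "dist (x + a *\<^sub>R v + b *\<^sub>R w) x = norm (a *\<^sub>R v + b *\<^sub>R w)" by (simp add: dist_norm algebra_simps)
    also have "\<dots> \<le> a * norm v + b * norm w"
      using norm_triangle_ineq[of "a *\<^sub>R v" "b *\<^sub>R w"] that by simp
    also have "\<dots> \<le> t * norm v + t * norm w" using that by (intro add_mono mult_right_mono) auto
    also have "\<dots> < t * (2 * (norm v + norm w + 1))"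
    proof -
      have "0 \<le> s \<Longrightarrow> s < 2 * (s + 1)" for s :: real by (simp add: algebra_simps)
      from this[of "norm v + norm w"] have "norm v + norm w < 2 * (norm v + norm w + 1)" by simp
      then show ?thesis using t by (metis distrib_left mult_strict_left_mono)
    qed
    also have "\<dots> = d" using nn by (simp add: t_def)
    finally show ?thesis .
  qed
  obtain a b where ab: "0 \<le> a" "a \<le> t" "0 \<le> b" "b \<le> t"
    "f (x + t *\<^sub>R v + t *\<^sub>R w) - f (x + t *\<^sub>R v) - f (x + t *\<^sub>R w) + f x = t * t * ?F (x + a *\<^sub>R v + b *\<^sub>R w)"
    using second_difference[OF assms(1,2) t, of x v w] d(2)[OF near] by metis
  have near': "x + a *\<^sub>R w + b *\<^sub>R v \<in> S" if "0 \<le> a" "a \<le> t" "0 \<le> b" "b \<le> t" for a b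
    using d(2)[OF near[of b a]] that by (simp add: algebra_simps)
  obtain a' b' where ab': "0 \<le> a'" "a' \<le> t" "0 \<le> b'" "b' \<le> t"
    "f (x + t *\<^sub>R w + t *\<^sub>R v) - f (x + t *\<^sub>R w) - f (x + t *\<^sub>R v) + f x = t * t * ?G (x + a' *\<^sub>R w + b' *\<^sub>R v)"
    using second_difference[OF assms(1,2) t, of x w v] near' by metis
  have "t * t * ?F (x + a *\<^sub>R v + b *\<^sub>R w) = t * t * ?G (x + b' *\<^sub>R v + a' *\<^sub>R w)"
    using ab(5) ab'(5) by (simp add: algebra_simps)
  then have "?F (x + a *\<^sub>R v + b *\<^sub>R w) = ?G (x + b' *\<^sub>R v + a' *\<^sub>R w)" using t by simp
  moreover have "dist (?F (x + a *\<^sub>R v + b *\<^sub>R w)) (?F x) < e" using d(2) near ab by blast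
  moreover have "dist (?G (x + b' *\<^sub>R v + a' *\<^sub>R w)) (?G x) < e" using d(2) near ab' by blast
  moreover have "\<bar>?F x - ?G x\<bar> = e + e" by (simp add: e_def)
  ultimately show False unfolding dist_real_def by linarith
qed

lemma partial_commute:
  assumes "open S" "smooth_on S f" "x \<in> S"
  shows "partial i (partial j f) x = partial j (partial i f) x"
  unfolding partial_def[abs_def]
  using mixed_derivatives_commute[OF assms(1) _ assms(3)] assms(2) unfolding smooth_on_def by blast

section \<open>Coframes and curvature\<close>

lemma det_2x2: "det (A :: real^2^2) = A $ 1 $ 1 * A $ 2 $ 2 - A $ 1 $ 2 * A $ 2 $ 1"
  by (simp add: det_2)

text \<open>\<open>h x $ i $ j\<close> is the value of the \<open>i\<close>-th form of an oriented orthonormal coframe on the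
  \<open>j\<close>-th coordinate vector.\<close>

definition coframe_on :: "(real^2) set \<Rightarrow> (real^2 \<Rightarrow> real^2^2) \<Rightarrow> (real^2 \<Rightarrow> real^2^2) \<Rightarrow> bool" where
  "coframe_on U g h \<longleftrightarrow> open U \<and> smooth_on U h \<and>
     (\<forall>x\<in>U. det (h x) > 0 \<and>
       (\<forall>i j. g x $ i $ j = h x $ 1 $ i * h x $ 1 $ j + h x $ 2 $ i * h x $ 2 $ j))"

text \<open>The coefficient of the exterior derivative of the k-th coframe form on the coordinate
  area form.\<close>

definition curl :: "2 \<Rightarrow> (real^2 \<Rightarrow> real^2^2) \<Rightarrow> real^2 \<Rightarrow> real" where
  "curl k h x = partial 1 (\<lambda>y. h y $ k $ 2) x - partial 2 (\<lambda>y. h y $ k $ 1) x"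

text \<open>The components of the connection form, solved from
  \<open>d\<eta>\<^sup>1 = - \<eta>\<^sup>1\<^sub>2 \<and> \<eta>\<^sup>2\<close> and \<open>d\<eta>\<^sup>2 = \<eta>\<^sup>1\<^sub>2 \<and> \<eta>\<^sup>1\<close>.\<close>

definition conn :: "(real^2 \<Rightarrow> real^2^2) \<Rightarrow> 2 \<Rightarrow> real^2 \<Rightarrow> real" where
  "conn h i x = - (curl 1 h x * h x $ 1 $ i + curl 2 h x * h x $ 2 $ i) / det (h x)"

section \<open>Cartan's structure equations in a chart\<close>

context
  fixes U g h assumes cf: "coframe_on U g h"
begin

lemma coframe_open: "open U" using cf by (simp add: coframe_on_def)

lemma coframe_det: "x \<in> U \<Longrightarrow> det (h x) > 0" using cf by (simp add: coframe_on_def)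

lemma coframe_metric:
  "x \<in> U \<Longrightarrow> g x $ i $ j = h x $ 1 $ i * h x $ 1 $ j + h x $ 2 $ i * h x $ 2 $ j"
  using cf unfolding coframe_on_def by blast

lemma coframe_smooth: "smooth_on U (\<lambda>y. h y $ k $ j)"
  using cf by (auto simp: coframe_on_def intro!: smooth_on_nth)

lemma coframe_det_smooth: "smooth_on U (\<lambda>y. det (h y))"
  unfolding det_2x2 by (intro smooth_on_diff smooth_on_mult coframe_smooth coframe_open)

lemma curl_smooth: "smooth_on U (curl k h)"
  unfolding curl_def[abs_def]
  by (intro smooth_on_diff smooth_on_partial coframe_smooth coframe_open)

lemma conn_smooth: "smooth_on U (conn h i)"
  unfolding conn_def[abs_def]
  by (intro smooth_on_divide smooth_on_uminus smooth_on_add smooth_on_mult coframe_smooth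
      coframe_open coframe_det_smooth curl_smooth) (use coframe_det in force)

text \<open>These are the two torsion-free structure equations evaluated on the pair of coordinate
  vectors. \<open>conn\<close> is their solution, so multiplying by the determinant turns both into
  identities.\<close>

lemma coframe_structure:
  assumes "x \<in> U"
  shows "curl 1 h x = - (conn h 1 x * h x $ 2 $ 2 - conn h 2 x * h x $ 2 $ 1)"
    and "curl 2 h x = conn h 1 x * h x $ 1 $ 2 - conn h 2 x * h x $ 1 $ 1"
proof -
  have D: "det (h x) \<noteq> 0" using coframe_det[OF assms] by simp
  have c: "conn h i x * det (h x) = - (curl 1 h x * h x $ 1 $ i + curl 2 h x * h x $ 2 $ i)" for i
    using D by (simp add: conn_def)
  have "curl 1 h x * det (h x) =
      - (conn h 1 x * det (h x) * h x $ 2 $ 2 - conn h 2 x * det (h x) * h x $ 2 $ 1)"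
    unfolding c unfolding det_2x2 by (simp add: algebra_simps)
  also have "\<dots> = - (conn h 1 x * h x $ 2 $ 2 - conn h 2 x * h x $ 2 $ 1) * det (h x)"
    by (simp add: algebra_simps)
  finally show "curl 1 h x = - (conn h 1 x * h x $ 2 $ 2 - conn h 2 x * h x $ 2 $ 1)"
    using D by simp
  have "curl 2 h x * det (h x) =
      conn h 1 x * det (h x) * h x $ 1 $ 2 - conn h 2 x * det (h x) * h x $ 1 $ 1"
    unfolding c unfolding det_2x2 by (simp add: algebra_simps)
  also have "\<dots> = (conn h 1 x * h x $ 1 $ 2 - conn h 2 x * h x $ 1 $ 1) * det (h x)"
    by (simp add: algebra_simps)
  finally show "curl 2 h x = conn h 1 x * h x $ 1 $ 2 - conn h 2 x * h x $ 1 $ 1"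
    using D by simp
qed

lemma partial_metric:
  assumes "x \<in> U"
  shows "partial i (\<lambda>y. g y $ k $ l) x =
    partial i (\<lambda>y. h y $ 1 $ k) x * h x $ 1 $ l + h x $ 1 $ k * partial i (\<lambda>y. h y $ 1 $ l) x +
    (partial i (\<lambda>y. h y $ 2 $ k) x * h x $ 2 $ l + h x $ 2 $ k * partial i (\<lambda>y. h y $ 2 $ l) x)"
proof -
  have d: "(\<lambda>y. h y $ k $ l) differentiable (at x)" for k l
    using smooth_on_differentiable[OF coframe_smooth assms] .
  have "partial i (\<lambda>y. g y $ k $ l) x =
      partial i (\<lambda>y. h y $ 1 $ k * h y $ 1 $ l + h y $ 2 $ k * h y $ 2 $ l) x"
    by (rule partial_cong_open[OF coframe_open assms]) (rule coframe_metric)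
  also have "\<dots> = partial i (\<lambda>y. h y $ 1 $ k * h y $ 1 $ l) x + partial i (\<lambda>y. h y $ 2 $ k * h y $ 2 $ l) x"
    by (intro partial_add differentiable_mult d)
  finally show ?thesis unfolding partial_mult[OF d d] .
qed

lemma coframe_metric_invertible:
  assumes "x \<in> U"
  shows "g x ** matrix_inv (g x) = mat 1" "det (g x) = (det (h x))\<^sup>2"
proof -
  show det: "det (g x) = (det (h x))\<^sup>2"
    unfolding det_2x2 coframe_metric[OF assms] by (simp add: power2_eq_square algebra_simps)
  then have "invertible (g x)" using coframe_det[OF assms] by (simp add: invertible_det_nz)
  then show "g x ** matrix_inv (g x) = mat 1"
    unfolding invertible_def matrix_inv_def by (rule someI2_ex) simp
qed

text \<open>The left sides are the coframe components of the Levi-Civita derivative of one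
  coordinate vector along another. Both sides solve the same linear system with matrix the transpose
  of h, whose determinant is nonzero.\<close>

lemma christoffel_coframe:
  assumes "x \<in> U"
  shows "h x $ 1 $ 1 * christoffel g 1 a b x + h x $ 1 $ 2 * christoffel g 2 a b x =
      partial a (\<lambda>y. h y $ 1 $ b) x + conn h a x * h x $ 2 $ b" (is "?N1 = ?R1")
    and "h x $ 2 $ 1 * christoffel g 1 a b x + h x $ 2 $ 2 * christoffel g 2 a b x =
      partial a (\<lambda>y. h y $ 2 $ b) x - conn h a x * h x $ 1 $ b" (is "?N2 = ?R2")
proof -
  \<comment> \<open>The Christoffel symbol of the first kind: contracting with the metric undoes the
    inverse matrix in the definition of \<open>christoffel\<close>.\<close>
  define T where "T l = (partial a (\<lambda>y. g y $ l $ b) x + partial b (\<lambda>y. g y $ l $ a) x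
      - partial l (\<lambda>y. g y $ a $ b) x) / 2" for l
  define M where "M = matrix_inv (g x)"
  have chr: "christoffel g k a b x = M $ k $ 1 * T 1 + M $ k $ 2 * T 2" for k
    unfolding christoffel_def T_def M_def by (simp add: UNIV_2 field_simps)
  have M: "g x $ m $ 1 * M $ 1 $ l + g x $ m $ 2 * M $ 2 $ l = (if m = l then 1 else 0)" for m l
  proof -
    have "(g x ** M) $ m $ l = mat 1 $ m $ l"
      using coframe_metric_invertible[OF assms] by (simp add: M_def)
    then show ?thesis by (simp add: matrix_matrix_mult_def UNIV_2 mat_def)
  qed
  have gT: "g x $ m $ 1 * christoffel g 1 a b x + g x $ m $ 2 * christoffel g 2 a b x = T m" for m
  proof -
    have "g x $ m $ 1 * christoffel g 1 a b x + g x $ m $ 2 * christoffel g 2 a b x =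
      (g x $ m $ 1 * M $ 1 $ 1 + g x $ m $ 2 * M $ 2 $ 1) * T 1 +
      (g x $ m $ 1 * M $ 1 $ 2 + g x $ m $ 2 * M $ 2 $ 2) * T 2"
      unfolding chr by (simp add: algebra_simps)
    also have "\<dots> = T m" unfolding M using exhaust_2[of m] by auto
    finally show ?thesis .
  qed
  have lhs: "h x $ 1 $ m * ?N1 + h x $ 2 $ m * ?N2 = T m" for m
    using gT[of m] unfolding coframe_metric[OF assms] by (simp add: algebra_simps)
  have D: "det (h x) \<noteq> 0" using coframe_det[OF assms] by simp
  have c: "conn h i x * det (h x) = - (curl 1 h x * h x $ 1 $ i + curl 2 h x * h x $ 2 $ i)" for i
    using D by (simp add: conn_def)
  have T2: "2 * T m = partial a (\<lambda>y. g y $ m $ b) x + partial b (\<lambda>y. g y $ m $ a) x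
      - partial m (\<lambda>y. g y $ a $ b) x" for m
    by (simp add: T_def)
  \<comment> \<open>The factor 2 clears the half in \<open>T\<close>. In each of the eight index
    cases the identity reduces to the definition of \<open>conn\<close> with the curls written
    out.\<close>
  have two: "2 * (h x $ 1 $ m * ?R1 + h x $ 2 $ m * ?R2) = 2 * T m" for m
    unfolding T2 partial_metric[OF assms]
    using exhaust_2[of m] exhaust_2[of a] exhaust_2[of b]
    by (elim disjE) (use c[of 1, unfolded det_2x2 curl_def] c[of 2, unfolded det_2x2 curl_def]
      in \<open>simp_all add: algebra_simps\<close>)
  have rhs: "h x $ 1 $ m * ?R1 + h x $ 2 $ m * ?R2 = T m" for m
    using two[of m] by (simp only: mult_cancel_left) simp
  have eq: "h x $ 1 $ m * (?N1 - ?R1) + h x $ 2 $ m * (?N2 - ?R2) = 0" for m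
    using lhs[of m] rhs[of m] by (simp add: algebra_simps)
  have "det (h x) * (?N1 - ?R1) = h x $ 2 $ 2 * (h x $ 1 $ 1 * (?N1 - ?R1) + h x $ 2 $ 1 * (?N2 - ?R2))
      - h x $ 2 $ 1 * (h x $ 1 $ 2 * (?N1 - ?R1) + h x $ 2 $ 2 * (?N2 - ?R2))"
    unfolding det_2x2 by algebra
  then show "?N1 = ?R1" unfolding eq using D by simp
  have "det (h x) * (?N2 - ?R2) = h x $ 1 $ 1 * (h x $ 1 $ 2 * (?N1 - ?R1) + h x $ 2 $ 2 * (?N2 - ?R2))
      - h x $ 1 $ 2 * (h x $ 1 $ 1 * (?N1 - ?R1) + h x $ 2 $ 1 * (?N2 - ?R2))"
    unfolding det_2x2 by algebra
  then show "?N2 = ?R2" unfolding eq using D by simp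
qed

lemma christoffel_smooth: "smooth_on U (christoffel g k a b)"
proof -
  define R1 where "R1 x = partial a (\<lambda>y. h y $ 1 $ b) x + conn h a x * h x $ 2 $ b" for x
  define R2 where "R2 x = partial a (\<lambda>y. h y $ 2 $ b) x - conn h a x * h x $ 1 $ b" for x
  have R: "smooth_on U R1" "smooth_on U R2" unfolding R1_def[abs_def] R2_def[abs_def]
    by (intro smooth_on_add smooth_on_diff smooth_on_mult smooth_on_partial coframe_smooth
        coframe_open conn_smooth)+
  have 1: "(h x $ 2 $ 2 * R1 x - h x $ 1 $ 2 * R2 x) / det (h x) = christoffel g 1 a b x"
    and 2: "(h x $ 1 $ 1 * R2 x - h x $ 2 $ 1 * R1 x) / det (h x) = christoffel g 2 a b x"
    if "x \<in> U" for x
    using coframe_det[OF that] unfolding R1_def R2_def christoffel_coframe[OF that, symmetric]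
    by (simp_all add: divide_eq_eq) (simp_all add: det_2x2 algebra_simps)
  have "smooth_on U (\<lambda>x. (h x $ 2 $ 2 * R1 x - h x $ 1 $ 2 * R2 x) / det (h x))"
    "smooth_on U (\<lambda>x. (h x $ 1 $ 1 * R2 x - h x $ 2 $ 1 * R1 x) / det (h x))"
    by (intro smooth_on_divide smooth_on_diff smooth_on_mult coframe_smooth coframe_open R
        coframe_det_smooth, use coframe_det in force)+
  then have "smooth_on U (christoffel g 1 a b)" "smooth_on U (christoffel g 2 a b)"
    by (auto intro: smooth_on_cong[OF coframe_open 1] smooth_on_cong[OF coframe_open 2])
  then show ?thesis using exhaust_2[of k] by auto
qed

text \<open>This is the equation d \<eta>^1_2 = K \<eta>^1 \<and> \<eta>^2. On differentiating the
  formulas for the Christoffel symbols, the second derivatives of h cancel by symmetry and the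
  quadratic terms cancel the products of \<open>conn\<close> with first derivatives; the coframe
  components \<open>Y1\<close> and \<open>Y2\<close> of the curvature vector are what
  remains.\<close>

lemma curvature_coframe:
  assumes "x \<in> U"
  shows "gauss_curvature g x * det (h x) = partial 1 (conn h 2) x - partial 2 (conn h 1) x"
proof -
  let ?G = "\<lambda>k a b. christoffel g k a b"
  let ?dc = "partial 1 (conn h 2) x - partial 2 (conn h 1) x"
  note dif = smooth_on_differentiable[OF _ assms]
  note dh = dif[OF coframe_smooth] and dG = dif[OF christoffel_smooth] and dc = dif[OF conn_smooth]
    and ddh = dif[OF smooth_on_partial[OF coframe_smooth]]
  have e1: "partial e (\<lambda>y. h y $ 1 $ 1 * ?G 1 a 2 y + h y $ 1 $ 2 * ?G 2 a 2 y) x =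
     partial e (\<lambda>y. partial a (\<lambda>y. h y $ 1 $ 2) y + conn h a y * h y $ 2 $ 2) x" for e a
    by (rule partial_cong_open[OF coframe_open assms]) (rule christoffel_coframe)
  have e2: "partial e (\<lambda>y. h y $ 2 $ 1 * ?G 1 a 2 y + h y $ 2 $ 2 * ?G 2 a 2 y) x =
     partial e (\<lambda>y. partial a (\<lambda>y. h y $ 2 $ 2) y - conn h a y * h y $ 1 $ 2) x" for e a
    by (rule partial_cong_open[OF coframe_open assms]) (rule christoffel_coframe)
  note d = partial_add partial_diff partial_mult differentiable_mult dh dG dc ddh
  have E1: "partial e (\<lambda>y. h y $ 1 $ 1) x * ?G 1 a 2 x + h x $ 1 $ 1 * partial e (?G 1 a 2) x +
      (partial e (\<lambda>y. h y $ 1 $ 2) x * ?G 2 a 2 x + h x $ 1 $ 2 * partial e (?G 2 a 2) x) =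
      partial e (partial a (\<lambda>y. h y $ 1 $ 2)) x +
      (partial e (conn h a) x * h x $ 2 $ 2 + conn h a x * partial e (\<lambda>y. h y $ 2 $ 2) x)" for e a
    using e1[of e a] by (simp add: d)
  have E2: "partial e (\<lambda>y. h y $ 2 $ 1) x * ?G 1 a 2 x + h x $ 2 $ 1 * partial e (?G 1 a 2) x +
      (partial e (\<lambda>y. h y $ 2 $ 2) x * ?G 2 a 2 x + h x $ 2 $ 2 * partial e (?G 2 a 2) x) =
      partial e (partial a (\<lambda>y. h y $ 2 $ 2)) x -
      (partial e (conn h a) x * h x $ 1 $ 2 + conn h a x * partial e (\<lambda>y. h y $ 1 $ 2) x)" for e a
    using e2[of e a] by (simp add: d)
  have E1': "h x $ 1 $ 1 * partial e (?G 1 a 2) x + h x $ 1 $ 2 * partial e (?G 2 a 2) x =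
      partial e (partial a (\<lambda>y. h y $ 1 $ 2)) x +
      (partial e (conn h a) x * h x $ 2 $ 2 + conn h a x * partial e (\<lambda>y. h y $ 2 $ 2) x)
      - partial e (\<lambda>y. h y $ 1 $ 1) x * ?G 1 a 2 x - partial e (\<lambda>y. h y $ 1 $ 2) x * ?G 2 a 2 x" for e a
    using E1[of e a] by linarith
  have E2': "h x $ 2 $ 1 * partial e (?G 1 a 2) x + h x $ 2 $ 2 * partial e (?G 2 a 2) x =
      partial e (partial a (\<lambda>y. h y $ 2 $ 2)) x -
      (partial e (conn h a) x * h x $ 1 $ 2 + conn h a x * partial e (\<lambda>y. h y $ 1 $ 2) x)
      - partial e (\<lambda>y. h y $ 2 $ 1) x * ?G 1 a 2 x - partial e (\<lambda>y. h y $ 2 $ 2) x * ?G 2 a 2 x" for e a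
    using E2[of e a] by linarith
  have sym: "partial 1 (partial 2 (\<lambda>y. h y $ k $ 2)) x = partial 2 (partial 1 (\<lambda>y. h y $ k $ 2)) x" for k
    by (rule partial_commute[OF coframe_open coframe_smooth assms])
  note C = christoffel_coframe[OF assms]
  define X1 where "X1 = curvature_component g 1 x"
  define X2 where "X2 = curvature_component g 2 x"
  have X: "curvature_component g l x = partial 1 (?G l 2 2) x - partial 2 (?G l 1 2) x
     + ((?G 1 2 2 x * ?G l 1 1 x - ?G 1 1 2 x * ?G l 2 1 x)
      + (?G 2 2 2 x * ?G l 1 2 x - ?G 2 1 2 x * ?G l 2 2 x))" for l
    by (simp add: curvature_component_def UNIV_2)
  have Y1: "h x $ 1 $ 1 * X1 + h x $ 1 $ 2 * X2 = ?dc * h x $ 2 $ 2"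
  proof -
    define W where "W a = h x $ 2 $ 1 * ?G 1 a 2 x + h x $ 2 $ 2 * ?G 2 a 2 x" for a
    have W: "W a = partial a (\<lambda>y. h y $ 2 $ 2) x - conn h a x * h x $ 1 $ 2" for a
      unfolding W_def C ..
    have "h x $ 1 $ 1 * X1 + h x $ 1 $ 2 * X2 =
      (h x $ 1 $ 1 * partial 1 (?G 1 2 2) x + h x $ 1 $ 2 * partial 1 (?G 2 2 2) x)
      - (h x $ 1 $ 1 * partial 2 (?G 1 1 2) x + h x $ 1 $ 2 * partial 2 (?G 2 1 2) x)
      + ?G 1 2 2 x * (h x $ 1 $ 1 * ?G 1 1 1 x + h x $ 1 $ 2 * ?G 2 1 1 x)
      - ?G 1 1 2 x * (h x $ 1 $ 1 * ?G 1 2 1 x + h x $ 1 $ 2 * ?G 2 2 1 x)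
      + ?G 2 2 2 x * (h x $ 1 $ 1 * ?G 1 1 2 x + h x $ 1 $ 2 * ?G 2 1 2 x)
      - ?G 2 1 2 x * (h x $ 1 $ 1 * ?G 1 2 2 x + h x $ 1 $ 2 * ?G 2 2 2 x)"
      unfolding X1_def X2_def X by (simp add: algebra_simps)
    also have "\<dots> = (partial 1 (conn h 2) x * h x $ 2 $ 2 - partial 2 (conn h 1) x * h x $ 2 $ 2
        + conn h 2 x * partial 1 (\<lambda>y. h y $ 2 $ 2) x - conn h 1 x * partial 2 (\<lambda>y. h y $ 2 $ 2) x
        + conn h 1 x * W 2 - conn h 2 x * W 1) * (1)"
      unfolding C unfolding E1'[of 1 2] E1'[of 2 1] sym[of 1] W_def by (simp add: algebra_simps)
    also have "\<dots> = ?dc * h x $ 2 $ 2" unfolding W by (simp add: algebra_simps)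
    finally show ?thesis .
  qed
  have Y2: "h x $ 2 $ 1 * X1 + h x $ 2 $ 2 * X2 = - ?dc * h x $ 1 $ 2"
  proof -
    define W where "W a = h x $ 1 $ 1 * ?G 1 a 2 x + h x $ 1 $ 2 * ?G 2 a 2 x" for a
    have W: "W a = partial a (\<lambda>y. h y $ 1 $ 2) x + conn h a x * h x $ 2 $ 2" for a
      unfolding W_def C ..
    have "h x $ 2 $ 1 * X1 + h x $ 2 $ 2 * X2 =
      (h x $ 2 $ 1 * partial 1 (?G 1 2 2) x + h x $ 2 $ 2 * partial 1 (?G 2 2 2) x)
      - (h x $ 2 $ 1 * partial 2 (?G 1 1 2) x + h x $ 2 $ 2 * partial 2 (?G 2 1 2) x)
      + ?G 1 2 2 x * (h x $ 2 $ 1 * ?G 1 1 1 x + h x $ 2 $ 2 * ?G 2 1 1 x)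
      - ?G 1 1 2 x * (h x $ 2 $ 1 * ?G 1 2 1 x + h x $ 2 $ 2 * ?G 2 2 1 x)
      + ?G 2 2 2 x * (h x $ 2 $ 1 * ?G 1 1 2 x + h x $ 2 $ 2 * ?G 2 1 2 x)
      - ?G 2 1 2 x * (h x $ 2 $ 1 * ?G 1 2 2 x + h x $ 2 $ 2 * ?G 2 2 2 x)"
      unfolding X1_def X2_def X by (simp add: algebra_simps)
    also have "\<dots> = (partial 1 (conn h 2) x * h x $ 1 $ 2 - partial 2 (conn h 1) x * h x $ 1 $ 2
        + conn h 2 x * partial 1 (\<lambda>y. h y $ 1 $ 2) x - conn h 1 x * partial 2 (\<lambda>y. h y $ 1 $ 2) x
        + conn h 1 x * W 2 - conn h 2 x * W 1) * (-1)"
      unfolding C unfolding E2'[of 1 2] E2'[of 2 1] sym[of 2] W_def by (simp add: algebra_simps)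
    also have "\<dots> = - ?dc * h x $ 1 $ 2" unfolding W by (simp add: algebra_simps)
    finally show ?thesis .
  qed
  \<comment> \<open>Lowering the index with the metric contracts \<open>Y1\<close> and
    \<open>Y2\<close> with the first column of h, which completes the determinant of h.\<close>
  have "g x $ 1 $ 1 * X1 + g x $ 1 $ 2 * X2 =
      h x $ 1 $ 1 * (h x $ 1 $ 1 * X1 + h x $ 1 $ 2 * X2) + h x $ 2 $ 1 * (h x $ 2 $ 1 * X1 + h x $ 2 $ 2 * X2)"
    unfolding coframe_metric[OF assms] by (simp add: algebra_simps)
  also have "\<dots> = ?dc * det (h x)" unfolding Y1 Y2 det_2x2 by (simp add: algebra_simps)
  finally show ?thesis
    using coframe_det[OF assms] unfolding gauss_curvature_def coframe_metric_invertible(2)[OF assms]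
    by (simp add: UNIV_2 X1_def X2_def power2_eq_square)
qed

lemma curvature_smooth: "smooth_on U (gauss_curvature g)"
proof -
  have "gauss_curvature g x = (partial 1 (conn h 2) x - partial 2 (conn h 1) x) / det (h x)"
    if "x \<in> U" for x
    using curvature_coframe[OF that] coframe_det[OF that] by (simp add: field_simps)
  moreover have "smooth_on U (\<lambda>x. (partial 1 (conn h 2) x - partial 2 (conn h 1) x) / det (h x))"
    by (intro smooth_on_divide smooth_on_diff smooth_on_partial conn_smooth coframe_det_smooth coframe_open)
      (use coframe_det in force)
  ultimately show ?thesis
    using smooth_on_cong[OF coframe_open, of "\<lambda>x. (partial 1 (conn h 2) x - partial 2 (conn h 1) x) / det (h x)"
        "gauss_curvature g"] by simp
qed

end

section \<open>Existence of coframes and change of coordinates\<close>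

text \<open>Gram-Schmidt, in the form of a Cholesky factorization: the upper triangular factor with
  positive diagonal is smooth because only square roots of positive functions occur.\<close>

lemma coframe_exists:
  assumes "open U" "smooth_on U g"
    and sym: "\<And>x. x \<in> U \<Longrightarrow> transpose (g x) = g x"
    and pos: "\<And>x a. x \<in> U \<Longrightarrow> a \<noteq> 0 \<Longrightarrow> a \<bullet> (g x *v a) > 0"
  obtains h where "coframe_on U g h"
proof -
  have q: "a \<bullet> (g x *v a) = a $ 1 * (g x $ 1 $ 1 * a $ 1 + g x $ 1 $ 2 * a $ 2) +
      a $ 2 * (g x $ 2 $ 1 * a $ 1 + g x $ 2 $ 2 * a $ 2)" for a x
    by (simp add: inner_vec_def matrix_vector_mult_def UNIV_2)
  have s: "g x $ 2 $ 1 = g x $ 1 $ 2" if "x \<in> U" for x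
    using arg_cong[OF sym[OF that], of "\<lambda>A. A $ 1 $ 2"] by (simp add: transpose_def)
  have p: "g x $ 1 $ 1 > 0" if "x \<in> U" for x
    using pos[OF that, of "axis 1 1"] unfolding q axis_eq_0_iff by (simp add: axis_def)
  have d: "g x $ 2 $ 2 - (g x $ 1 $ 2)\<^sup>2 / g x $ 1 $ 1 > 0" if "x \<in> U" for x
  proof -
    \<comment> \<open>The value of the quadratic form on this vector is the first diagonal entry
      times the determinant, so positivity here gives positivity of the determinant.\<close>
    have "vector [- g x $ 1 $ 2, g x $ 1 $ 1] \<noteq> (0 :: real^2)"
      using p[OF that] by (auto dest: arg_cong[of _ _ "\<lambda>v. v $ 2"])
    from pos[OF that this] have "g x $ 1 $ 1 * (g x $ 1 $ 1 * g x $ 2 $ 2 - (g x $ 1 $ 2)\<^sup>2) > 0"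
      by (simp add: q s[OF that] power2_eq_square algebra_simps)
    then have "g x $ 1 $ 1 * g x $ 2 $ 2 - (g x $ 1 $ 2)\<^sup>2 > 0"
      using p[OF that] by (simp add: zero_less_mult_iff)
    then show ?thesis using p[OF that] by (simp add: field_simps)
  qed
  define h :: "real^2 \<Rightarrow> real^2^2" where "h x = vector [vector [sqrt (g x $ 1 $ 1), g x $ 1 $ 2 / sqrt (g x $ 1 $ 1)],
    vector [0, sqrt (g x $ 2 $ 2 - (g x $ 1 $ 2)\<^sup>2 / g x $ 1 $ 1)]]" for x
  have gs: "smooth_on U (\<lambda>x. g x $ i $ j)" for i j
    using assms(1,2) by (auto intro!: smooth_on_nth)
  have h: "h x $ 1 $ 1 = sqrt (g x $ 1 $ 1)" "h x $ 1 $ 2 = g x $ 1 $ 2 / sqrt (g x $ 1 $ 1)"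
    "h x $ 2 $ 1 = 0" "h x $ 2 $ 2 = sqrt (g x $ 2 $ 2 - (g x $ 1 $ 2)\<^sup>2 / g x $ 1 $ 1)" for x
    by (simp_all add: h_def)
  have s1: "smooth_on U (\<lambda>x. sqrt (g x $ 1 $ 1))"
    by (rule smooth_on_sqrt[OF assms(1) gs p])
  have s2: "smooth_on U (\<lambda>x. g x $ 1 $ 2 / sqrt (g x $ 1 $ 1))"
    by (rule smooth_on_divide[OF assms(1) gs s1]) (use p in fastforce)
  have "smooth_on U (\<lambda>x. (g x $ 1 $ 2)\<^sup>2 / g x $ 1 $ 1)"
    by (rule smooth_on_divide[OF assms(1) smooth_on_power[OF assms(1) gs] gs]) (use p in fastforce)
  from smooth_on_sqrt[OF assms(1) smooth_on_diff[OF assms(1) gs this] d]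
  have s3: "smooth_on U (\<lambda>x. sqrt (g x $ 2 $ 2 - (g x $ 1 $ 2)\<^sup>2 / g x $ 1 $ 1))" .
  have "smooth_on U (\<lambda>x. h x $ i $ j)" for i j
    using exhaust_2[of i] exhaust_2[of j] s1 s2 s3 smooth_on_const[of U 0]
    by (elim disjE) (simp_all add: h)
  then have "smooth_on U h" by (intro smooth_on_vec assms(1))
  moreover have "det (h x) > 0" if "x \<in> U" for x
    unfolding det_2x2 h using p[OF that] d[OF that] by simp
  moreover have "g x $ i $ j = h x $ 1 $ i * h x $ 1 $ j + h x $ 2 $ i * h x $ 2 $ j" if "x \<in> U" for x i j
    using exhaust_2[of i] exhaust_2[of j] p[OF that] d[OF that]
    by (elim disjE; simp add: h s[OF that] power2_eq_square)
  ultimately show ?thesis using that assms(1) unfolding coframe_on_def by blast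
qed

text \<open>Exterior differentiation commutes with pullback of 1-forms: the second derivatives of
  \<tau> cancel by symmetry, and the first ones assemble to the Jacobian.\<close>

lemma pullback_curl:
  fixes \<tau> :: "real^2 \<Rightarrow> real^2"
  assumes "open U" "smooth_on U \<tau>" "x \<in> U"
    and "\<And>j. a j differentiable (at (\<tau> x))"
  shows "partial 1 (\<lambda>y. a 1 (\<tau> y) * partial 2 (\<lambda>y. \<tau> y $ 1) y + a 2 (\<tau> y) * partial 2 (\<lambda>y. \<tau> y $ 2) y) x
    - partial 2 (\<lambda>y. a 1 (\<tau> y) * partial 1 (\<lambda>y. \<tau> y $ 1) y + a 2 (\<tau> y) * partial 1 (\<lambda>y. \<tau> y $ 2) y) x
    = (partial 1 (\<lambda>y. \<tau> y $ 1) x * partial 2 (\<lambda>y. \<tau> y $ 2) x -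
       partial 2 (\<lambda>y. \<tau> y $ 1) x * partial 1 (\<lambda>y. \<tau> y $ 2) x) *
      (partial 1 (a (2::2)) (\<tau> x) - partial 2 (a (1::2)) (\<tau> x))"
proof -
  have \<tau>s: "smooth_on U (\<lambda>y. \<tau> y $ i)" for i
    by (rule smooth_on_nth[OF assms(1,2)])
  have d1: "(partial j (\<lambda>y. \<tau> y $ i)) differentiable (at x)" for i j
    by (rule smooth_on_differentiable[OF smooth_on_partial[OF \<tau>s] assms(3)])
  have \<tau>d: "\<tau> differentiable (at x)" by (rule smooth_on_differentiable[OF assms(2,3)])
  have d2: "(\<lambda>y. a j (\<tau> y)) differentiable (at x)" for j
    using differentiable_chain_at[OF \<tau>d assms(4)[of j]] by (simp add: o_def)
  have sym: "partial 1 (partial 2 (\<lambda>y. \<tau> y $ i)) x = partial 2 (partial 1 (\<lambda>y. \<tau> y $ i)) x" for i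
    by (rule partial_commute[OF assms(1) \<tau>s assms(3)])
  show ?thesis
    by (simp add: partial_add partial_mult d1 d2 differentiable_mult sym
        partial_compose[OF \<tau>d assms(4)] algebra_simps)
qed

definition pullback :: "(real^2 \<Rightarrow> real^2) \<Rightarrow> (real^2 \<Rightarrow> real^2^2) \<Rightarrow> real^2 \<Rightarrow> real^2^2" where
  "pullback \<tau> h x = (\<chi> k j. h (\<tau> x) $ k $ 1 * partial j (\<lambda>y. \<tau> y $ 1) x +
     h (\<tau> x) $ k $ 2 * partial j (\<lambda>y. \<tau> y $ 2) x)"

context
  fixes U V :: "(real^2) set" and \<tau> g g' h
  assumes cf: "coframe_on V g' h" and U: "open U" and \<tau>: "smooth_on U \<tau>"
    and sub: "\<And>x. x \<in> U \<Longrightarrow> \<tau> x \<in> V"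
    and pos: "\<And>x. x \<in> U \<Longrightarrow> partial 1 (\<lambda>y. \<tau> y $ 1) x * partial 2 (\<lambda>y. \<tau> y $ 2) x -
       partial 2 (\<lambda>y. \<tau> y $ 1) x * partial 1 (\<lambda>y. \<tau> y $ 2) x > 0"
    and met: "\<And>x i j. x \<in> U \<Longrightarrow> g x $ i $ j = (\<Sum>k\<in>UNIV. \<Sum>l\<in>UNIV.
       partial i (\<lambda>y. \<tau> y $ k) x * (g' (\<tau> x) $ k $ l * partial j (\<lambda>y. \<tau> y $ l) x))"
begin

lemma pullback_det: "det (pullback \<tau> h x) = det (h (\<tau> x)) *
    (partial 1 (\<lambda>y. \<tau> y $ 1) x * partial 2 (\<lambda>y. \<tau> y $ 2) x -
       partial 2 (\<lambda>y. \<tau> y $ 1) x * partial 1 (\<lambda>y. \<tau> y $ 2) x)"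
  by (simp add: det_2x2 pullback_def algebra_simps)

lemma coframe_on_pullback: "coframe_on U g (pullback \<tau> h)"
proof -
  have "open V" using coframe_open[OF cf] .
  have "smooth_on U (\<lambda>x. pullback \<tau> h x $ k $ j)" for k j
    unfolding pullback_def
    by (simp, intro smooth_on_add smooth_on_mult U smooth_on_partial smooth_on_nth[OF U \<tau>];
        rule smooth_on_compose[OF U \<open>open V\<close> sub \<tau> coframe_smooth[OF cf]])
  then have "smooth_on U (pullback \<tau> h)" by (intro smooth_on_vec U)
  moreover have "det (pullback \<tau> h x) > 0" if "x \<in> U" for x
    unfolding pullback_det using coframe_det[OF cf sub[OF that]] pos[OF that] by simp
  moreover have "g x $ i $ j = pullback \<tau> h x $ 1 $ i * pullback \<tau> h x $ 1 $ j +
      pullback \<tau> h x $ 2 $ i * pullback \<tau> h x $ 2 $ j" if "x \<in> U" for x i j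
    unfolding met[OF that] coframe_metric[OF cf sub[OF that]]
    by (simp add: pullback_def UNIV_2 algebra_simps)
  ultimately show ?thesis using U unfolding coframe_on_def by blast
qed

text \<open>The pulled-back coframe satisfies the pulled-back structure equations: the Jacobian
  appears in both curls and in the determinant, and cancels.\<close>

lemma pullback_conn:
  assumes "x \<in> U"
  shows "conn (pullback \<tau> h) i x =
    conn h 1 (\<tau> x) * partial i (\<lambda>y. \<tau> y $ 1) x + conn h 2 (\<tau> x) * partial i (\<lambda>y. \<tau> y $ 2) x"
proof -
  let ?J = "partial 1 (\<lambda>y. \<tau> y $ 1) x * partial 2 (\<lambda>y. \<tau> y $ 2) x -
       partial 2 (\<lambda>y. \<tau> y $ 1) x * partial 1 (\<lambda>y. \<tau> y $ 2) x"
  have curl: "curl k (pullback \<tau> h) x = ?J * curl k h (\<tau> x)" for k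
    using pullback_curl[OF U \<tau> assms smooth_on_differentiable[OF coframe_smooth[OF cf] sub[OF assms]], of "\<lambda>j. k"]
    by (simp add: curl_def pullback_def)
  have J: "?J \<noteq> 0" using pos[OF assms] by simp
  have D: "det (h (\<tau> x)) \<noteq> 0" using coframe_det[OF cf sub[OF assms]] by simp
  have "conn (pullback \<tau> h) i x = - (curl 1 h (\<tau> x) * pullback \<tau> h x $ 1 $ i +
      curl 2 h (\<tau> x) * pullback \<tau> h x $ 2 $ i) * ?J / (det (h (\<tau> x)) * ?J)"
    unfolding conn_def[of "pullback \<tau> h"] curl pullback_det by (simp add: algebra_simps)
  also have "\<dots> = - (curl 1 h (\<tau> x) * pullback \<tau> h x $ 1 $ i +
      curl 2 h (\<tau> x) * pullback \<tau> h x $ 2 $ i) / det (h (\<tau> x))"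
    using J by (rule nonzero_mult_divide_mult_cancel_right)
  also have "\<dots> = conn h 1 (\<tau> x) * partial i (\<lambda>y. \<tau> y $ 1) x + conn h 2 (\<tau> x) * partial i (\<lambda>y. \<tau> y $ 2) x"
    unfolding conn_def using D by (simp add: pullback_def field_simps)
  finally show ?thesis .
qed

lemma pullback_curvature:
  assumes "x \<in> U"
  shows "gauss_curvature g x = gauss_curvature g' (\<tau> x)"
proof -
  let ?J = "partial 1 (\<lambda>y. \<tau> y $ 1) x * partial 2 (\<lambda>y. \<tau> y $ 2) x -
       partial 2 (\<lambda>y. \<tau> y $ 1) x * partial 1 (\<lambda>y. \<tau> y $ 2) x"
  let ?c = "\<lambda>i y. conn h 1 (\<tau> y) * partial i (\<lambda>y. \<tau> y $ 1) y + conn h 2 (\<tau> y) * partial i (\<lambda>y. \<tau> y $ 2) y"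
  have "gauss_curvature g x * det (pullback \<tau> h x) =
      partial 1 (conn (pullback \<tau> h) 2) x - partial 2 (conn (pullback \<tau> h) 1) x"
    by (rule curvature_coframe[OF coframe_on_pullback assms])
  also have "\<dots> = partial 1 (?c 2) x - partial 2 (?c 1) x"
    using partial_cong_open[OF U assms pullback_conn] by simp
  also have "\<dots> = ?J * (partial 1 (conn h 2) (\<tau> x) - partial 2 (conn h 1) (\<tau> x))"
    by (rule pullback_curl[OF U \<tau> assms smooth_on_differentiable[OF conn_smooth[OF cf] sub[OF assms]]])
  also have "\<dots> = gauss_curvature g' (\<tau> x) * det (pullback \<tau> h x)"
    unfolding curvature_coframe[OF cf sub[OF assms], symmetric] pullback_det by simp
  finally show ?thesis using coframe_det[OF coframe_on_pullback assms] by simp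
qed

end

section \<open>Frobenius systems and Lie brackets\<close>

lemma smooth_form_expand:
  fixes A :: "'k::real_normed_field form1"
  assumes "smooth_form N A" "z \<in> N"
  shows "A z v = (\<Sum>b\<in>Basis. (v \<bullet> b) *\<^sub>R A z b)"
proof -
  interpret linear "A z" using assms by (simp add: smooth_form_def)
  have "A z v = A z (\<Sum>b\<in>Basis. (v \<bullet> b) *\<^sub>R b)" by (simp add: euclidean_representation)
  also have "\<dots> = (\<Sum>b\<in>Basis. (v \<bullet> b) *\<^sub>R A z b)" by (simp add: sum scale)
  finally show ?thesis .
qed

text \<open>A product rule for evaluating a varying form on a varying vector. Linearity reduces it
  to finitely many products, because smoothness of a form is only given for each constant
  vector.\<close>

lemma smooth_form_has_derivative:
  fixes A :: "'k::real_normed_field form1"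
  assumes A: "smooth_form N A" and N: "open N" "z \<in> N"
    and Y: "(Y has_derivative D) (at z)"
  shows "((\<lambda>y. A y (Y y)) has_derivative
    (\<lambda>w. frechet_derivative (\<lambda>y. A y (Y z)) (at z) w + A z (D w))) (at z)"
proof -
  define DA where "DA b = frechet_derivative (\<lambda>y. A y b) (at z)" for b
  have DA: "((\<lambda>y. A y b) has_derivative DA b) (at z)" for b
    unfolding DA_def by (rule smooth_on_has_derivative[OF _ N(2)]) (use A in \<open>simp only: smooth_form_def\<close>)
  have 1: "((\<lambda>y. \<Sum>b\<in>Basis. (Y y \<bullet> b) *\<^sub>R A y b) has_derivative
      (\<lambda>w. \<Sum>b\<in>Basis. (Y z \<bullet> b) *\<^sub>R DA b w + (D w \<bullet> b) *\<^sub>R A z b)) (at z)"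
    by (intro has_derivative_sum has_derivative_scaleR has_derivative_inner_left Y DA)
  have 2: "((\<lambda>y. \<Sum>b\<in>Basis. (Y z \<bullet> b) *\<^sub>R A y b) has_derivative
      (\<lambda>w. \<Sum>b\<in>Basis. (Y z \<bullet> b) *\<^sub>R DA b w)) (at z)"
    by (intro has_derivative_sum has_derivative_scaleR_right DA)
  have "((\<lambda>y. A y (Y z)) has_derivative (\<lambda>w. \<Sum>b\<in>Basis. (Y z \<bullet> b) *\<^sub>R DA b w)) (at z)"
    by (rule has_derivative_transform_within_open[OF 2 N])
      (rule smooth_form_expand[OF A, symmetric])
  then have "frechet_derivative (\<lambda>y. A y (Y z)) (at z) = (\<lambda>w. \<Sum>b\<in>Basis. (Y z \<bullet> b) *\<^sub>R DA b w)"
    by (rule frechet_derivative_eq)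
  then have "(\<lambda>w. \<Sum>b\<in>Basis. (Y z \<bullet> b) *\<^sub>R DA b w + (D w \<bullet> b) *\<^sub>R A z b) =
      (\<lambda>w. frechet_derivative (\<lambda>y. A y (Y z)) (at z) w + A z (D w))"
    by (simp add: sum.distrib smooth_form_expand[OF A N(2), of "D _"])
  then show ?thesis
    using has_derivative_transform_within_open[OF 1 N, of "\<lambda>y. A y (Y y)"]
      smooth_form_expand[OF A, symmetric] by simp
qed

text \<open>The function is known to vanish on Q only, not in a neighbourhood of z, so its
  derivative is controlled only along curves that stay in Q.\<close>

lemma has_derivative_zero_on_tangent:
  fixes L :: "'a::real_normed_vector \<Rightarrow> 'b::real_normed_vector"
  assumes L: "(L has_derivative D) (at z)" and v: "v \<in> tangent_space Q z"
    and N: "open N" "z \<in> N" and 0: "\<And>y. y \<in> Q \<inter> N \<Longrightarrow> L y = 0"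
  shows "D v = 0"
proof -
  obtain \<gamma> where \<gamma>: "\<gamma> 0 = z" "\<And>t. \<gamma> t \<in> Q" "(\<gamma> has_vector_derivative v) (at 0)"
    using v unfolding tangent_space_def by blast
  have \<gamma>': "(\<gamma> has_derivative (\<lambda>t. t *\<^sub>R v)) (at 0)"
    using \<gamma>(3) by (simp add: has_vector_derivative_def)
  have "isCont \<gamma> 0" using \<gamma>' has_derivative_continuous by blast
  have lim: "(\<gamma> \<longlongrightarrow> z) (at 0)" using \<open>isCont \<gamma> 0\<close> \<gamma>(1) by (simp add: isCont_def)
  have ev: "\<forall>\<^sub>F t in nhds (0::real). \<gamma> t \<in> N"
    using topological_tendstoD[OF lim N] N(2) \<gamma>(1) by (auto simp: eventually_at_filter elim!: eventually_mono)
  then obtain T where T: "open T" "0 \<in> T" "\<And>t. t \<in> T \<Longrightarrow> \<gamma> t \<in> N"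
    unfolding eventually_nhds by blast
  have "((\<lambda>t. L (\<gamma> t)) has_derivative (\<lambda>t. D (t *\<^sub>R v))) (at 0)"
    using has_derivative_compose[OF \<gamma>'] L \<gamma>(1) by simp
  moreover have "((\<lambda>t. L (\<gamma> t)) has_derivative (\<lambda>t. 0)) (at 0)"
    by (rule has_derivative_transform_within_open[OF has_derivative_const T(1,2), of 0])
      (use 0 T(3) \<gamma>(2) in auto)
  ultimately have "(\<lambda>t. D (t *\<^sub>R v)) = (\<lambda>t. 0)"
    using has_derivative_unique by blast
  then show ?thesis by (metis scaleR_one)
qed

text \<open>Two sections \<open>\<xi>\<close>, \<open>\<zeta>\<close> (with coefficients in \<open>'k\<close>, along real fields \<open>Y a\<close> tangent to \<open>Q\<close>) of the
  common kernel of the forms have their Lie bracket in that kernel.\<close>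

lemma frobenius_bracket:
  fixes As :: "'k::real_normed_field form1 list" and Y :: "nat \<Rightarrow> frames \<Rightarrow> frames"
  assumes N: "open N" "z \<in> N" and I: "finite I" and j: "j < length As"
    and smooth: "\<And>A. A \<in> set As \<Longrightarrow> smooth_form N A"
    and frob: "frobenius_at P z As"
    and tan: "\<And>a. a \<in> I \<Longrightarrow> Y a z \<in> tangent_space Q z" "Q \<subseteq> P" and zQ: "z \<in> Q"
    and DY: "\<And>a. a \<in> I \<Longrightarrow> (Y a has_derivative DY a) (at z)"
    and D\<xi>: "\<And>a. a \<in> I \<Longrightarrow> (\<xi> a has_derivative D\<xi> a) (at z)"
    and D\<zeta>: "\<And>a. a \<in> I \<Longrightarrow> (\<zeta> a has_derivative D\<zeta> a) (at z)"
    and \<xi>0: "\<And>y j. y \<in> Q \<inter> N \<Longrightarrow> j < length As \<Longrightarrow> (\<Sum>a\<in>I. \<xi> a y * (As ! j) y (Y a y)) = 0"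
    and \<zeta>0: "\<And>y j. y \<in> Q \<inter> N \<Longrightarrow> j < length As \<Longrightarrow> (\<Sum>a\<in>I. \<zeta> a y * (As ! j) y (Y a y)) = 0"
  shows "(\<Sum>a\<in>I. \<Sum>b\<in>I. \<xi> a z * \<zeta> b z * (As ! j) z (DY b (Y a z) - DY a (Y b z))) +
    (\<Sum>b\<in>I. (\<Sum>a\<in>I. \<xi> a z * D\<zeta> b (Y a z) - \<zeta> a z * D\<xi> b (Y a z)) * (As ! j) z (Y b z)) = 0"
proof -
  define A where "A = As ! j"
  have A: "smooth_form N A" using smooth j by (simp add: A_def)
  interpret linear "A z" using A N(2) by (simp add: smooth_form_def)
  define E where "E b w = frechet_derivative (\<lambda>y. A y (Y b z)) (at z) w + A z (DY b w)" for b w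
  have dA: "((\<lambda>y. A y (Y b y)) has_derivative E b) (at z)" if "b \<in> I" for b
    unfolding E_def using smooth_form_has_derivative[OF A N DY[OF that]] .
  \<comment> \<open>The sum vanishes along Q and \<open>Y a\<close> is tangent to Q, so its
    derivative in that direction vanishes too.\<close>
  have van: "(\<Sum>b\<in>I. s b z * E b (Y a z) + Ds b (Y a z) * A z (Y b z)) = 0"
    if Ds: "\<And>b. b \<in> I \<Longrightarrow> (s b has_derivative Ds b) (at z)" and a: "a \<in> I"
      and s0: "\<And>y. y \<in> Q \<inter> N \<Longrightarrow> (\<Sum>a\<in>I. s a y * (As ! j) y (Y a y)) = 0" for s Ds a
  proof -
    have "((\<lambda>y. \<Sum>b\<in>I. s b y * A y (Y b y)) has_derivative
        (\<lambda>w. \<Sum>b\<in>I. s b z * E b w + Ds b w * A z (Y b z))) (at z)"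
      by (intro has_derivative_sum has_derivative_mult Ds dA)
    from has_derivative_zero_on_tangent[OF this tan(1)[OF a] N s0[folded A_def]]
    show ?thesis by simp
  qed
  obtain \<beta> :: "nat \<Rightarrow> frames \<Rightarrow> 'k" where \<beta>: "\<And>v w. v \<in> tangent_space P z \<Longrightarrow> w \<in> tangent_space P z \<Longrightarrow>
      exterior_derivative A z v w = (\<Sum>l<length As. \<beta> l v * (As ! l) z w - \<beta> l w * (As ! l) z v)"
    using frob j unfolding frobenius_at_def A_def by blast
  have tanP: "Y a z \<in> tangent_space P z" if "a \<in> I" for a
    using tan(1)[OF that] tan(2) unfolding tangent_space_def by blast
  \<comment> \<open>By the Frobenius condition every term of dA contains a factor that is some form
    of the list on \<xi> or on \<zeta>, so dA vanishes on the pair.\<close>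
  have "(\<Sum>a\<in>I. \<Sum>b\<in>I. \<xi> a z * \<zeta> b z * exterior_derivative A z (Y a z) (Y b z)) =
      (\<Sum>a\<in>I. \<Sum>b\<in>I. \<Sum>l<length As. \<xi> a z * \<beta> l (Y a z) * (\<zeta> b z * (As ! l) z (Y b z))
        - \<zeta> b z * \<beta> l (Y b z) * (\<xi> a z * (As ! l) z (Y a z)))"
    by (intro sum.cong refl) (simp add: \<beta> tanP sum_distrib_left algebra_simps)
  also have "\<dots> = (\<Sum>l<length As. \<Sum>a\<in>I. \<Sum>b\<in>I. \<xi> a z * \<beta> l (Y a z) * (\<zeta> b z * (As ! l) z (Y b z))
        - \<zeta> b z * \<beta> l (Y b z) * (\<xi> a z * (As ! l) z (Y a z)))"
    by (subst sum.swap[of _ "{..<length As}"], intro sum.cong refl sum.swap)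
  also have "\<dots> = (\<Sum>l<length As. (\<Sum>a\<in>I. \<xi> a z * \<beta> l (Y a z)) * (\<Sum>b\<in>I. \<zeta> b z * (As ! l) z (Y b z))
        - (\<Sum>b\<in>I. \<zeta> b z * \<beta> l (Y b z)) * (\<Sum>a\<in>I. \<xi> a z * (As ! l) z (Y a z)))"
  proof (intro sum.cong refl)
    fix l
    have "(\<Sum>a\<in>I. \<Sum>b\<in>I. \<zeta> b z * \<beta> l (Y b z) * (\<xi> a z * (As ! l) z (Y a z))) =
      (\<Sum>b\<in>I. \<zeta> b z * \<beta> l (Y b z)) * (\<Sum>a\<in>I. \<xi> a z * (As ! l) z (Y a z))"
      by (subst sum.swap) (simp add: sum_product)
    then show "(\<Sum>a\<in>I. \<Sum>b\<in>I. \<xi> a z * \<beta> l (Y a z) * (\<zeta> b z * (As ! l) z (Y b z))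
        - \<zeta> b z * \<beta> l (Y b z) * (\<xi> a z * (As ! l) z (Y a z))) =
      (\<Sum>a\<in>I. \<xi> a z * \<beta> l (Y a z)) * (\<Sum>b\<in>I. \<zeta> b z * (As ! l) z (Y b z))
        - (\<Sum>b\<in>I. \<zeta> b z * \<beta> l (Y b z)) * (\<Sum>a\<in>I. \<xi> a z * (As ! l) z (Y a z))"
      by (simp add: sum_subtractf sum_product)
  qed
  also have "\<dots> = 0" using \<xi>0[of z] \<zeta>0[of z] zQ N(2) by simp
  finally have ext: "(\<Sum>a\<in>I. \<Sum>b\<in>I. \<xi> a z * \<zeta> b z * exterior_derivative A z (Y a z) (Y b z)) = 0" .
  \<comment> \<open>Cartan's formula dA(X,Y) = X(A(Y)) - Y(A(X)) - A([X,Y]); the difference of the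
    two \<open>DY\<close> terms is the Lie bracket.\<close>
  have E: "E b (Y a z) - E a (Y b z) =
      exterior_derivative A z (Y a z) (Y b z) + A z (DY b (Y a z) - DY a (Y b z))" for a b
    by (simp add: E_def exterior_derivative_def diff)
  have 1: "(\<Sum>a\<in>I. \<xi> a z * (\<Sum>b\<in>I. \<zeta> b z * E b (Y a z) + D\<zeta> b (Y a z) * A z (Y b z))) = 0"
    using van[of \<zeta> D\<zeta>, OF D\<zeta>] \<zeta>0 j by simp
  have 2: "(\<Sum>a\<in>I. \<zeta> a z * (\<Sum>b\<in>I. \<xi> b z * E b (Y a z) + D\<xi> b (Y a z) * A z (Y b z))) = 0"
    using van[of \<xi> D\<xi>, OF D\<xi>] \<xi>0 j by simp
  have 3: "(\<Sum>a\<in>I. \<xi> a z * (\<Sum>b\<in>I. \<zeta> b z * E b (Y a z) + D\<zeta> b (Y a z) * A z (Y b z))) =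
     (\<Sum>a\<in>I. \<Sum>b\<in>I. \<xi> a z * \<zeta> b z * E b (Y a z)) + (\<Sum>b\<in>I. (\<Sum>a\<in>I. \<xi> a z * D\<zeta> b (Y a z)) * A z (Y b z))"
    unfolding sum_distrib_right
    by (subst (2) sum.swap) (simp add: sum_distrib_left sum.distrib algebra_simps)
  have 4: "(\<Sum>a\<in>I. \<zeta> a z * (\<Sum>b\<in>I. \<xi> b z * E b (Y a z) + D\<xi> b (Y a z) * A z (Y b z))) =
     (\<Sum>a\<in>I. \<Sum>b\<in>I. \<xi> a z * \<zeta> b z * E a (Y b z)) + (\<Sum>b\<in>I. (\<Sum>a\<in>I. \<zeta> a z * D\<xi> b (Y a z)) * A z (Y b z))"
  proof -
    have "(\<Sum>a\<in>I. \<Sum>b\<in>I. \<xi> a z * \<zeta> b z * E a (Y b z)) = (\<Sum>a\<in>I. \<Sum>b\<in>I. \<xi> b z * \<zeta> a z * E b (Y a z))"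
      by (rule sum.swap)
    moreover have "(\<Sum>b\<in>I. (\<Sum>a\<in>I. \<zeta> a z * D\<xi> b (Y a z)) * A z (Y b z)) =
        (\<Sum>a\<in>I. \<Sum>b\<in>I. \<zeta> a z * D\<xi> b (Y a z) * A z (Y b z))"
      unfolding sum_distrib_right by (rule sum.swap)
    ultimately show ?thesis by (simp add: sum_distrib_left sum.distrib algebra_simps)
  qed
  have "0 = (\<Sum>a\<in>I. \<Sum>b\<in>I. \<xi> a z * \<zeta> b z * (E b (Y a z) - E a (Y b z))) +
     (\<Sum>b\<in>I. (\<Sum>a\<in>I. \<xi> a z * D\<zeta> b (Y a z) - \<zeta> a z * D\<xi> b (Y a z)) * A z (Y b z))"
  proof -
    have "(\<Sum>a\<in>I. \<Sum>b\<in>I. \<xi> a z * \<zeta> b z * (E b (Y a z) - E a (Y b z))) +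
      (\<Sum>b\<in>I. (\<Sum>a\<in>I. \<xi> a z * D\<zeta> b (Y a z) - \<zeta> a z * D\<xi> b (Y a z)) * A z (Y b z)) =
      ((\<Sum>a\<in>I. \<Sum>b\<in>I. \<xi> a z * \<zeta> b z * E b (Y a z)) + (\<Sum>b\<in>I. (\<Sum>a\<in>I. \<xi> a z * D\<zeta> b (Y a z)) * A z (Y b z))) -
      ((\<Sum>a\<in>I. \<Sum>b\<in>I. \<xi> a z * \<zeta> b z * E a (Y b z)) + (\<Sum>b\<in>I. (\<Sum>a\<in>I. \<zeta> a z * D\<xi> b (Y a z)) * A z (Y b z)))"
      by (simp add: sum_subtractf right_diff_distrib left_diff_distrib)
    then show ?thesis using 1 2 unfolding 3 4 by simp
  qed
  also have "(\<Sum>a\<in>I. \<Sum>b\<in>I. \<xi> a z * \<zeta> b z * (E b (Y a z) - E a (Y b z))) =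
     (\<Sum>a\<in>I. \<Sum>b\<in>I. \<xi> a z * \<zeta> b z * exterior_derivative A z (Y a z) (Y b z)) +
     (\<Sum>a\<in>I. \<Sum>b\<in>I. \<xi> a z * \<zeta> b z * A z (DY b (Y a z) - DY a (Y b z)))"
    unfolding E by (simp add: sum.distrib distrib_left)
  finally show ?thesis using ext unfolding A_def by simp
qed

section \<open>Fields on the product of the frame bundles\<close>

lemma tangent_space_mono: "Q \<subseteq> P \<Longrightarrow> tangent_space Q z \<subseteq> tangent_space P z"
  unfolding tangent_space_def by blast

text \<open>\<open>tangent_space\<close> asks for a curve in the set for all times, but for no
  regularity away from time 0. A curve defined near 0 is therefore continued by the constant
  z.\<close>

lemma tangent_spaceI:
  assumes "z \<in> Q" "(\<gamma> has_vector_derivative v) (at 0)" "\<gamma> 0 = z" "open T" "0 \<in> T" "\<And>t. t \<in> T \<Longrightarrow> \<gamma> t \<in> Q"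
  shows "v \<in> tangent_space Q z"
proof -
  have "((\<lambda>t. if t \<in> T then \<gamma> t else z) has_vector_derivative v) (at 0)"
    using has_vector_derivative_transform_within_open[OF assms(2,4,5), of "\<lambda>t. if t \<in> T then \<gamma> t else z"] by simp
  then show ?thesis
    unfolding tangent_space_def using assms
    by (intro CollectI exI[of _ "\<lambda>t. if t \<in> T then \<gamma> t else z"]) auto
qed

text \<open>Left-invariant fields on the Euclidean frame bundle, extended linearly: translations along
  \<open>e\<^sub>1\<close>, \<open>e\<^sub>2\<close>, \<open>e\<^sub>3\<close>, then the rotations dual to \<open>\<omega>\<^sup>1\<^sub>2\<close>, \<open>\<omega>\<^sup>3\<^sub>1\<close>, \<open>\<omega>\<^sup>3\<^sub>2\<close>.\<close>

definition move :: "nat \<Rightarrow> real^3^3 \<Rightarrow> (real^3) \<times> (real^3^3)" where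
  "move a F = [(F $ 1, 0), (F $ 2, 0), (F $ 3, 0), (0, vector [- F $ 2, F $ 1, 0]),
     (0, vector [F $ 3, 0, - F $ 1]), (0, vector [0, F $ 3, - F $ 2])] ! a"

text \<open>The first two fields lift the coordinate fields along the section \<open>E\<close> of the frame bundle.\<close>

definition field :: "(real^2 \<Rightarrow> real^2^2) \<Rightarrow> nat \<Rightarrow> frames \<Rightarrow> frames" where
  "field E a z = (let x = fst (fst z); F = snd (snd z) in
     if a < 2 then let v = axis (if a = 0 then 1 else 2) 1 in ((v, frechet_derivative E (at x) v), 0)
     else (0, move (a - 2) F))"

definition dfield :: "(real^2 \<Rightarrow> real^2^2) \<Rightarrow> nat \<Rightarrow> frames \<Rightarrow> frames \<Rightarrow> frames" where
  "dfield E a z w = (if a < 2 then ((0, frechet_derivative (\<lambda>y. frechet_derivative E (at y)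
       (axis (if a = 0 then 1 else 2) 1)) (at (fst (fst z))) (fst (fst w))), 0)
     else (0, move (a - 2) (snd (snd w))))"

lemma less8_cases:
  fixes a :: nat
  assumes "a < 8"
  obtains "a = 0" | "a = 1" | "a = 2" | "a = 3" | "a = 4" | "a = 5" | "a = 6" | "a = 7"
  using assms by linarith

lemma sum8: "(\<Sum>a<(8::nat). f a) = f 0 + f 1 + f 2 + f 3 + f 4 + f 5 + f 6 + (f 7 :: 'a::comm_monoid_add)"
  by (simp add: eval_nat_numeral)

lemma move_simps:
  "move 0 F = (F $ 1, 0)" "move 1 F = (F $ 2, 0)" "move (Suc 0) F = (F $ 2, 0)" "move 2 F = (F $ 3, 0)"
  "move 3 F = (0, vector [- F $ 2, F $ 1, 0])" "move 4 F = (0, vector [F $ 3, 0, - F $ 1])"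
  "move 5 F = (0, vector [0, F $ 3, - F $ 2])"
  by (simp_all add: move_def)

lemma bounded_linear_move: "a < 6 \<Longrightarrow> bounded_linear (move a)"
proof -
  assume "a < 6"
  then consider "a = 0" | "a = 1" | "a = 2" | "a = 3" | "a = 4" | "a = 5" by linarith
  then have "linear (move a)"
    by cases (auto intro!: linearI simp: move_simps vec_eq_iff forall_3 vector_3)
  then show ?thesis by (simp add: linear_conv_bounded_linear)
qed

lemma field_has_derivative:
  assumes "a < 8" "smooth_on U E" "fst (fst z) \<in> U"
  shows "(field E a has_derivative dfield E a z) (at z)"
proof (cases "a < 2")
  case True
  let ?v = "axis (if a = 0 then 1 else 2) 1 :: real^2"
  have "((\<lambda>y. frechet_derivative E (at y) ?v) has_derivative
      frechet_derivative (\<lambda>y. frechet_derivative E (at y) ?v) (at (fst (fst z)))) (at (fst (fst z)))"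
    by (rule smooth_on_has_derivative[OF smooth_on_frechet[OF assms(2)] assms(3)])
  from has_derivative_compose[OF has_derivative_fst[OF has_derivative_fst[OF has_derivative_ident]] this]
  have "((\<lambda>z. ((?v, frechet_derivative E (at (fst (fst z))) ?v), 0 :: (real^3) \<times> (real^3^3))) has_derivative
      (\<lambda>w. ((0, frechet_derivative (\<lambda>y. frechet_derivative E (at y) ?v) (at (fst (fst z))) (fst (fst w))), 0))) (at z)"
    by (rule has_derivative_Pair[OF has_derivative_Pair[OF has_derivative_const] has_derivative_const])
  moreover have "field E a = (\<lambda>z. ((?v, frechet_derivative E (at (fst (fst z))) ?v), 0))"
    using True by (simp only: fun_eq_iff field_def Let_def if_True) simp
  moreover have "dfield E a z = (\<lambda>w. ((0, frechet_derivative (\<lambda>y. frechet_derivative E (at y) ?v)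
      (at (fst (fst z))) (fst (fst w))), 0))"
    using True by (simp only: fun_eq_iff dfield_def if_True) simp
  ultimately show ?thesis by simp
next
  case False
  have "bounded_linear (\<lambda>z::frames. move (a - 2) (snd (snd z)))"
    by (rule bounded_linear_compose[OF bounded_linear_move bounded_linear_compose[OF bounded_linear_snd bounded_linear_snd]])
      (use assms(1) False in linarith)
  then have "bounded_linear (\<lambda>z::frames. (0 :: (real^2) \<times> (real^2^2), move (a - 2) (snd (snd z))))"
    by (rule bounded_linear_Pair[OF bounded_linear_zero])
  from bounded_linear_imp_has_derivative[OF this]
  have "((\<lambda>z::frames. (0 :: (real^2) \<times> (real^2^2), move (a - 2) (snd (snd z)))) has_derivative
      (\<lambda>z. (0, move (a - 2) (snd (snd z))))) (at z)" .
  moreover have "field E a = (\<lambda>z. (0, move (a - 2) (snd (snd z))))"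
    using False by (simp only: fun_eq_iff field_def Let_def if_False) simp
  moreover have "dfield E a z = (\<lambda>w. (0, move (a - 2) (snd (snd w))))"
    using False by (simp only: fun_eq_iff dfield_def if_False) simp
  ultimately show ?thesis by simp
qed

definition euclidean_fibre :: "(real^2) \<times> (real^2^2) \<Rightarrow> frames set" where
  "euclidean_fibre e = {e} \<times> euclidean_frames"

lemma rotation_frames:
  fixes F :: "real^3^3"
  assumes "(r, F) \<in> euclidean_frames" "c\<^sup>2 + s\<^sup>2 = 1"
  shows "(r', vector [c *\<^sub>R F $ 1 + s *\<^sub>R (- F $ 2), c *\<^sub>R F $ 2 + s *\<^sub>R F $ 1, F $ 3]) \<in> euclidean_frames"
    "(r', vector [c *\<^sub>R F $ 1 + s *\<^sub>R F $ 3, F $ 2, c *\<^sub>R F $ 3 + s *\<^sub>R (- F $ 1)]) \<in> euclidean_frames"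
    "(r', vector [F $ 1, c *\<^sub>R F $ 2 + s *\<^sub>R F $ 3, c *\<^sub>R F $ 3 + s *\<^sub>R (- F $ 2)]) \<in> euclidean_frames"
proof -
  have F: "F $ i \<bullet> F $ j = (if i = j then 1 else 0)" for i j
    using assms(1) by (simp add: euclidean_frames_def)
  have cs: "c * c + s * s = 1" "s * s + c * c = 1" using assms(2) by (simp_all add: power2_eq_square)
  show "(r', vector [c *\<^sub>R F $ 1 + s *\<^sub>R (- F $ 2), c *\<^sub>R F $ 2 + s *\<^sub>R F $ 1, F $ 3]) \<in> euclidean_frames"
    "(r', vector [c *\<^sub>R F $ 1 + s *\<^sub>R F $ 3, F $ 2, c *\<^sub>R F $ 3 + s *\<^sub>R (- F $ 1)]) \<in> euclidean_frames"
    "(r', vector [F $ 1, c *\<^sub>R F $ 2 + s *\<^sub>R F $ 3, c *\<^sub>R F $ 3 + s *\<^sub>R (- F $ 2)]) \<in> euclidean_frames"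
    unfolding euclidean_frames_def
    by (simp_all add: forall_3 vector_3 inner_add_left inner_add_right inner_diff_left inner_diff_right F cs algebra_simps)
qed

lemma cos_sin_has_vector_derivative:
  "((\<lambda>t. cos t *\<^sub>R u + sin t *\<^sub>R w) has_vector_derivative w) (at (0::real))"
  unfolding has_vector_derivative_def by (auto intro!: derivative_eq_intros)

text \<open>The curves are a straight line of basepoints for a translation, and for a rotation a
  cosine-sine turn of two frame vectors that fixes the third.\<close>

lemma move_tangent:
  assumes "(r, F) \<in> euclidean_frames" "a < 6"
  shows "(0, move a F) \<in> tangent_space (euclidean_fibre e) (e, (r, F))"
proof -
  have cs: "(cos t)\<^sup>2 + (sin t)\<^sup>2 = 1" for t :: real by simp
  note rf = rotation_frames[OF assms(1) cs]
  have z: "(e, (r, F)) \<in> euclidean_fibre e" using assms(1) by (simp add: euclidean_fibre_def)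
  have v: "((\<lambda>t. vector [f t, g t, h t] :: real^3^3) has_vector_derivative vector [f', g', h']) (at 0)"
    if "(f has_vector_derivative f') (at 0)" "(g has_vector_derivative g') (at 0)"
      "(h has_vector_derivative h') (at 0)" for f g h f' g' h'
  proof -
    have vec: "vector [a, b, c] = (axis 1 a + axis 2 b + axis 3 c :: real^3^3)" for a b c
      by (simp add: vec_eq_iff forall_3 axis_def)
    have "linear (axis i :: real^3 \<Rightarrow> real^3^3)" for i
      by (rule linearI) (simp_all add: vec_eq_iff axis_def)
    then have bl: "bounded_linear (axis i :: real^3 \<Rightarrow> real^3^3)" for i
      by (simp add: linear_conv_bounded_linear)
    show ?thesis
      unfolding vec by (intro has_vector_derivative_add bounded_linear.has_vector_derivative[OF bl] that)
  qed
  have triv: "(x, G) \<in> euclidean_frames \<Longrightarrow> (y, G) \<in> euclidean_frames" for x y and G :: "real^3^3"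
    by (simp add: euclidean_frames_def)
  have tr: "((\<lambda>t. r + t *\<^sub>R w) has_vector_derivative w) (at (0::real))" for w
    unfolding has_vector_derivative_def by (auto intro!: derivative_eq_intros)
  have trans: "(0, (F $ i, 0)) \<in> tangent_space (euclidean_fibre e) (e, (r, F))" for i
  proof (rule tangent_spaceI[OF z, of "\<lambda>t. (e, (r + t *\<^sub>R F $ i, F))" _ UNIV])
    show "((\<lambda>t. (e, (r + t *\<^sub>R F $ i, F))) has_vector_derivative (0, (F $ i, 0))) (at 0)"
      by (intro has_vector_derivative_Pair tr has_vector_derivative_const)
  qed (use assms(1) triv in \<open>auto simp: euclidean_fibre_def\<close>)
  have rot: "(0, (0, vector [f', g', h'])) \<in> tangent_space (euclidean_fibre e) (e, (r, F))"
    if "(f has_vector_derivative f') (at 0)" "(g has_vector_derivative g') (at 0)"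
      "(h has_vector_derivative h') (at 0)" "f 0 = F $ 1" "g 0 = F $ 2" "h 0 = F $ 3"
      "\<And>t. (r, vector [f t, g t, h t]) \<in> euclidean_frames" for f g h f' g' h'
  proof (rule tangent_spaceI[OF z, of "\<lambda>t. (e, (r, vector [f t, g t, h t]))" _ UNIV])
    show "((\<lambda>t. (e, (r, vector [f t, g t, h t] :: real^3^3))) has_vector_derivative
        (0, (0, vector [f', g', h']))) (at 0)"
      by (intro has_vector_derivative_Pair v has_vector_derivative_const that)
    show "(e, (r, vector [f 0, g 0, h 0])) = (e, (r, F))"
      using that(4-6) by (simp add: vec_eq_iff forall_3)
  qed (use that(7) in \<open>auto simp: euclidean_fibre_def\<close>)
  note cosin = cos_sin_has_vector_derivative has_vector_derivative_const
  have "(0, (0, vector [- F $ 2, F $ 1, 0])) \<in> tangent_space (euclidean_fibre e) (e, (r, F))"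
    by (rule rot[OF cosin(1) cosin(1) cosin(2) _ _ _ rf(1)]) auto
  moreover have "(0, (0, vector [F $ 3, 0, - F $ 1])) \<in> tangent_space (euclidean_fibre e) (e, (r, F))"
    by (rule rot[OF cosin(1) cosin(2) cosin(1) _ _ _ rf(2)]) auto
  moreover have "(0, (0, vector [0, F $ 3, - F $ 2])) \<in> tangent_space (euclidean_fibre e) (e, (r, F))"
    by (rule rot[OF cosin(2) cosin(1) cosin(1) _ _ _ rf(3)]) auto
  moreover have "a = 0 \<or> a = 1 \<or> a = 2 \<or> a = 3 \<or> a = 4 \<or> a = 5" using assms(2) by linarith
  ultimately show ?thesis
    by (elim disjE) (simp_all add: move_simps trans)
qed

text \<open>An 8-dimensional submanifold of the 9-dimensional frame product, framed by the eight
  fields; the direction left out is the rotation of the surface frame over a fixed point.\<close>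

definition section_frames :: "(real^2) set \<Rightarrow> (real^2 \<Rightarrow> real^2^2) \<Rightarrow> frames set" where
  "section_frames U E = (\<lambda>x. (x, E x)) ` U \<times> euclidean_frames"

lemma field_tangent:
  assumes "a < 8" "open U" "smooth_on U E" "x \<in> U" "(r, F) \<in> euclidean_frames"
  shows "field E a ((x, E x), (r, F)) \<in> tangent_space (section_frames U E) ((x, E x), (r, F))"
proof (cases "a < 2")
  case True
  define v :: "real^2" where "v = axis (if a = 0 then 1 else 2) 1"
  have l: "((\<lambda>t. x + t *\<^sub>R v) has_vector_derivative v) (at 0)"
    by (auto intro!: derivative_eq_intros)
  have "((\<lambda>t. E (x + t *\<^sub>R v)) has_vector_derivative frechet_derivative E (at x) v) (at 0)"
  proof -
    have E: "(E has_derivative frechet_derivative E (at x)) (at x)"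
      using smooth_on_has_derivative assms(3,4) by blast
    then interpret linear "frechet_derivative E (at x)" by (rule has_derivative_linear)
    show ?thesis
      using has_derivative_compose[OF l[unfolded has_vector_derivative_def], of E "frechet_derivative E (at x)"] E
      by (simp add: has_vector_derivative_def scale)
  qed
  then have "((\<lambda>t. ((x + t *\<^sub>R v, E (x + t *\<^sub>R v)), (r, F))) has_vector_derivative
      ((v, frechet_derivative E (at x) v), 0)) (at 0)"
    by (intro has_vector_derivative_Pair l) auto
  moreover have "open ((\<lambda>t. x + t *\<^sub>R v) -` U)"
    by (intro continuous_open_vimage assms continuous_intros)
  ultimately have "((v, frechet_derivative E (at x) v), 0) \<in> tangent_space (section_frames U E) ((x, E x), (r, F))"
    using assms
    by (intro tangent_spaceI[where T = "(\<lambda>t. x + t *\<^sub>R v) -` U" and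
        \<gamma> = "\<lambda>t. ((x + t *\<^sub>R v, E (x + t *\<^sub>R v)), (r, F))"]) (auto simp: section_frames_def)
  then show ?thesis using True by (simp add: field_def v_def Let_def)
next
  case False
  have "euclidean_fibre (x, E x) \<subseteq> section_frames U E"
    using assms(4) by (auto simp: euclidean_fibre_def section_frames_def)
  then show ?thesis
    using subsetD[OF tangent_space_mono move_tangent[OF assms(5), of "a - 2" "(x, E x)"]] assms(1) False
    by (auto simp: field_def Let_def)
qed

text \<open>The Lie algebra of the Euclidean group, complexified, in the basis \<^const>\<open>move\<close>.\<close>

definition euclidean_bracket :: "(nat \<Rightarrow> 'k::real_normed_field) \<Rightarrow> (nat \<Rightarrow> 'k) \<Rightarrow> nat \<Rightarrow> 'k" where
  "euclidean_bracket s t a = [0, 0,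
     s 5 * t 3 - s 3 * t 5 - (s 6 * t 4 - s 4 * t 6),
     - (s 5 * t 2 - s 2 * t 5) - (s 7 * t 4 - s 4 * t 7),
     s 6 * t 2 - s 2 * t 6 + (s 7 * t 3 - s 3 * t 7),
     - (s 6 * t 7 - s 7 * t 6), s 5 * t 7 - s 7 * t 5, - (s 5 * t 6 - s 6 * t 5)] ! a"

lemma euclidean_bracket_simps:
  "euclidean_bracket s t 0 = 0" "euclidean_bracket s t 1 = 0"
  "euclidean_bracket s t 2 = s 5 * t 3 - s 3 * t 5 - (s 6 * t 4 - s 4 * t 6)"
  "euclidean_bracket s t 3 = - (s 5 * t 2 - s 2 * t 5) - (s 7 * t 4 - s 4 * t 7)"
  "euclidean_bracket s t 4 = s 6 * t 2 - s 2 * t 6 + (s 7 * t 3 - s 3 * t 7)"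
  "euclidean_bracket s t 5 = - (s 6 * t 7 - s 7 * t 6)"
  "euclidean_bracket s t 6 = s 5 * t 7 - s 7 * t 5"
  "euclidean_bracket s t 7 = - (s 5 * t 6 - s 6 * t 5)"
  by (simp_all add: euclidean_bracket_def)

text \<open>The lifts commute with each other by symmetry of second derivatives, and with the
  Euclidean fields because these live on the other factor. Only the structure constants of the
  Euclidean group remain.\<close>

lemma field_bracket:
  fixes A :: "frames \<Rightarrow> 'k::real_normed_field" and s t :: "nat \<Rightarrow> 'k"
  assumes lin: "linear A" and sym: "dfield E 1 z (field E 0 z) = dfield E 0 z (field E 1 z)"
    and dz: "\<And>i. frechet_derivative (\<lambda>y. frechet_derivative E (at y) (axis i 1)) (at (fst (fst z))) 0 = 0"
  shows "(\<Sum>a<8. \<Sum>b<8. s a * t b * A (dfield E b z (field E a z) - dfield E a z (field E b z))) =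
    (\<Sum>c<8. euclidean_bracket s t c * A (field E c z))"
proof -
  interpret linear A by (rule lin)
  define B where "B a b = dfield E b z (field E a z) - dfield E a z (field E b z)" for a b
  obtain x e r F where z: "z = ((x, e), (r, F))" by (metis surj_pair)
  have v0: "vector [0, 0, 0] = (0 :: real^3^3)" by (simp add: vec_eq_iff forall_3)
  have 0: "B 0 1 = 0" "B 1 0 = 0" using sym by (simp_all add: B_def)
  have 1:
    "B 0 0 = 0" "B 0 2 = 0" "B 0 3 = 0" "B 0 4 = 0" "B 0 5 = 0" "B 0 6 = 0" "B 0 7 = 0" "B 1 1 = 0"
    "B 1 2 = 0" "B 1 3 = 0" "B 1 4 = 0" "B 1 5 = 0" "B 1 6 = 0" "B 1 7 = 0" "B 2 0 = 0" "B 2 1 = 0"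
    "B 3 0 = 0" "B 3 1 = 0" "B 4 0 = 0" "B 4 1 = 0" "B 5 0 = 0" "B 5 1 = 0" "B 6 0 = 0" "B 6 1 = 0"
    "B 7 0 = 0" "B 7 1 = 0"
    using dz v0 by (simp_all add: B_def dfield_def field_def Let_def z move_simps zero_prod_def)
  \<comment> \<open>Translations commute, a rotation and a translation give a translation, two
    rotations give the third.\<close>
  have 2:
    "B 2 2 = 0" "B 2 3 = 0" "B 2 4 = 0" "B 2 5 = field E 3 z" "B 2 6 = - field E 4 z" "B 2 7 = 0"
    "B 3 2 = 0" "B 3 3 = 0" "B 3 4 = 0" "B 3 5 = - field E 2 z" "B 3 6 = 0" "B 3 7 = - field E 4 z"
    "B 4 2 = 0" "B 4 3 = 0" "B 4 4 = 0" "B 4 5 = 0" "B 4 6 = field E 2 z" "B 4 7 = field E 3 z"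
    "B 5 2 = - field E 3 z" "B 5 3 = field E 2 z" "B 5 4 = 0" "B 5 5 = 0" "B 5 6 = - field E 7 z"
    "B 5 7 = field E 6 z" "B 6 2 = field E 4 z" "B 6 3 = 0" "B 6 4 = - field E 2 z"
    "B 6 5 = field E 7 z" "B 6 6 = 0" "B 6 7 = - field E 5 z" "B 7 2 = 0" "B 7 3 = field E 4 z"
    "B 7 4 = - field E 3 z" "B 7 5 = - field E 6 z" "B 7 6 = field E 5 z" "B 7 7 = 0"
    by (simp_all add: B_def dfield_def field_def Let_def z move_simps zero_prod_def vec_eq_iff forall_3)
  show ?thesis
    unfolding B_def[symmetric] sum8 euclidean_bracket_simps 0 1 2
    by (simp add: neg algebra_simps)
qed

lemma mixed_derivatives_commute_euclidean:
  fixes f :: "'a::real_normed_vector \<Rightarrow> 'b::euclidean_space"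
  assumes "open S" "smooth_on S f" "x \<in> S"
  shows "frechet_derivative (\<lambda>y. frechet_derivative f (at y) v) (at x) w =
         frechet_derivative (\<lambda>y. frechet_derivative f (at y) w) (at x) v"
proof (rule euclidean_eqI)
  fix b :: 'b
  have 1: "frechet_derivative (\<lambda>y. f y \<bullet> b) (at y) u = frechet_derivative f (at y) u \<bullet> b" if "y \<in> S" for y u
    using frechet_derivative_eq[OF has_derivative_inner_left[OF smooth_on_has_derivative[OF assms(2) that]]] by metis
  have 2: "frechet_derivative (\<lambda>y. frechet_derivative (\<lambda>y. f y \<bullet> b) (at y) u) (at x) u' =
      frechet_derivative (\<lambda>y. frechet_derivative f (at y) u) (at x) u' \<bullet> b" for u u'
  proof -
    have "frechet_derivative (\<lambda>y. frechet_derivative (\<lambda>y. f y \<bullet> b) (at y) u) (at x) =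
        frechet_derivative (\<lambda>y. frechet_derivative f (at y) u \<bullet> b) (at x)"
      by (rule frechet_derivative_cong_open[OF assms(1,3)]) (rule 1)
    then show ?thesis
      using frechet_derivative_eq[OF has_derivative_inner_left[OF smooth_on_has_derivative[OF
        smooth_on_frechet[OF assms(2), of u] assms(3)]], of b] by metis
  qed
  have "Ck_on 2 S (\<lambda>y. f y \<bullet> b)"
    using smooth_on_linear_compose[OF assms(1) bounded_linear_inner_left assms(2)] by (simp add: smooth_on_def)
  from mixed_derivatives_commute[OF assms(1) this assms(3)]
  show "frechet_derivative (\<lambda>y. frechet_derivative f (at y) v) (at x) w \<bullet> b =
         frechet_derivative (\<lambda>y. frechet_derivative f (at y) w) (at x) v \<bullet> b"
    unfolding 2 .
qed

text \<open>\<open>annihilated N As E x s\<close>: the combination of the eight fields with coefficients \<open>s\<close> lies in the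
  common kernel of \<open>As\<close> along the whole Euclidean fibre over the frame \<open>E x\<close>.\<close>

definition annihilated ::
    "frames set \<Rightarrow> 'k::real_normed_field form1 list \<Rightarrow> (real^2 \<Rightarrow> real^2^2) \<Rightarrow> real^2 \<Rightarrow> (nat \<Rightarrow> 'k) \<Rightarrow> bool"
  where
  "annihilated N As E x s \<longleftrightarrow> (\<forall>r F. (r, F) \<in> euclidean_frames \<longrightarrow> ((x, E x), (r, F)) \<in> N \<longrightarrow>
     (\<forall>j<length As. (\<Sum>a<8. s a * (As ! j) ((x, E x), (r, F)) (field E a ((x, E x), (r, F)))) = 0))"

lemma annihilated_add:
  "annihilated N As E x s \<Longrightarrow> annihilated N As E x t \<Longrightarrow> annihilated N As E x (\<lambda>a. s a + t a)"
  unfolding annihilated_def by (simp add: distrib_right sum.distrib)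

lemma annihilated_scale: "annihilated N As E x s \<Longrightarrow> annihilated N As E x (\<lambda>a. c * s a)"
  unfolding annihilated_def by (simp add: mult.assoc sum_distrib_left[symmetric])

lemma annihilated_cong:
  "annihilated N As E x s \<Longrightarrow> (\<And>a. a < 8 \<Longrightarrow> s a = t a) \<Longrightarrow> annihilated N As E x t"
  unfolding annihilated_def by simp

section \<open>Brackets of combinations in the kernel of a Frobenius system\<close>

context
  fixes N P :: "frames set" and As :: "'k::real_normed_field form1 list"
    and U :: "(real^2) set" and E :: "real^2 \<Rightarrow> real^2^2"
  assumes U: "open U" and E: "smooth_on U E" and N: "open N"
    and sub: "section_frames U E \<subseteq> P"
    and smooth: "\<And>A. A \<in> set As \<Longrightarrow> smooth_form N A"
    and frob: "\<And>z. z \<in> N \<inter> P \<Longrightarrow> frobenius_at P z As"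
begin

lemma field_bracket_section:
  fixes s t :: "nat \<Rightarrow> 'k"
  assumes "x \<in> U" and z: "z = ((x, E x), (r, F))" "z \<in> N" and j: "j < length As"
  shows "(\<Sum>a<8. \<Sum>b<8. s a * t b * (As ! j) z (dfield E b z (field E a z) - dfield E a z (field E b z))) =
    (\<Sum>c<8. euclidean_bracket s t c * (As ! j) z (field E c z))"
proof (rule field_bracket)
  show "linear ((As ! j) z)" using smooth[of "As ! j"] z j by (simp add: smooth_form_def)
  show "dfield E 1 z (field E 0 z) = dfield E 0 z (field E 1 z)"
    using mixed_derivatives_commute_euclidean[OF U E assms(1)] by (simp add: dfield_def field_def z Let_def)
  show "frechet_derivative (\<lambda>y. frechet_derivative E (at y) (axis i 1)) (at (fst (fst z))) 0 = 0" for i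
    using linear_0[OF has_derivative_linear[OF smooth_on_has_derivative[OF smooth_on_frechet[OF E] assms(1)]]]
    by (simp add: z)
qed

text \<open>The coefficients are functions of the surface point, hence only the two lifts
  differentiate them; all other contributions are the algebraic bracket.\<close>

lemma annihilated_bracket:
  fixes s t :: "nat \<Rightarrow> real^2 \<Rightarrow> 'k"
  assumes V: "open V" "x \<in> V" "V \<subseteq> U"
    and s: "\<And>y. y \<in> V \<Longrightarrow> annihilated N As E y (\<lambda>a. s a y)"
    and t: "\<And>y. y \<in> V \<Longrightarrow> annihilated N As E y (\<lambda>a. t a y)"
    and Ds: "\<And>a. a < 8 \<Longrightarrow> (s a has_derivative Ds a) (at x)"
    and Dt: "\<And>a. a < 8 \<Longrightarrow> (t a has_derivative Dt a) (at x)"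
  shows "annihilated N As E x (\<lambda>c. euclidean_bracket (\<lambda>a. s a x) (\<lambda>a. t a x) c +
    (s 0 x * Dt c (axis 1 1) + s 1 x * Dt c (axis 2 1) - t 0 x * Ds c (axis 1 1) - t 1 x * Ds c (axis 2 1)))"
  unfolding annihilated_def
proof (intro allI impI)
  fix r F j assume F: "(r, F) \<in> euclidean_frames" and zN: "((x, E x), (r, F)) \<in> N" and j: "j < length As"
  define z where "z = ((x, E x), (r, F))"
  have xU: "x \<in> U" using V by blast
  have zQ: "z \<in> section_frames V E" using V F by (simp add: z_def section_frames_def)
  have QP: "section_frames V E \<subseteq> P" using sub V by (auto simp: section_frames_def)
  have D: "((\<lambda>z. f (fst (fst z))) has_derivative (\<lambda>w. Df (fst (fst w)))) (at z)"
    if "(f has_derivative Df) (at x)" for f :: "real^2 \<Rightarrow> 'k" and Df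
    using has_derivative_compose[OF has_derivative_fst[OF has_derivative_fst[OF has_derivative_ident]], of f Df z] that
    by (simp add: z_def)
  have zN': "z \<in> N" using zN by (simp add: z_def)
  have frobz: "frobenius_at P z As" using frob zN' zQ QP by blast
  have van: "(\<Sum>a<8. f a (fst (fst y)) * (As ! j) y (field E a y)) = 0"
    if "\<And>y. y \<in> V \<Longrightarrow> annihilated N As E y (\<lambda>a. f a y)" "y \<in> section_frames V E \<inter> N" "j < length As" for f y j
    using that unfolding annihilated_def section_frames_def by force
  have tan: "field E a z \<in> tangent_space (section_frames V E) z" if "a \<in> {..<8}" for a
    using field_tangent[of a V E x r F] V F that smooth_on_subset[OF E V(3)] by (simp add: z_def)
  have DY: "(field E a has_derivative dfield E a z) (at z)" if "a \<in> {..<8}" for a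
    using field_has_derivative[OF _ E] that xU by (simp add: z_def)
  have dfs: "((\<lambda>z. s a (fst (fst z))) has_derivative (\<lambda>w. Ds a (fst (fst w)))) (at z)"
    and dft: "((\<lambda>z. t a (fst (fst z))) has_derivative (\<lambda>w. Dt a (fst (fst w)))) (at z)" if "a \<in> {..<8}" for a
    using D Ds Dt that by auto
  have br: "(\<Sum>a<8. \<Sum>b<8. s a (fst (fst z)) * t b (fst (fst z)) * (As ! j) z (dfield E b z (field E a z) - dfield E a z (field E b z))) +
    (\<Sum>b<8. (\<Sum>a<8. s a (fst (fst z)) * Dt b (fst (fst (field E a z))) - t a (fst (fst z)) * Ds b (fst (fst (field E a z)))) * (As ! j) z (field E b z)) = 0"
    by (rule frobenius_bracket[where I = "{..<8}" and N = N and P = P and Q = "section_frames V E" and As = As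
        and Y = "field E" and DY = "\<lambda>a. dfield E a z" and \<xi> = "\<lambda>a z. s a (fst (fst z))" and \<zeta> = "\<lambda>a z. t a (fst (fst z))"
        and D\<xi> = "\<lambda>a w. Ds a (fst (fst w))" and D\<zeta> = "\<lambda>a w. Dt a (fst (fst w))",
        OF N zN' finite_lessThan j smooth frobz tan QP zQ DY dfs dft van[OF s] van[OF t]])
  have f: "fst (fst (field E 0 z)) = axis 1 1" "fst (fst (field E 1 z)) = axis 2 1"
    "fst (fst (field E 2 z)) = 0" "fst (fst (field E 3 z)) = 0" "fst (fst (field E 4 z)) = 0"
    "fst (fst (field E 5 z)) = 0" "fst (fst (field E 6 z)) = 0" "fst (fst (field E 7 z)) = 0"
    by (simp_all add: field_def Let_def)
  have zero: "Ds b 0 = 0" "Dt b 0 = 0" if "b < 8" for b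
    using linear_0[OF has_derivative_linear[OF Ds[OF that]]] linear_0[OF has_derivative_linear[OF Dt[OF that]]] by auto
  have "(\<Sum>b<8. (\<Sum>a<8. s a (fst (fst z)) * Dt b (fst (fst (field E a z))) - t a (fst (fst z)) * Ds b (fst (fst (field E a z)))) * (As ! j) z (field E b z)) =
     (\<Sum>b<8. (s 0 x * Dt b (axis 1 1) + s 1 x * Dt b (axis 2 1) - t 0 x * Ds b (axis 1 1) - t 1 x * Ds b (axis 2 1)) * (As ! j) z (field E b z))"
  proof (intro sum.cong refl arg_cong2[where f = "(*)"])
    fix b assume "b \<in> {..<8::nat}"
    then have b: "b < 8" by simp
    show "(\<Sum>a<8. s a (fst (fst z)) * Dt b (fst (fst (field E a z))) - t a (fst (fst z)) * Ds b (fst (fst (field E a z)))) =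
      s 0 x * Dt b (axis 1 1) + s 1 x * Dt b (axis 2 1) - t 0 x * Ds b (axis 1 1) - t 1 x * Ds b (axis 2 1)"
      unfolding sum8 f zero[OF b] by (simp add: z_def algebra_simps)
  qed
  with br show "(\<Sum>a<8. (euclidean_bracket (\<lambda>a. s a x) (\<lambda>a. t a x) a +
     (s 0 x * Dt a (axis 1 1) + s 1 x * Dt a (axis 2 1) - t 0 x * Ds a (axis 1 1) - t 1 x * Ds a (axis 2 1))) *
     (As ! j) ((x, E x), (r, F)) (field E a ((x, E x), (r, F)))) = 0"
    unfolding field_bracket_section[OF xU z_def zN' j] z_def[symmetric] distrib_right sum.distrib
    by (simp add: z_def)
qed

text \<open>Without lift components the combinations are tangent to the Euclidean fibre and have
  constant coefficients there, so membership at the single point x suffices. The annihilated motions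
  over x thus form a Lie algebra even if they do not extend to neighbouring points.\<close>

lemma annihilated_fibre_bracket:
  fixes s t :: "nat \<Rightarrow> 'k"
  assumes x: "x \<in> U" and s: "annihilated N As E x s" "s 0 = 0" "s 1 = 0"
    and t: "annihilated N As E x t" "t 0 = 0" "t 1 = 0"
  shows "annihilated N As E x (euclidean_bracket s t)"
  unfolding annihilated_def
proof (intro allI impI)
  fix r F j assume F: "(r, F) \<in> euclidean_frames" and zN: "((x, E x), (r, F)) \<in> N" and j: "j < length As"
  define z where "z = ((x, E x), (r, F))"
  define Q where "Q = euclidean_fibre (x, E x)"
  have zQ: "z \<in> Q" using F by (simp add: z_def Q_def euclidean_fibre_def)
  have QP: "Q \<subseteq> P" using sub x by (auto simp: section_frames_def Q_def euclidean_fibre_def)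
  have zN': "z \<in> N" using zN by (simp add: z_def)
  have frobz: "frobenius_at P z As" using frob zN' zQ QP by blast
  have I: "(\<Sum>a<8. g a) = (\<Sum>a\<in>{2..<8}. g a)" if "g 0 = 0" "g 1 = 0" for g :: "nat \<Rightarrow> 'k"
  proof (rule sum.mono_neutral_right)
    show "\<forall>i\<in>{..<8} - {2..<8}. g i = 0"
    proof
      fix i :: nat assume "i \<in> {..<8} - {2..<8}"
      then have "i = 0 \<or> i = 1" by auto
      then show "g i = 0" using that by auto
    qed
  qed auto
  have van: "(\<Sum>a\<in>{2..<8}. f a * (As ! j) y (field E a y)) = 0"
    if f: "annihilated N As E x f" "f 0 = 0" "f 1 = 0" and y: "y \<in> Q \<inter> N" "j < length As" for f y j
  proof -
    have "(\<Sum>a<8. f a * (As ! j) y (field E a y)) = 0"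
      using f(1) y unfolding annihilated_def Q_def euclidean_fibre_def by auto
    then show ?thesis using I[of "\<lambda>a. f a * (As ! j) y (field E a y)"] f(2,3) by simp
  qed
  have tan: "field E a z \<in> tangent_space Q z" if "a \<in> {2..<8}" for a
    using move_tangent[OF F, of "a - 2" "(x, E x)"] that by (auto simp: z_def Q_def field_def)
  have DY: "(field E a has_derivative dfield E a z) (at z)" if "a \<in> {2..<8}" for a
    using field_has_derivative[OF _ E] that x by (simp add: z_def)
  have "(\<Sum>a\<in>{2..<8}. \<Sum>b\<in>{2..<8}. s a * t b * (As ! j) z (dfield E b z (field E a z) - dfield E a z (field E b z))) +
    (\<Sum>b\<in>{2..<8}. (\<Sum>a\<in>{2..<8}. s a * 0 - t a * 0) * (As ! j) z (field E b z)) = 0"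
    by (rule frobenius_bracket[where I = "{2..<8}" and N = N and P = P and Q = Q and As = As
        and Y = "field E" and DY = "\<lambda>a. dfield E a z" and \<xi> = "\<lambda>a z. s a" and \<zeta> = "\<lambda>a z. t a"
        and D\<xi> = "\<lambda>a w. 0" and D\<zeta> = "\<lambda>a w. 0",
        OF N zN' finite_atLeastLessThan j smooth frobz tan QP zQ DY has_derivative_const has_derivative_const van[OF s] van[OF t]])
  then have "(\<Sum>a\<in>{2..<8}. \<Sum>b\<in>{2..<8}. s a * t b * (As ! j) z (dfield E b z (field E a z) - dfield E a z (field E b z))) = 0"
    by simp
  moreover have "(\<Sum>a<8. \<Sum>b<8. s a * t b * (As ! j) z (dfield E b z (field E a z) - dfield E a z (field E b z))) =
     (\<Sum>a\<in>{2..<8}. \<Sum>b\<in>{2..<8}. s a * t b * (As ! j) z (dfield E b z (field E a z) - dfield E a z (field E b z)))"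
    using s(2,3) t(2,3) by (simp add: I)
  ultimately show "(\<Sum>a<8. euclidean_bracket s t a * (As ! j) ((x, E x), (r, F)) (field E a ((x, E x), (r, F)))) = 0"
    using field_bracket_section[OF x z_def zN' j, of s t] by (simp add: z_def)
qed

end

section \<open>The equations forced by Darboux integrability\<close>

text \<open>The space \<open>W\<close> of Euclidean motions below contains no two independent pure rotations and no
  rotation orthogonal to \<open>\<omega>\<^sup>1\<^sub>2\<close>. Removing translations from the brackets of its elements leaves pure
  rotations, whose proportionality gives the equations.\<close>

lemma euclidean_subalgebra_equations:
  fixes W :: "'k::real_normed_field \<Rightarrow> 'k \<Rightarrow> 'k \<Rightarrow> 'k \<Rightarrow> 'k \<Rightarrow> 'k \<Rightarrow> bool"
    and \<kappa> p q p1 p2 q2 :: 'k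
  assumes add: "\<And>u1 u2 u3 a b c u1' u2' u3' a' b' c'. W u1 u2 u3 a b c \<Longrightarrow> W u1' u2' u3' a' b' c' \<Longrightarrow>
      W (u1 + u1') (u2 + u2') (u3 + u3') (a + a') (b + b') (c + c')"
    and scale: "\<And>m u1 u2 u3 a b c. W u1 u2 u3 a b c \<Longrightarrow>
      W (m * u1) (m * u2) (m * u3) (m * a) (m * b) (m * c)"
    and br: "\<And>u1 u2 u3 a b c u1' u2' u3' a' b' c'. W u1 u2 u3 a b c \<Longrightarrow> W u1' u2' u3' a' b' c' \<Longrightarrow>
      W (a * u2' - u2 * a' - (b * u3' - u3 * b')) (- (a * u1' - u1 * a') - (c * u3' - u3 * c'))
        (b * u1' - u1 * b' + (c * u2' - u2 * c')) (- (b * c' - c * b')) (a * c' - c * a') (- (a * b' - b * a'))"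
    and rot: "\<And>b c. W 0 0 0 0 b c \<Longrightarrow> b = 0 \<and> c = 0"
    and G0: "W 0 0 1 \<kappa> (- p) (- q)"
    and T1: "W 0 (2 * \<kappa>) p (3 * \<kappa> * p) (\<kappa> * \<kappa> - p1) (- p2)"
    and T2: "W (- 2 * \<kappa>) 0 q (3 * \<kappa> * q) (- p2) (\<kappa> * \<kappa> - q2)"
    and \<kappa>: "\<kappa> \<noteq> 0" and pq: "p * p + q * q = 0 \<Longrightarrow> p = 0 \<and> q = 0"
  shows "p1 = 3 * p * p + \<kappa> * \<kappa> \<and> p2 = 3 * p * q \<and> q2 = 3 * q * q + \<kappa> * \<kappa>"
proof -
  \<comment> \<open>A, B, C are what remains of the rotation parts of \<open>T1\<close> and
    \<open>T2\<close>, up to sign, after \<open>G0\<close> has removed their translation along the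
    normal. The claim becomes \<kappa> A = p^2, \<kappa> B = q^2 and \<kappa> C = p q.\<close>
  define A where "A = (p1 - p * p - \<kappa> * \<kappa>) / (2 * \<kappa>)"
  define B where "B = (q2 - q * q - \<kappa> * \<kappa>) / (2 * \<kappa>)"
  define C where "C = (p2 - p * q) / (2 * \<kappa>)"
  define S where "S = p * p + q * q + C * C - A * B"
  define \<rho> where "\<rho> = p * p + q * q"
  have A: "p1 = 2 * (\<kappa> * A) + p * p + \<kappa> * \<kappa>" and B: "q2 = 2 * (\<kappa> * B) + q * q + \<kappa> * \<kappa>"
    and C: "p2 = 2 * (\<kappa> * C) + p * q"
    using \<kappa> by (simp_all add: A_def B_def C_def field_simps)
  have cong: "W u1 u2 u3 a b c \<Longrightarrow> u1 = u1' \<Longrightarrow> u2 = u2' \<Longrightarrow> u3 = u3' \<Longrightarrow> a = a' \<Longrightarrow> b = b' \<Longrightarrow> c = c' \<Longrightarrow>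
      W u1' u2' u3' a' b' c'" for u1 u2 u3 a b c u1' u2' u3' a' b' c' by simp
  \<comment> \<open>Eliminating the first components of two pure rotations leaves a rotation of the
    kind that \<open>rot\<close> excludes.\<close>
  have par: "a * b' = a' * b" "a * c' = a' * c" if "W 0 0 0 a b c" "W 0 0 0 a' b' c'" for a b c a' b' c'
  proof -
    have "W 0 0 0 0 (a * b' - a' * b) (a * c' - a' * c)"
      by (rule cong[OF add[OF scale[OF that(2), of a] scale[OF that(1), of "- a'"]]]) simp_all
    from rot[OF this] show "a * b' = a' * b" "a * c' = a' * c" by simp_all
  qed
  have G1: "W 1 0 0 (- q) C B"
    by (rule cong[OF scale[OF add[OF T2 scale[OF G0, of "- q"]], of "- 1 / (2 * \<kappa>)"]])
      (use \<kappa> in \<open>simp_all add: B C field_simps\<close>)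
  have G2: "W 0 1 0 p (- A) (- C)"
    by (rule cong[OF scale[OF add[OF T1 scale[OF G0, of "- p"]], of "1 / (2 * \<kappa>)"]])
      (use \<kappa> in \<open>simp_all add: A C field_simps\<close>)
  \<comment> \<open>\<open>G1\<close>, \<open>G2\<close> and \<open>G0\<close> have the three unit
    translations as translation parts, so suitable multiples of them strip any bracket down to a
    pure rotation.\<close>
  have R10: "W 0 0 0 (- 2 * \<kappa> * p) (S + \<kappa> * (A - B)) (2 * \<kappa> * C)"
    by (rule cong[OF add[OF add[OF br[OF G1 G0] scale[OF G1, of C]]
        add[OF scale[OF G2, of "B - \<kappa>"] scale[OF G0, of "- p"]]]])
      (simp_all add: S_def algebra_simps)
  have R20: "W 0 0 0 (- 2 * \<kappa> * q) (2 * \<kappa> * C) (S - \<kappa> * (A - B))"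
    by (rule cong[OF add[OF add[OF br[OF G2 G0] scale[OF G1, of "\<kappa> - A"]]
        add[OF scale[OF G2, of "- C"] scale[OF G0, of "- q"]]]])
      (simp_all add: S_def algebra_simps)
  define y where "y = S - 2 * \<rho> - \<kappa> * (A + B)"
  have R12: "W 0 0 0 y (2 * (q * C + p * A)) (2 * (p * C + q * B))"
    by (rule cong[OF add[OF add[OF br[OF G1 G2] scale[OF G1, of q]]
        add[OF scale[OF G2, of "- p"] scale[OF G0, of "- (A + B)"]]]])
      (simp_all add: S_def \<rho>_def y_def algebra_simps)
  have E1: "q * (S + \<kappa> * (A - B)) = 2 * \<kappa> * C * p" and E2: "p * (S - \<kappa> * (A - B)) = 2 * \<kappa> * C * q"
  proof -
    have "(2 * \<kappa>) * (q * (S + \<kappa> * (A - B)) - 2 * \<kappa> * C * p) = 0"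
      "(2 * \<kappa>) * (p * (S - \<kappa> * (A - B)) - 2 * \<kappa> * C * q) = 0"
      using par[OF R10 R20] by algebra+
    then show "q * (S + \<kappa> * (A - B)) = 2 * \<kappa> * C * p" "p * (S - \<kappa> * (A - B)) = 2 * \<kappa> * C * q"
      using \<kappa> by simp_all
  qed
  have "\<kappa> * A = p * p \<and> \<kappa> * B = q * q \<and> \<kappa> * C = p * q"
  proof (cases "\<rho> = 0")
    case True
    then have [simp]: "p = 0" "q = 0" using pq by (auto simp: \<rho>_def)
    \<comment> \<open>With p = q = 0 the first components of \<open>R10\<close> and
      \<open>R20\<close> vanish, so \<open>rot\<close> kills both outright; for larger \<rho> only
      proportionality is available.\<close>
    have "S + \<kappa> * (A - B) = 0 \<and> 2 * \<kappa> * C = 0" by (rule rot) (use R10 in simp)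
    moreover have "2 * \<kappa> * C = 0 \<and> S - \<kappa> * (A - B) = 0" by (rule rot) (use R20 in simp)
    moreover have "2 * S = (S + \<kappa> * (A - B)) + (S - \<kappa> * (A - B))" by simp
    ultimately have "C = 0" "S = 0" "\<kappa> * (A - B) = 0" using \<kappa> by auto
    then have "A = B" "A * B = 0" using \<kappa> by (simp_all add: S_def)
    then show ?thesis using \<open>C = 0\<close> by simp
  next
    case False
    have cancel: "m = 0" if "p * m = 0" "q * m = 0" for m
      using that False by (auto simp: \<rho>_def)
    have "S = \<kappa> * (A + B)"
    proof -
      \<comment> \<open>Half of p \<open>R10\<close> + q \<open>R20\<close>, whose entries collapse
        by \<open>E1\<close> and \<open>E2\<close>.\<close>
      have r: "W 0 0 0 (- \<kappa> * \<rho>) (p * S) (q * S)"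
      proof -
        have "p * (S + \<kappa> * (A - B)) + q * (2 * \<kappa> * C) = 2 * (p * S)"
          "p * (2 * \<kappa> * C) + q * (S - \<kappa> * (A - B)) = 2 * (q * S)"
          using E1 E2 by algebra+
        then have "W 0 0 0 (2 * (- \<kappa> * \<rho>)) (2 * (p * S)) (2 * (q * S))"
          by (intro cong[OF add[OF scale[OF R10, of p] scale[OF R20, of q]]])
            (simp_all add: \<rho>_def algebra_simps)
        from scale[OF this, of "1 / 2"] show ?thesis by simp
      qed
      have "(- \<kappa> * \<rho>) * (2 * (q * C + p * A)) = y * (p * S)" "(- \<kappa> * \<rho>) * (2 * (p * C + q * B)) = y * (q * S)"
        using par[OF r R12] .
      then have "p * (\<rho> * (S + \<kappa> * (A + B)) + y * S) = 0" "q * (\<rho> * (S + \<kappa> * (A + B)) + y * S) = 0"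
        using E1 E2 by algebra+
      then have "\<rho> * (S + \<kappa> * (A + B)) + y * S = 0" by (rule cancel)
      \<comment> \<open>Proportionality of \<open>r\<close> and \<open>R12\<close>, after cancelling
        p and q. The branch S = \<rho> needs further brackets to reach the same conclusion.\<close>
      then have "(S - \<rho>) * (S - \<kappa> * (A + B)) = 0" unfolding y_def by algebra
      moreover have "S = \<kappa> * (A + B)" if "S = \<rho>"
      proof -
        have r': "W 0 0 0 (- \<kappa>) p q"
          by (rule cong[OF scale[OF r, of "1 / \<rho>"]]) (use False that in simp_all)
        \<comment> \<open>In this branch the rotation \<open>r'\<close> cancels the rotation part of
          \<open>G0\<close> and a pure normal translation lies in W. Its brackets with
          \<open>G1\<close> and \<open>G2\<close>, stripped as before, are rotations in the first
          component only, and being proportional to \<open>r'\<close> with (p, q) nonzero they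
          vanish.\<close>
        have R3: "W 0 0 1 0 0 0"
          by (rule cong[OF add[OF G0 r']]) simp_all
        have CAB: "C * C = A * B" using that by (simp add: S_def \<rho>_def)
        have "W 0 0 0 (p * B - q * C) 0 0"
          by (rule cong[OF add[OF br[OF G1 R3] add[OF scale[OF G1, of C] scale[OF G2, of B]]]])
            (use CAB in \<open>simp_all add: algebra_simps\<close>)
        from par[OF this r'] have "p * (p * B - q * C) = 0" "q * (p * B - q * C) = 0"
          by (simp_all add: mult.commute)
        then have 1: "p * B - q * C = 0" by (rule cancel)
        have "W 0 0 0 (q * A - p * C) 0 0"
          by (rule cong[OF add[OF br[OF G2 R3] add[OF scale[OF G1, of "- A"] scale[OF G2, of "- C"]]]])
            (use CAB in \<open>simp_all add: algebra_simps\<close>)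
        from par[OF this r'] have "p * (q * A - p * C) = 0" "q * (q * A - p * C) = 0"
          by (simp_all add: mult.commute)
        then have 2: "q * A - p * C = 0" by (rule cancel)
        have "p * (S - \<kappa> * (A + B)) = 0" "q * (S - \<kappa> * (A + B)) = 0"
          using E1 E2 1 2 by algebra+
        then have "S - \<kappa> * (A + B) = 0" by (rule cancel)
        then show ?thesis by simp
      qed
      ultimately show ?thesis by auto
    qed
    \<comment> \<open>The symmetric matrix with diagonal A, B and off-diagonal C kills (-q, p),
      hence is a multiple of the square of (p, q); the trace found in \<open>s\<close> fixes the
      multiple.\<close>
    then have 1: "q * A = p * C" and 2: "p * B = q * C"
      using E1 E2 \<kappa> by (simp_all add: algebra_simps)
    have "p * (p * (A * B - C * C)) = 0" "q * (q * (A * B - C * C)) = 0" using 1 2 by algebra+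
    moreover have "\<rho> * (A * B - C * C) = p * (p * (A * B - C * C)) + q * (q * (A * B - C * C))"
      by (simp add: \<rho>_def algebra_simps)
    ultimately have "\<rho> * (A * B - C * C) = 0" by (metis add_0)
    then have "S = \<rho>" using False by (simp add: S_def \<rho>_def)
    then have s: "\<kappa> * (A + B) = \<rho>" using \<open>S = \<kappa> * (A + B)\<close> by simp
    have "\<rho> * (\<kappa> * A - p * p) = 0" "\<rho> * (\<kappa> * B - q * q) = 0" "\<rho> * (\<kappa> * C - p * q) = 0"
      using s 1 2 unfolding \<rho>_def by algebra+
    then show ?thesis using False by simp
  qed
  then show ?thesis unfolding A B C by simp
qed

section \<open>The singular systems evaluated on the eight fields\<close>

text \<open>A common form of both cases: a real \<kappa> equal to the root of |K| gives the first
  hyperbolic system, and \<i> times that root gives the elliptic one.\<close>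

definition singular_system ::
    "(frames \<Rightarrow> 'k::real_normed_field) \<Rightarrow> (real^2 \<Rightarrow> real^2^2) \<Rightarrow> 'k form1 list" where
  "singular_system \<kappa> g = map (\<lambda>A z v. of_real (A z v)) (isometric_embedding_system g) @
     [\<lambda>z v. of_real (omega2 3 1 z v) - \<kappa> z * of_real (eta g 2 z v),
      \<lambda>z v. of_real (omega2 3 2 z v) + \<kappa> z * of_real (eta g 1 z v)]"

text \<open>The inverse transpose of the coframe matrix: its rows are the orthonormal tangent
  vectors dual to the coframe.\<close>

definition dual_frame :: "(real^2 \<Rightarrow> real^2^2) \<Rightarrow> real^2 \<Rightarrow> real^2^2" where
  "dual_frame h x = vector [vector [h x $ 2 $ 2 / det (h x), - h x $ 2 $ 1 / det (h x)],
     vector [- h x $ 1 $ 2 / det (h x), h x $ 1 $ 1 / det (h x)]]"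

lemma dual_frame_simps:
  "dual_frame h x $ 1 $ 1 = h x $ 2 $ 2 / det (h x)" "dual_frame h x $ 1 $ 2 = - h x $ 2 $ 1 / det (h x)"
  "dual_frame h x $ 2 $ 1 = - h x $ 1 $ 2 / det (h x)" "dual_frame h x $ 2 $ 2 = h x $ 1 $ 1 / det (h x)"
  by (simp_all add: dual_frame_def)

context
  fixes U g h assumes cf: "coframe_on U g h"
begin

lemma dual_frame_smooth: "smooth_on U (dual_frame h)"
proof -
  have "smooth_on U (\<lambda>x. dual_frame h x $ i $ j)" for i j
    using exhaust_2[of i] exhaust_2[of j] coframe_det[OF cf]
    by (elim disjE; simp only: dual_frame_simps;
        intro smooth_on_divide smooth_on_uminus coframe_smooth[OF cf] coframe_det_smooth[OF cf] coframe_open[OF cf];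
        fastforce)
  then show ?thesis by (intro smooth_on_vec coframe_open[OF cf])
qed

lemma dual_frame_apply:
  assumes "x \<in> U"
  shows "h x $ i $ 1 * dual_frame h x $ j $ 1 + h x $ i $ 2 * dual_frame h x $ j $ 2 = (if i = j then 1 else 0)"
  using exhaust_2[of i] exhaust_2[of j] coframe_det[OF cf assms]
  by (elim disjE) (simp_all add: dual_frame_simps field_simps, simp_all add: det_2x2 algebra_simps)

lemma coframe_inner:
  assumes "x \<in> U"
  shows "v \<bullet> (g x *v w) = (h x $ 1 $ 1 * v $ 1 + h x $ 1 $ 2 * v $ 2) * (h x $ 1 $ 1 * w $ 1 + h x $ 1 $ 2 * w $ 2)
    + (h x $ 2 $ 1 * v $ 1 + h x $ 2 $ 2 * v $ 2) * (h x $ 2 $ 1 * w $ 1 + h x $ 2 $ 2 * w $ 2)"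
  by (simp add: inner_vec_def matrix_vector_mult_def UNIV_2 coframe_metric[OF cf assms] algebra_simps)

lemma dual_frame_inner:
  assumes "x \<in> U"
  shows "dual_frame h x $ i \<bullet> (g x *v w) = h x $ i $ 1 * w $ 1 + h x $ i $ 2 * w $ 2"
  using exhaust_2[of i] unfolding coframe_inner[OF assms] dual_frame_apply[OF assms] by auto

lemma dual_frame_det:
  assumes "x \<in> U"
  shows "det (dual_frame h x) > 0"
proof -
  have D: "det (h x) > 0" by (rule coframe_det[OF cf assms])
  have "det (dual_frame h x) * (det (h x) * det (h x)) = det (h x)"
    using D unfolding det_2x2[of "dual_frame h x"] dual_frame_simps
    by (simp add: field_simps) (simp add: det_2x2 algebra_simps)
  then show ?thesis using D by (metis mult_pos_pos zero_less_mult_pos2)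
qed

lemma dual_frame_surface_frames:
  assumes "x \<in> U" "U \<subseteq> \<Omega>"
  shows "(x, dual_frame h x) \<in> surface_frames \<Omega> g"
  using assms dual_frame_det[OF assms(1)] dual_frame_apply[OF assms(1)]
  by (auto simp: surface_frames_def dual_frame_inner[OF assms(1)])

text \<open>The covariant derivative of \<open>e\<^sub>2\<close> has the components of the connection form by the formula for
  the Christoffel symbols in terms of the coframe, after differentiating \<open>h E\<^sup>T = 1\<close>.\<close>

lemma eta12_dual_frame:
  assumes x: "x \<in> U"
  shows "eta12 g ((x, dual_frame h x), w) ((axis i 1, frechet_derivative (dual_frame h) (at x) (axis i 1)), w') = conn h i x"
proof -
  let ?E = "dual_frame h"
  have Es: "smooth_on U (\<lambda>y. ?E y $ k $ j)" for k j
    by (intro smooth_on_nth coframe_open[OF cf] dual_frame_smooth)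
  have dE: "(\<lambda>y. ?E y $ k $ j) differentiable (at x)" for k j
    by (rule smooth_on_differentiable[OF Es x])
  have dh: "(\<lambda>y. h y $ k $ j) differentiable (at x)" for k j
    by (rule smooth_on_differentiable[OF coframe_smooth[OF cf] x])
  have D: "frechet_derivative ?E (at x) (axis i 1) $ k $ j = partial i (\<lambda>y. ?E y $ k $ j) x" for k j
    by (rule partial_eq[symmetric], intro bounded_linear.has_derivative[OF bounded_linear_vec_nth]
        smooth_on_has_derivative[OF dual_frame_smooth x])
  have "partial i (\<lambda>y. h y $ 1 $ 1 * ?E y $ 2 $ 1 + h y $ 1 $ 2 * ?E y $ 2 $ 2) x = partial i (\<lambda>y. 0) x"
    by (rule partial_cong_open[OF coframe_open[OF cf] x]) (simp add: dual_frame_apply)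
  then have hE: "partial i (\<lambda>y. h y $ 1 $ 1) x * ?E x $ 2 $ 1 + h x $ 1 $ 1 * partial i (\<lambda>y. ?E y $ 2 $ 1) x +
      (partial i (\<lambda>y. h y $ 1 $ 2) x * ?E x $ 2 $ 2 + h x $ 1 $ 2 * partial i (\<lambda>y. ?E y $ 2 $ 2) x) = 0"
    by (simp add: partial_add partial_mult differentiable_mult dE dh)
  let ?G = "\<lambda>k b. christoffel g k i b x"
  have C: "christoffel_map g x (axis i 1) w $ k = ?G k 1 * w $ 1 + ?G k 2 * w $ 2" for w k
    using exhaust_2[of i] by (auto simp: christoffel_map_def UNIV_2 axis_def)
  have "eta12 g ((x, ?E x), w) ((axis i 1, frechet_derivative ?E (at x) (axis i 1)), w') =
      h x $ 1 $ 1 * (partial i (\<lambda>y. ?E y $ 2 $ 1) x + (?G 1 1 * ?E x $ 2 $ 1 + ?G 1 2 * ?E x $ 2 $ 2)) +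
      h x $ 1 $ 2 * (partial i (\<lambda>y. ?E y $ 2 $ 2) x + (?G 2 1 * ?E x $ 2 $ 1 + ?G 2 2 * ?E x $ 2 $ 2))"
    by (simp add: eta12_def dual_frame_inner[OF x] D C)
  also have "\<dots> = h x $ 1 $ 1 * partial i (\<lambda>y. ?E y $ 2 $ 1) x + h x $ 1 $ 2 * partial i (\<lambda>y. ?E y $ 2 $ 2) x
      + (h x $ 1 $ 1 * ?G 1 1 + h x $ 1 $ 2 * ?G 2 1) * ?E x $ 2 $ 1
      + (h x $ 1 $ 1 * ?G 1 2 + h x $ 1 $ 2 * ?G 2 2) * ?E x $ 2 $ 2"
    by (simp add: algebra_simps)
  also have "\<dots> = conn h i x * (h x $ 2 $ 1 * ?E x $ 2 $ 1 + h x $ 2 $ 2 * ?E x $ 2 $ 2)"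
    unfolding christoffel_coframe[OF cf x] using hE by (simp add: algebra_simps)
  also have "\<dots> = conn h i x" by (simp add: dual_frame_apply[OF x])
  finally show ?thesis .
qed

end

text \<open>None of the values depends on r or F. This is the Euclidean invariance that lets kernel
  elements have coefficients constant along the fibre.\<close>

lemma forms_on_fields:
  assumes cf: "coframe_on U g h" and x: "x \<in> U" and F: "(r, F) \<in> euclidean_frames"
    and z: "z = ((x, dual_frame h x), (r, F))" and a: "a < 8"
  shows "omega 1 z (field (dual_frame h) a z) = (if a = 2 then 1 else 0)"
    and "omega 2 z (field (dual_frame h) a z) = (if a = 3 then 1 else 0)"
    and "omega 3 z (field (dual_frame h) a z) = (if a = 4 then 1 else 0)"
    and "omega2 1 2 z (field (dual_frame h) a z) = (if a = 5 then 1 else 0)"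
    and "omega2 3 1 z (field (dual_frame h) a z) = (if a = 6 then 1 else 0)"
    and "omega2 3 2 z (field (dual_frame h) a z) = (if a = 7 then 1 else 0)"
    and "eta g i z (field (dual_frame h) a z) = (if a = 0 then h x $ i $ 1 else if a = 1 then h x $ i $ 2 else 0)"
    and "eta12 g z (field (dual_frame h) a z) = (if a = 0 then conn h 1 x else if a = 1 then conn h 2 x else 0)"
proof -
  have F': "F $ i \<bullet> F $ j = (if i = j then 1 else 0)" for i j
    using F by (simp add: euclidean_frames_def)
  let ?f = "\<lambda>a. field (dual_frame h) a z"
  show "omega 1 z (?f a) = (if a = 2 then 1 else 0)"
    using a by (rule less8_cases) (simp_all add: omega_def field_def Let_def z move_simps F' zero_prod_def)
  show "omega 2 z (?f a) = (if a = 3 then 1 else 0)"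
    using a by (rule less8_cases) (simp_all add: omega_def field_def Let_def z move_simps F' zero_prod_def)
  show "omega 3 z (?f a) = (if a = 4 then 1 else 0)"
    using a by (rule less8_cases) (simp_all add: omega_def field_def Let_def z move_simps F' zero_prod_def)
  show "omega2 1 2 z (?f a) = (if a = 5 then 1 else 0)"
    using a by (rule less8_cases) (simp_all add: omega2_def field_def Let_def z move_simps F' zero_prod_def)
  show "omega2 3 1 z (?f a) = (if a = 6 then 1 else 0)"
    using a by (rule less8_cases) (simp_all add: omega2_def field_def Let_def z move_simps F' zero_prod_def)
  show "omega2 3 2 z (?f a) = (if a = 7 then 1 else 0)"
    using a by (rule less8_cases) (simp_all add: omega2_def field_def Let_def z move_simps F' zero_prod_def)
  have e: "(axis 1 1 :: real^2) $ 2 = 0" "(axis 2 1 :: real^2) $ 1 = 0"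
    by (simp_all add: axis_def)
  show "eta g i z (?f a) = (if a = 0 then h x $ i $ 1 else if a = 1 then h x $ i $ 2 else 0)"
    using a by (rule less8_cases)
      (simp_all add: eta_def field_def Let_def z zero_prod_def dual_frame_inner[OF cf x] e)
  have c0: "christoffel_map g x 0 w = 0" for w
    by (simp add: christoffel_map_def vec_eq_iff)
  show "eta12 g z (?f a) = (if a = 0 then conn h 1 x else if a = 1 then conn h 2 x else 0)"
    using a
  proof (rule less8_cases)
    assume "a = 0"
    then show ?thesis using eta12_dual_frame[OF cf x, of "(r, F)" 1 0] by (simp add: field_def Let_def z)
  next
    assume "a = 1"
    then show ?thesis using eta12_dual_frame[OF cf x, of "(r, F)" 2 0] by (simp add: field_def Let_def z)
  qed (simp_all add: eta12_def field_def Let_def z zero_prod_def c0)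
qed

text \<open>Every form in the span of the singular system kills the two lifted fields, and a transverse
  pair is determined by its values on the last two rotations.\<close>

lemma combination_singular_system:
  "combination b (singular_system \<kappa> g) z v = b 0 * of_real (omega 3 z v)
     + b 1 * of_real (omega 1 z v - eta g 1 z v) + b 2 * of_real (omega 2 z v - eta g 2 z v)
     + b 3 * of_real (omega2 1 2 z v - eta12 g z v)
     + b 4 * (of_real (omega2 3 1 z v) - \<kappa> z * of_real (eta g 2 z v))
     + b 5 * (of_real (omega2 3 2 z v) + \<kappa> z * of_real (eta g 1 z v))"
  by (simp add: combination_def singular_system_def isometric_embedding_system_def eval_nat_numeral)

lemma combination_isometric_embedding_system:
  "combination b (map (\<lambda>A z v. of_real (A z v)) (isometric_embedding_system g)) z v =
     b 0 * of_real (omega 3 z v)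
     + b 1 * of_real (omega 1 z v - eta g 1 z v) + b 2 * of_real (omega 2 z v - eta g 2 z v)
     + b 3 * of_real (omega2 1 2 z v - eta12 g z v)"
  by (simp add: combination_def isometric_embedding_system_def eval_nat_numeral)

lemma section_frames_sub_frame_product:
  assumes "coframe_on U g h" "U \<subseteq> \<Omega>"
  shows "section_frames U (dual_frame h) \<subseteq> frame_product \<Omega> g"
  using dual_frame_surface_frames[OF assms(1) _ assms(2)]
  by (auto simp: section_frames_def frame_product_def)

context
  fixes U \<Omega> g h and \<kappa> :: "frames \<Rightarrow> 'k::real_normed_field" and As :: "'k form1 list" and x r F z
  assumes cf: "coframe_on U g h" and U\<Omega>: "U \<subseteq> \<Omega>" and x: "x \<in> U" and F: "(r, F) \<in> euclidean_frames"
    and z: "z = ((x, dual_frame h x), (r, F))"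
    and span: "\<And>A. A \<in> set As \<Longrightarrow> in_span_at (frame_product \<Omega> g) z (singular_system \<kappa> g) A"
begin

lemma field_tangent_frame_product:
  assumes "a < 8"
  shows "field (dual_frame h) a z \<in> tangent_space (frame_product \<Omega> g) z"
  unfolding z by (rule subsetD[OF tangent_space_mono[OF section_frames_sub_frame_product[OF cf U\<Omega>]]])
    (rule field_tangent[OF assms coframe_open[OF cf] dual_frame_smooth[OF cf] x F])

text \<open>The two lists are solved from the generators: a lift of a coordinate vector must have
  Euclidean components equal to its coframe components, no normal translation, first rotation
  \<open>conn\<close>, and the last two rotations prescribed by \<kappa>.\<close>

lemma span_on_fields:
  assumes "A \<in> set As"
  obtains b where "\<And>v. v \<in> tangent_space (frame_product \<Omega> g) z \<Longrightarrow> A z v = combination b (singular_system \<kappa> g) z v"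
    "A z (field (dual_frame h) 6 z) = b 4" "A z (field (dual_frame h) 7 z) = b 5"
    "(\<Sum>a<8. [1, 0, of_real (h x $ 1 $ 1), of_real (h x $ 2 $ 1), 0, of_real (conn h 1 x),
        \<kappa> z * of_real (h x $ 2 $ 1), - \<kappa> z * of_real (h x $ 1 $ 1)] ! a * A z (field (dual_frame h) a z)) = 0"
    "(\<Sum>a<8. [0, 1, of_real (h x $ 1 $ 2), of_real (h x $ 2 $ 2), 0, of_real (conn h 2 x),
        \<kappa> z * of_real (h x $ 2 $ 2), - \<kappa> z * of_real (h x $ 1 $ 2)] ! a * A z (field (dual_frame h) a z)) = 0"
proof -
  obtain b where b: "\<And>v. v \<in> tangent_space (frame_product \<Omega> g) z \<Longrightarrow> A z v = combination b (singular_system \<kappa> g) z v"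
    using span[OF assms] unfolding in_span_at_def by blast
  note val = b[OF field_tangent_frame_product] combination_singular_system forms_on_fields[OF cf x F z]
  have v: "A z (field (dual_frame h) 0 z) = - b 1 * of_real (h x $ 1 $ 1) - b 2 * of_real (h x $ 2 $ 1)
      - b 3 * of_real (conn h 1 x) - b 4 * \<kappa> z * of_real (h x $ 2 $ 1) + b 5 * \<kappa> z * of_real (h x $ 1 $ 1)"
    "A z (field (dual_frame h) 1 z) = - b 1 * of_real (h x $ 1 $ 2) - b 2 * of_real (h x $ 2 $ 2)
      - b 3 * of_real (conn h 2 x) - b 4 * \<kappa> z * of_real (h x $ 2 $ 2) + b 5 * \<kappa> z * of_real (h x $ 1 $ 2)"
    "A z (field (dual_frame h) 2 z) = b 1" "A z (field (dual_frame h) 3 z) = b 2" "A z (field (dual_frame h) 4 z) = b 0"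
    "A z (field (dual_frame h) 5 z) = b 3" "A z (field (dual_frame h) 6 z) = b 4" "A z (field (dual_frame h) 7 z) = b 5"
    by (simp_all add: val algebra_simps)
  show ?thesis
    by (rule that[OF b v(7,8)]) (unfold sum8 v, simp_all add: algebra_simps)
qed

text \<open>Modulo the embedding system a form is given by its values on the last two rotations. If
  a nonzero combination of these rotations were killed, the value pairs of two forms of the list
  would be proportional, and some nontrivial combination of the forms would lie in the embedding
  system, against transversality and independence.\<close>

lemma transverse_rotations:
  assumes len: "length As \<ge> 2"
    and trans: "transverse_at (frame_product \<Omega> g) z As (map (\<lambda>A z v. of_real (A z v)) (isometric_embedding_system g))"
    and ind: "independent_at (frame_product \<Omega> g) z As"
    and 0: "\<And>j. j < length As \<Longrightarrow> s * (As ! j) z (field (dual_frame h) 6 z) + t * (As ! j) z (field (dual_frame h) 7 z) = 0"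
  shows "s = 0 \<and> t = 0"
proof (rule ccontr)
  assume st: "\<not> (s = 0 \<and> t = 0)"
  have l: "0 < length As" "1 < length As" using len by linarith+
  then have "As ! 0 \<in> set As" "As ! 1 \<in> set As" by simp_all
  obtain b where b: "\<And>v. v \<in> tangent_space (frame_product \<Omega> g) z \<Longrightarrow> (As ! 0) z v = combination b (singular_system \<kappa> g) z v"
    "(As ! 0) z (field (dual_frame h) 6 z) = b 4" "(As ! 0) z (field (dual_frame h) 7 z) = b 5"
    by (rule span_on_fields[OF \<open>As ! 0 \<in> set As\<close>]) (rule that; assumption)
  obtain d where d: "\<And>v. v \<in> tangent_space (frame_product \<Omega> g) z \<Longrightarrow> (As ! 1) z v = combination d (singular_system \<kappa> g) z v"
    "(As ! 1) z (field (dual_frame h) 6 z) = d 4" "(As ! 1) z (field (dual_frame h) 7 z) = d 5"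
    by (rule span_on_fields[OF \<open>As ! 1 \<in> set As\<close>]) (rule that; assumption)
  have e: "s * b 4 + t * b 5 = 0" "s * d 4 + t * d 5 = 0" using 0[OF l(1)] 0[OF l(2)] unfolding b(2,3) d(2,3) by auto
  have "s * (b 4 * d 5 - b 5 * d 4) = 0" "t * (b 4 * d 5 - b 5 * d 4) = 0" using e by algebra+
  then have det: "b 4 * d 5 = b 5 * d 4" using st by auto
  \<comment> \<open>A vanishing determinant gives a dependency between the two value pairs; the
    cases make sure that the one chosen is not trivial.\<close>
  obtain m n where mn: "m \<noteq> 0 \<or> n \<noteq> 0" "m * b 4 + n * d 4 = 0" "m * b 5 + n * d 5 = 0"
  proof (cases "b 4 = 0 \<and> d 4 = 0")
    case True
    show ?thesis
    proof (cases "b 5 = 0 \<and> d 5 = 0")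
      case True
      then show ?thesis using \<open>b 4 = 0 \<and> d 4 = 0\<close> that[of 1 0] by simp
    next
      case False
      then show ?thesis using \<open>b 4 = 0 \<and> d 4 = 0\<close> that[of "d 5" "- b 5"] by (auto simp: mult.commute)
    qed
  next
    case False
    then show ?thesis using det that[of "d 4" "- b 4"] by (auto simp: mult.commute)
  qed
  define a where "a j = (if j = 0 then m else if j = 1 then n else 0)" for j :: nat
  have comb: "combination a As z v = m * (As ! 0) z v + n * (As ! 1) z v" for v
  proof -
    have "combination a As z v = (\<Sum>j\<in>{0, 1}. a j * (As ! j) z v)"
      unfolding combination_def by (rule sum.mono_neutral_right) (use len in \<open>auto simp: a_def\<close>)
    then show ?thesis by (simp add: a_def)
  qed
  have "combination a As z v = combination (\<lambda>l. m * b l + n * d l)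
      (map (\<lambda>A z v. of_real (A z v)) (isometric_embedding_system g)) z v"
    if "v \<in> tangent_space (frame_product \<Omega> g) z" for v
  proof -
    have "combination a As z v = combination (\<lambda>l. m * b l + n * d l)
      (map (\<lambda>A z v. of_real (A z v)) (isometric_embedding_system g)) z v
      + (m * b 4 + n * d 4) * (of_real (omega2 3 1 z v) - \<kappa> z * of_real (eta g 2 z v))
      + (m * b 5 + n * d 5) * (of_real (omega2 3 2 z v) + \<kappa> z * of_real (eta g 1 z v))"
      unfolding comb b(1)[OF that] d(1)[OF that] combination_singular_system
        combination_isometric_embedding_system by (simp add: algebra_simps)
    then show ?thesis by (simp add: mn)
  qed
  then have "\<forall>v\<in>tangent_space (frame_product \<Omega> g) z. combination a As z v = 0"
    using trans unfolding transverse_at_def by blast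
  then have "\<forall>j<length As. a j = 0" using ind unfolding independent_at_def by blast
  then have "a 0 = 0" "a 1 = 0" using l by simp_all
  then show False using mn(1) by (auto simp: a_def)
qed

end

section \<open>The brackets of the lifts over one chart\<close>

text \<open>Splitting each coefficient into a constant of the field and a real function confines the
  calculus to real functions, where \<open>partial\<close> applies.\<close>

lemma annihilated_bracket_real:
  fixes As :: "'k::real_normed_field form1 list" and cs ct :: "nat \<Rightarrow> 'k" and S T :: "nat \<Rightarrow> real^2 \<Rightarrow> real"
  assumes U: "open U" "smooth_on U E" and N: "open N" and P: "section_frames U E \<subseteq> P"
    and smooth: "\<And>A. A \<in> set As \<Longrightarrow> smooth_form N A"
    and frob: "\<And>z. z \<in> N \<inter> P \<Longrightarrow> frobenius_at P z As"
    and x: "x \<in> U"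
    and s: "\<And>y. y \<in> U \<Longrightarrow> annihilated N As E y (\<lambda>a. cs a * of_real (S a y))"
    and t: "\<And>y. y \<in> U \<Longrightarrow> annihilated N As E y (\<lambda>a. ct a * of_real (T a y))"
    and S: "\<And>a. a < 8 \<Longrightarrow> S a differentiable (at x)"
    and T: "\<And>a. a < 8 \<Longrightarrow> T a differentiable (at x)"
  shows "annihilated N As E x (\<lambda>b. euclidean_bracket (\<lambda>a. cs a * of_real (S a x)) (\<lambda>a. ct a * of_real (T a x)) b +
    (cs 0 * of_real (S 0 x) * (ct b * of_real (partial 1 (T b) x)) + cs 1 * of_real (S 1 x) * (ct b * of_real (partial 2 (T b) x))
     - ct 0 * of_real (T 0 x) * (cs b * of_real (partial 1 (S b) x)) - ct 1 * of_real (T 1 x) * (cs b * of_real (partial 2 (S b) x))))"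
proof -
  have D: "((\<lambda>y. m * of_real (G y)) has_derivative (\<lambda>w. m * of_real (frechet_derivative G (at x) w))) (at x)"
    if "G differentiable (at x)" for G and m :: 'k
    using that unfolding frechet_derivative_works
    by (rule has_derivative_mult_right[OF bounded_linear.has_derivative[OF bounded_linear_of_real]])
  show ?thesis
    using annihilated_bracket[OF U N P smooth frob U(1) x order_refl s t D[OF S] D[OF T]]
    unfolding partial_def .
qed

definition frame_deriv :: "(real^2 \<Rightarrow> real^2^2) \<Rightarrow> 2 \<Rightarrow> (real^2 \<Rightarrow> real) \<Rightarrow> real^2 \<Rightarrow> real" where
  "frame_deriv h i f x = dual_frame h x $ i $ 1 * partial 1 f x + dual_frame h x $ i $ 2 * partial 2 f x"

lemma dual_frame_solve:
  assumes "coframe_on U g h" "x \<in> U"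
  shows "h x $ 1 $ i * (dual_frame h x $ 1 $ 1 * d 1 + dual_frame h x $ 1 $ 2 * d 2) +
     h x $ 2 $ i * (dual_frame h x $ 2 $ 1 * d 1 + dual_frame h x $ 2 $ 2 * d 2) = (d i :: real)"
proof -
  have D: "det (h x) \<noteq> 0" using coframe_det[OF assms] by simp
  have "(h x $ 1 $ i * (dual_frame h x $ 1 $ 1 * d 1 + dual_frame h x $ 1 $ 2 * d 2) +
     h x $ 2 $ i * (dual_frame h x $ 2 $ 1 * d 1 + dual_frame h x $ 2 $ 2 * d 2)) * det (h x) =
     h x $ 1 $ i * (h x $ 2 $ 2 * d 1 - h x $ 2 $ 1 * d 2) + h x $ 2 $ i * (- h x $ 1 $ 2 * d 1 + h x $ 1 $ 1 * d 2)"
    using D by (simp add: dual_frame_simps field_simps)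
  also have "\<dots> = d i * det (h x)"
    using exhaust_2[of i] by (elim disjE) (simp_all add: det_2x2 algebra_simps)
  finally show ?thesis using D by simp
qed

lemma partial_frame_deriv:
  assumes "coframe_on U g h" "x \<in> U"
  shows "partial i f x = h x $ 1 $ i * frame_deriv h 1 f x + h x $ 2 $ i * frame_deriv h 2 f x"
  using dual_frame_solve[OF assms, of i "\<lambda>i. partial i f x"] by (simp add: frame_deriv_def)

lemma frame_deriv_smooth:
  assumes "coframe_on U g h" "smooth_on U f"
  shows "smooth_on U (frame_deriv h i f)"
  unfolding frame_deriv_def[abs_def] using coframe_open[OF assms(1)]
  by (intro smooth_on_add smooth_on_mult smooth_on_partial smooth_on_nth dual_frame_smooth[OF assms(1)] assms(2))

lemma list8: "[x0, x1, x2, x3, x4, x5, x6, x7] ! 0 = x0" "[x0, x1, x2, x3, x4, x5, x6, x7] ! 1 = x1"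
  "[x0, x1, x2, x3, x4, x5, x6, x7] ! 2 = x2" "[x0, x1, x2, x3, x4, x5, x6, x7] ! 3 = x3"
  "[x0, x1, x2, x3, x4, x5, x6, x7] ! 4 = x4" "[x0, x1, x2, x3, x4, x5, x6, x7] ! 5 = x5"
  "[x0, x1, x2, x3, x4, x5, x6, x7] ! 6 = x6" "[x0, x1, x2, x3, x4, x5, x6, x7] ! 7 = x7"
  by simp_all

text \<open>c is 1 in the hyperbolic and \<i> in the elliptic case: its assumption says that
  \<kappa> = c k has square - K. p and q are the components of df in the frame.\<close>

locale darboux_chart =
  fixes U \<Omega> :: "(real^2) set" and g h and c :: "'k::real_normed_field"
    and N :: "frames set" and As :: "'k form1 list" and K k f p q
  defines "K \<equiv> gauss_curvature g" and "k \<equiv> \<lambda>x. sqrt \<bar>K x\<bar>" and "f \<equiv> \<lambda>x. ln \<bar>K x\<bar> / 4"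
    and "p \<equiv> frame_deriv h 1 f" and "q \<equiv> frame_deriv h 2 f"
  assumes cf: "coframe_on U g h" and sub: "U \<subseteq> \<Omega>"
    and K0: "\<And>x. x \<in> U \<Longrightarrow> K x \<noteq> 0"
    and c: "\<And>x. x \<in> U \<Longrightarrow> c * c * of_real \<bar>K x\<bar> = - of_real (K x)"
    and N: "open N" and len: "length As \<ge> 2"
    and smooth: "\<And>A. A \<in> set As \<Longrightarrow> smooth_form N A"
    and good: "\<And>z. z \<in> N \<inter> frame_product \<Omega> g \<Longrightarrow>
      independent_at (frame_product \<Omega> g) z As \<and>
      (\<forall>A\<in>set As. in_span_at (frame_product \<Omega> g) z (singular_system (\<lambda>z. c * of_real (root_curvature g z)) g) A) \<and>
      frobenius_at (frame_product \<Omega> g) z As \<and>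
      transverse_at (frame_product \<Omega> g) z As (map (\<lambda>A z v. of_real (A z v)) (isometric_embedding_system g))"
begin

abbreviation E where "E \<equiv> dual_frame h"
abbreviation ann where "ann \<equiv> annihilated N As E"
abbreviation R :: "real \<Rightarrow> 'k" where "R \<equiv> of_real"

lemma U: "open U" using coframe_open[OF cf] .

lemma K_smooth: "smooth_on U K" unfolding K_def by (rule curvature_smooth[OF cf])

lemma absK_smooth: "smooth_on U (\<lambda>x. \<bar>K x\<bar>)"
proof -
  have "smooth_on U (\<lambda>x. sqrt (K x * K x))"
    by (rule smooth_on_sqrt[OF U smooth_on_mult[OF U K_smooth K_smooth]])
      (metis K0 not_real_square_gt_zero)
  then show ?thesis by simp
qed

lemma k_smooth: "smooth_on U k"
  unfolding k_def by (rule smooth_on_sqrt[OF U absK_smooth]) (use K0 in auto)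

lemma f_smooth: "smooth_on U f"
proof -
  have "smooth_on U (\<lambda>x. ln \<bar>K x\<bar>)" by (rule smooth_on_ln[OF U absK_smooth]) (use K0 in auto)
  from smooth_on_mult[OF U this smooth_on_const[of U "1 / 4"]] show ?thesis by (simp add: f_def)
qed

lemma p_smooth: "smooth_on U p" and q_smooth: "smooth_on U q"
  unfolding p_def q_def by (rule frame_deriv_smooth[OF cf f_smooth])+

lemmas dif = smooth_on_differentiable

lemma partial_f: "x \<in> U \<Longrightarrow> partial i f x = h x $ 1 $ i * p x + h x $ 2 $ i * q x"
  unfolding p_def q_def by (rule partial_frame_deriv[OF cf])

lemma k_pos: "x \<in> U \<Longrightarrow> k x > 0" using K0 by (simp add: k_def)

text \<open>By the normalization of f, k = exp (2 f) and therefore dk = 2 k df.\<close>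

lemma partial_k: assumes "x \<in> U" shows "partial i k x = 2 * k x * (h x $ 1 $ i * p x + h x $ 2 $ i * q x)"
proof -
  have k: "k y = exp (2 * f y)" if "y \<in> U" for y
  proof -
    have "2 * f y = ln (sqrt \<bar>K y\<bar>)" using K0[OF that] by (simp add: f_def ln_sqrt)
    then show ?thesis using K0[OF that] by (simp add: k_def)
  qed
  have "((\<lambda>t. exp (2 * t)) has_real_derivative 2 * exp (2 * f x)) (at (f x))"
    by (auto intro!: derivative_eq_intros)
  from partial_chain_real[OF this dif[OF f_smooth assms], of i]
  have "partial i (\<lambda>y. exp (2 * f y)) x = 2 * exp (2 * f x) * partial i f x" .
  then show ?thesis
    using partial_cong_open[OF U assms k, where i = i] by (simp add: k[OF assms] partial_f[OF assms])
qed

lemma kappa_squared: assumes "x \<in> U" shows "c * c * R (k x * k x) = - R (K x)"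
  using c[OF assms] by (simp add: k_def)

lemma section_sub: "section_frames U E \<subseteq> frame_product \<Omega> g"
  by (rule section_frames_sub_frame_product[OF cf sub])

lemma span_at:
  assumes "x \<in> U" "(r, F) \<in> euclidean_frames" "((x, E x), (r, F)) \<in> N" "j < length As"
  shows "in_span_at (frame_product \<Omega> g) ((x, E x), (r, F)) (singular_system (\<lambda>z. c * of_real (root_curvature g z)) g) (As ! j)"
  using good[of "((x, E x), (r, F))"] assms section_sub nth_mem unfolding section_frames_def by blast

text \<open>\<open>SX\<close> holds the real parts of the two lifts and \<open>SG\<close> those of
  the motion that their bracket produces; \<open>cX\<close> and \<open>cG\<close> hold the field
  constants, signs included.\<close>

definition SX :: "2 \<Rightarrow> (real^2 \<Rightarrow> real) list" where
  "SX i = [\<lambda>x. if i = 1 then 1 else 0, \<lambda>x. if i = 1 then 0 else 1, \<lambda>x. h x $ 1 $ i, \<lambda>x. h x $ 2 $ i,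
     \<lambda>x. 0, conn h i, \<lambda>x. k x * h x $ 2 $ i, \<lambda>x. k x * h x $ 1 $ i]"
definition "SG = [\<lambda>x. 0, \<lambda>x. 0, \<lambda>x. 0, \<lambda>x. 0, \<lambda>x. 1, k, p, q]"
definition "cX = [1, 1, 1, 1, 1, 1, c, - c]"
definition "cG = [1, 1, 1, 1, 1, c, - 1, - 1]"

lemmas lists = SX_def SG_def cX_def cG_def

lemma differentiable_sections:
  assumes "x \<in> U" "a < 8"
  shows "(SX i ! a) differentiable (at x)" "(SG ! a) differentiable (at x)"
proof -
  note d = dif[OF coframe_smooth[OF cf] assms(1)] dif[OF conn_smooth[OF cf] assms(1)] dif[OF k_smooth assms(1)]
    dif[OF p_smooth assms(1)] dif[OF q_smooth assms(1)] differentiable_mult differentiable_const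
  show "(SX i ! a) differentiable (at x)" "(SG ! a) differentiable (at x)"
    using assms(2) by (rule less8_cases; simp only: lists list8; intro d)+
qed

lemma ann_X:
  assumes "x \<in> U"
  shows "ann x (\<lambda>a. cX ! a * R ((SX 1 ! a) x))" "ann x (\<lambda>a. cX ! a * R ((SX 2 ! a) x))"
proof -
  have kr: "root_curvature g ((x, e), w) = k x" for e w by (simp add: root_curvature_def k_def K_def)
  show "ann x (\<lambda>a. cX ! a * R ((SX 1 ! a) x))" "ann x (\<lambda>a. cX ! a * R ((SX 2 ! a) x))"
  proof -
    have e: "(cX ! a * R ((SX 1 ! a) x)) = [1, 0, R (h x $ 1 $ 1), R (h x $ 2 $ 1), 0, R (conn h 1 x),
        (c * R (k x)) * R (h x $ 2 $ 1), - (c * R (k x)) * R (h x $ 1 $ 1)] ! a"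
      "(cX ! a * R ((SX 2 ! a) x)) = [0, 1, R (h x $ 1 $ 2), R (h x $ 2 $ 2), 0, R (conn h 2 x),
        (c * R (k x)) * R (h x $ 2 $ 2), - (c * R (k x)) * R (h x $ 1 $ 2)] ! a" if "a < 8" for a
      using that by (rule less8_cases; simp add: lists)+
    have "(\<Sum>a<8. cX ! a * R ((SX 1 ! a) x) * (As ! j) ((x, E x), (r, F)) (field E a ((x, E x), (r, F)))) = 0 \<and>
      (\<Sum>a<8. cX ! a * R ((SX 2 ! a) x) * (As ! j) ((x, E x), (r, F)) (field E a ((x, E x), (r, F)))) = 0"
      if F: "(r, F) \<in> euclidean_frames" "((x, E x), (r, F)) \<in> N" "j < length As" for r F j
    proof (rule span_on_fields[OF cf sub assms F(1) refl, of "[As ! j]" "\<lambda>z. c * of_real (root_curvature g z)" "As ! j"])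
      show "in_span_at (frame_product \<Omega> g) ((x, E x), (r, F)) (singular_system (\<lambda>z. c * of_real (root_curvature g z)) g) A"
        if "A \<in> set [As ! j]" for A using that span_at[OF assms F] by simp
    qed (auto simp: e kr)
    then show "ann x (\<lambda>a. cX ! a * R ((SX 1 ! a) x))" "ann x (\<lambda>a. cX ! a * R ((SX 2 ! a) x))"
      unfolding annihilated_def by blast+
  qed
qed

lemma partial_kh:
  assumes "x \<in> U"
  shows "partial i (\<lambda>x. k x * h x $ a $ b) x =
    2 * k x * (h x $ 1 $ i * p x + h x $ 2 $ i * q x) * h x $ a $ b + k x * partial i (\<lambda>x. h x $ a $ b) x"
  by (simp add: partial_mult dif[OF coframe_smooth[OF cf] assms] dif[OF k_smooth assms] partial_k[OF assms])

text \<open>The bracket of the lifted fields is a multiple of this section.\<close>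

lemma ann_G:
  assumes x: "x \<in> U"
  shows "ann x (\<lambda>a. cG ! a * R ((SG ! a) x))"
proof -
  have D: "det (h x) > 0" by (rule coframe_det[OF cf x])
  have k0: "k x > 0" by (rule k_pos[OF x])
  note ds = differentiable_sections(1)[OF x]
  have bracket: "ann x (\<lambda>b. euclidean_bracket (\<lambda>a. cX ! a * R ((SX 1 ! a) x)) (\<lambda>a. cX ! a * R ((SX 2 ! a) x)) b +
    (cX ! 0 * R ((SX 1 ! 0) x) * (cX ! b * R (partial 1 (SX 2 ! b) x)) + cX ! 1 * R ((SX 1 ! 1) x) * (cX ! b * R (partial 2 (SX 2 ! b) x))
     - cX ! 0 * R ((SX 2 ! 0) x) * (cX ! b * R (partial 1 (SX 1 ! b) x)) - cX ! 1 * R ((SX 2 ! 1) x) * (cX ! b * R (partial 2 (SX 1 ! b) x))))"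
    (is "ann x ?Z")
    by (rule annihilated_bracket_real[where cs = "(!) cX" and ct = "(!) cX" and S = "(!) (SX 1)" and T = "(!) (SX 2)",
        OF U dual_frame_smooth[OF cf] N section_sub smooth _ x ann_X ds ds]) (use good in blast)+
  note st = coframe_structure[OF cf x, unfolded curl_def]
  let ?c1 = "conn h 1 x" and ?c2 = "conn h 2 x" and ?h = "\<lambda>i j. h x $ i $ j"
  let ?d = "\<lambda>i a b. partial i (\<lambda>x. h x $ a $ b) x"
  let ?D = "det (h x)"
  have Z: "?Z 0 = 0" "?Z 1 = 0" "?Z 2 = 0" "?Z 3 = 0" "?Z 4 = - 2 * c * R (k x * ?D)"
    "?Z 5 = - 2 * (c * c) * R (k x * k x * ?D)" "?Z 6 = 2 * c * R (k x * p x * ?D)" "?Z 7 = 2 * c * R (k x * q x * ?D)"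
  proof -
    show "?Z 0 = 0" "?Z 1 = 0" unfolding euclidean_bracket_simps lists list8 by simp_all
    have "?Z 2 = R (?c1 * ?h 2 2 - ?c2 * ?h 2 1 + (?d 1 1 2 - ?d 2 1 1))"
      unfolding euclidean_bracket_simps lists list8 by (simp add: algebra_simps)
    then show "?Z 2 = 0" unfolding st by simp
    have "?Z 3 = R (?c2 * ?h 1 1 - ?c1 * ?h 1 2 + (?d 1 2 2 - ?d 2 2 1))"
      unfolding euclidean_bracket_simps lists list8 by (simp add: algebra_simps)
    then show "?Z 3 = 0" unfolding st by simp
    show "?Z 4 = - 2 * c * R (k x * ?D)"
      unfolding euclidean_bracket_simps lists list8 det_2x2 by (simp add: algebra_simps)
    \<comment> \<open>The curvature arrives from the connection and once more from the bracket of
      the two rotations in the lifts. As \<kappa>^2 = - K, the two terms are equal and add.\<close>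
    have "?Z 5 = R (partial 1 (conn h 2) x - partial 2 (conn h 1) x) - (c * c * R (k x * k x)) * R ?D"
      unfolding euclidean_bracket_simps lists list8 det_2x2 by (simp add: algebra_simps)
    also have "R (partial 1 (conn h 2) x - partial 2 (conn h 1) x) = R (K x * ?D)"
      unfolding K_def curvature_coframe[OF cf x] ..
    also have "\<dots> = - (c * c * R (k x * k x)) * R ?D" unfolding kappa_squared[OF x] by simp
    finally show "?Z 5 = - 2 * (c * c) * R (k x * k x * ?D)" by (simp add: algebra_simps)
    \<comment> \<open>The terms with \<open>conn\<close> and with derivatives of h cancel by the
      structure equation for \<eta>^2; only the derivative of k survives and leaves the component p
      of df.\<close>
    have "?Z 6 = c * R (- ?c1 * (k x * ?h 1 2) + ?c2 * (k x * ?h 1 1) + (partial 1 (\<lambda>x. k x * h x $ 2 $ 2) x - partial 2 (\<lambda>x. k x * h x $ 2 $ 1) x))"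
      unfolding euclidean_bracket_simps lists list8 by (simp add: algebra_simps)
    also have "- ?c1 * (k x * ?h 1 2) + ?c2 * (k x * ?h 1 1) + (partial 1 (\<lambda>x. k x * h x $ 2 $ 2) x - partial 2 (\<lambda>x. k x * h x $ 2 $ 1) x)
      = - k x * (?c1 * ?h 1 2 - ?c2 * ?h 1 1) + k x * (?d 1 2 2 - ?d 2 2 1) + 2 * k x * p x * ?D"
      unfolding partial_kh[OF x] det_2x2 by (simp add: algebra_simps)
    also have "\<dots> = 2 * (k x * p x * ?D)" unfolding st by (simp add: algebra_simps)
    finally show "?Z 6 = 2 * c * R (k x * p x * ?D)" by simp
    have "?Z 7 = - c * R (?c1 * (k x * ?h 2 2) - ?c2 * (k x * ?h 2 1) + (partial 1 (\<lambda>x. k x * h x $ 1 $ 2) x - partial 2 (\<lambda>x. k x * h x $ 1 $ 1) x))"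
      unfolding euclidean_bracket_simps lists list8 by (simp add: algebra_simps)
    also have "?c1 * (k x * ?h 2 2) - ?c2 * (k x * ?h 2 1) + (partial 1 (\<lambda>x. k x * h x $ 1 $ 2) x - partial 2 (\<lambda>x. k x * h x $ 1 $ 1) x)
      = k x * (?c1 * ?h 2 2 - ?c2 * ?h 2 1) + k x * (?d 1 1 2 - ?d 2 1 1) - 2 * k x * q x * ?D"
      unfolding partial_kh[OF x] det_2x2 by (simp add: algebra_simps)
    also have "\<dots> = - 2 * (k x * q x * ?D)" unfolding st by (simp add: algebra_simps)
    finally show "?Z 7 = 2 * c * R (k x * q x * ?D)" by simp
  qed
  have c0: "c \<noteq> 0" using c[OF x] K0[OF x] by auto
  \<comment> \<open>Normalizes the normal translation to 1.\<close>
  let ?m = "- 1 / (2 * c * R (k x * ?D))"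
  show ?thesis
  proof (rule annihilated_cong[OF annihilated_scale[OF bracket, of ?m]])
    fix a :: nat assume "a < 8"
    then show "?m * ?Z a = cG ! a * R ((SG ! a) x)"
      by (rule less8_cases; hypsubst; unfold Z; unfold lists list8) (use c0 k0 D in \<open>simp_all add: field_simps\<close>)
  qed
qed

lemma ann_X': "x \<in> U \<Longrightarrow> ann x (\<lambda>a. cX ! a * R ((SX i ! a) x))"
  using ann_X exhaust_2[of i] by auto

text \<open>The bracket of the i-th lift with the motion of \<open>ann_G\<close>, which has no lift
  components, so that only its own coefficients are differentiated. The \<open>conn\<close> terms
  make the derivatives of p and q covariant. In the component 3 \<kappa> df, two parts come from the
  derivative of k and one from the bracket of rotations.\<close>

lemma ann_nabla:
  assumes x: "x \<in> U"
  shows "ann x (\<lambda>a. [0, 0, - 2 * (c * R (k x)) * R (h x $ 2 $ i), 2 * (c * R (k x)) * R (h x $ 1 $ i),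
    R (h x $ 1 $ i * p x + h x $ 2 $ i * q x), 3 * (c * R (k x)) * R (h x $ 1 $ i * p x + h x $ 2 $ i * q x),
    (c * R (k x)) * (c * R (k x)) * R (h x $ 1 $ i) - R (partial i p x + q x * conn h i x),
    (c * R (k x)) * (c * R (k x)) * R (h x $ 2 $ i) - R (partial i q x - p x * conn h i x)] ! a)"
    (is "ann x (\<lambda>a. ?L ! a)")
proof -
  have bracket: "ann x (\<lambda>b. euclidean_bracket (\<lambda>a. cX ! a * R ((SX i ! a) x)) (\<lambda>a. cG ! a * R ((SG ! a) x)) b +
    (cX ! 0 * R ((SX i ! 0) x) * (cG ! b * R (partial 1 (SG ! b) x)) + cX ! 1 * R ((SX i ! 1) x) * (cG ! b * R (partial 2 (SG ! b) x))
     - cG ! 0 * R ((SG ! 0) x) * (cX ! b * R (partial 1 (SX i ! b) x)) - cG ! 1 * R ((SG ! 1) x) * (cX ! b * R (partial 2 (SX i ! b) x))))"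
    by (rule annihilated_bracket_real[where cs = "(!) cX" and ct = "(!) cG" and S = "(!) (SX i)" and T = "(!) SG",
        OF U dual_frame_smooth[OF cf] N section_sub smooth _ x ann_X' ann_G differentiable_sections(1)[OF x] differentiable_sections(2)[OF x]])
      (use good in blast)+
  have d: "cX ! 0 * R ((SX i ! 0) x) * (cG ! b * R (partial 1 (SG ! b) x)) + cX ! 1 * R ((SX i ! 1) x) * (cG ! b * R (partial 2 (SG ! b) x))
     - cG ! 0 * R ((SG ! 0) x) * (cX ! b * R (partial 1 (SX i ! b) x)) - cG ! 1 * R ((SG ! 1) x) * (cX ! b * R (partial 2 (SX i ! b) x))
     = cG ! b * R (partial i (SG ! b) x)" for b
    using exhaust_2[of i] unfolding lists list8 by auto
  show ?thesis
  proof (rule annihilated_cong[OF bracket[unfolded d]])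
    fix a :: nat assume "a < 8"
    then show "euclidean_bracket (\<lambda>a. cX ! a * R ((SX i ! a) x)) (\<lambda>a. cG ! a * R ((SG ! a) x)) a +
        cG ! a * R (partial i (SG ! a) x) = ?L ! a"
      by (rule less8_cases; hypsubst; unfold euclidean_bracket_simps; unfold lists list8)
        (simp_all add: partial_k[OF x] algebra_simps)
  qed
qed

text \<open>These are the components of the Hessian equation for f. They come from the algebra of
  the motions annihilated over the single point x; \<open>base\<close> guarantees a point of the
  fibre in N, without which annihilation would be vacuous.\<close>

lemma pde_at:
  assumes x: "x \<in> U" and base: "((x, E x), (0, mat 1)) \<in> N"
  shows "partial i p x = h x $ 1 $ i * (3 * (p x)\<^sup>2 - K x) + h x $ 2 $ i * (3 * p x * q x) - q x * conn h i x"
    and "partial i q x = h x $ 1 $ i * (3 * p x * q x) + h x $ 2 $ i * (3 * (q x)\<^sup>2 - K x) + p x * conn h i x"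
proof -
  define P where "P j = E x $ j $ 1 * (partial 1 p x + q x * conn h 1 x) + E x $ j $ 2 * (partial 2 p x + q x * conn h 2 x)" for j
  define Q where "Q j = E x $ j $ 1 * (partial 1 q x - p x * conn h 1 x) + E x $ j $ 2 * (partial 2 q x - p x * conn h 2 x)" for j
  have P: "partial i p x + q x * conn h i x = h x $ 1 $ i * P 1 + h x $ 2 $ i * P 2" for i
    unfolding P_def using dual_frame_solve[OF cf x, of i "\<lambda>i. partial i p x + q x * conn h i x"] by simp
  have Q: "partial i q x - p x * conn h i x = h x $ 1 $ i * Q 1 + h x $ 2 $ i * Q 2" for i
    unfolding Q_def using dual_frame_solve[OF cf x, of i "\<lambda>i. partial i q x - p x * conn h i x"] by simp
  note st = coframe_structure[OF cf x, unfolded curl_def]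
  have D: "det (h x) > 0" by (rule coframe_det[OF cf x])
  \<comment> \<open>Symmetry of the Hessian: partial derivatives of f commute and the connection has
    no torsion.\<close>
  have sym: "P 2 = Q 1"
  proof -
    note d = dif[OF coframe_smooth[OF cf] x] dif[OF p_smooth x] dif[OF q_smooth x] differentiable_mult
    have pp: "partial j (partial i f) x = partial j (\<lambda>y. h y $ 1 $ i * p y + h y $ 2 $ i * q y) x" for i j
      by (rule partial_cong_open[OF U x]) (rule partial_f)
    have "partial 1 (partial 2 f) x = partial 2 (partial 1 f) x"
      by (rule partial_commute[OF U f_smooth x])
    then have 0: "p x * (partial 1 (\<lambda>y. h y $ 1 $ 2) x - partial 2 (\<lambda>y. h y $ 1 $ 1) x) +
        q x * (partial 1 (\<lambda>y. h y $ 2 $ 2) x - partial 2 (\<lambda>y. h y $ 2 $ 1) x) +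
        h x $ 1 $ 2 * partial 1 p x + h x $ 2 $ 2 * partial 1 q x - h x $ 1 $ 1 * partial 2 p x - h x $ 2 $ 1 * partial 2 q x = 0"
      unfolding pp by (simp add: partial_add partial_mult d algebra_simps)
    have pi: "partial i p x = h x $ 1 $ i * P 1 + h x $ 2 $ i * P 2 - q x * conn h i x"
      "partial i q x = h x $ 1 $ i * Q 1 + h x $ 2 $ i * Q 2 + p x * conn h i x" for i
      using P[of i] Q[of i] by simp_all
    have "det (h x) * (Q 1 - P 2) = 0"
      using 0 unfolding st pi det_2x2 by (simp add: algebra_simps)
    then show ?thesis using D by simp
  qed
  define \<kappa> where "\<kappa> = c * R (k x)"
  have \<kappa>2: "\<kappa> * \<kappa> = - R (K x)" using kappa_squared[OF x] by (simp add: \<kappa>_def algebra_simps)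
  then have \<kappa>0: "\<kappa> \<noteq> 0" using K0[OF x] by auto
  \<comment> \<open>The two zeros are the lift components: W consists of Euclidean motions
    only.\<close>
  define W where "W u1 u2 u3 a b d = ann x (\<lambda>i. [0, 0, u1, u2, u3, a, b, d] ! i)" for u1 u2 u3 a b d
  have nab: "ann x (\<lambda>a. [0, 0, - 2 * \<kappa> * R (h x $ 2 $ i), 2 * \<kappa> * R (h x $ 1 $ i),
    R (h x $ 1 $ i * p x + h x $ 2 $ i * q x), 3 * \<kappa> * R (h x $ 1 $ i * p x + h x $ 2 $ i * q x),
    \<kappa> * \<kappa> * R (h x $ 1 $ i) - R (h x $ 1 $ i * P 1 + h x $ 2 $ i * P 2),
    \<kappa> * \<kappa> * R (h x $ 2 $ i) - R (h x $ 1 $ i * P 2 + h x $ 2 $ i * Q 2)] ! a)" for i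
    using ann_nabla[OF x, of i] unfolding P Q sym \<kappa>_def .
  have eE: "R (E x $ j $ 1) * R (h x $ m $ 1) + R (E x $ j $ 2) * R (h x $ m $ 2) = (if m = j then 1 else 0)" for j m
  proof -
    have "R (E x $ j $ 1) * R (h x $ m $ 1) + R (E x $ j $ 2) * R (h x $ m $ 2) =
        R (h x $ m $ 1 * E x $ j $ 1 + h x $ m $ 2 * E x $ j $ 2)" by (simp add: mult.commute)
    then show ?thesis unfolding dual_frame_apply[OF cf x] by simp
  qed
  \<comment> \<open>Contraction with the dual frame vector e_j replaces the coordinate index by a
    frame index; m1 and m2 are its coframe components.\<close>
  have frame: "W (- 2 * \<kappa> * m2) (2 * \<kappa> * m1) (m1 * R (p x) + m2 * R (q x)) (3 * \<kappa> * (m1 * R (p x) + m2 * R (q x)))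
      (\<kappa> * \<kappa> * m1 - (m1 * R (P 1) + m2 * R (P 2))) (\<kappa> * \<kappa> * m2 - (m1 * R (P 2) + m2 * R (Q 2)))"
    if m1: "m1 = (if 1 = j then 1 else 0)" and m2: "m2 = (if 2 = j then 1 else 0)" for j :: 2 and m1 m2
    unfolding W_def m1 m2 eE[symmetric]
    by (rule annihilated_cong[OF annihilated_add[OF annihilated_scale[OF nab[of 1], of "R (E x $ j $ 1)"]
        annihilated_scale[OF nab[of 2], of "R (E x $ j $ 2)"]]], rule less8_cases, assumption)
      (simp_all add: algebra_simps)
  note T1 = frame[of 1 1 0] and T2 = frame[of 0 2 1]
  have eqs: "R (P 1) = 3 * R (p x) * R (p x) + \<kappa> * \<kappa> \<and> R (P 2) = 3 * R (p x) * R (q x) \<and>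
    R (Q 2) = 3 * R (q x) * R (q x) + \<kappa> * \<kappa>"
  proof (rule euclidean_subalgebra_equations[where W = W and \<kappa> = \<kappa>])
    show "W (u1 + u1') (u2 + u2') (u3 + u3') (a + a') (b + b') (c + c')"
      if "W u1 u2 u3 a b c" "W u1' u2' u3' a' b' c'" for u1 u2 u3 a b c u1' u2' u3' a' b' c'
      unfolding W_def by (rule annihilated_cong[OF annihilated_add[OF that[unfolded W_def]]]) (erule less8_cases; simp)
    show "W (m * u1) (m * u2) (m * u3) (m * a) (m * b) (m * c)" if "W u1 u2 u3 a b c" for m u1 u2 u3 a b c
      unfolding W_def by (rule annihilated_cong[OF annihilated_scale[OF that[unfolded W_def], of m]]) (erule less8_cases; simp)
    show "W (a * u2' - u2 * a' - (b * u3' - u3 * b')) (- (a * u1' - u1 * a') - (c * u3' - u3 * c'))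
        (b * u1' - u1 * b' + (c * u2' - u2 * c')) (- (b * c' - c * b')) (a * c' - c * a') (- (a * b' - b * a'))"
      if "W u1 u2 u3 a b c" "W u1' u2' u3' a' b' c'" for u1 u2 u3 a b c u1' u2' u3' a' b' c'
    proof -
      have "ann x (euclidean_bracket (\<lambda>i. [0, 0, u1, u2, u3, a, b, c] ! i) (\<lambda>i. [0, 0, u1', u2', u3', a', b', c'] ! i))"
        by (rule annihilated_fibre_bracket[OF U dual_frame_smooth[OF cf] N section_sub smooth _ x])
          (use good that[unfolded W_def] in auto)
      then show ?thesis unfolding W_def
        by (rule annihilated_cong) (erule less8_cases; hypsubst; unfold euclidean_bracket_simps list8; rule refl)
    qed
    show "b = 0 \<and> d = 0" if "W 0 0 0 0 b d" for b d
    proof -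
      define z where "z = ((x, E x), (0 :: real^3, mat 1 :: real^3^3))"
      have F: "(0, mat 1) \<in> euclidean_frames"
        by (simp add: euclidean_frames_def forall_3 inner_vec_def sum_3 mat_def)
      have zN: "z \<in> N \<inter> frame_product \<Omega> g"
        using base section_sub x F by (auto simp: z_def section_frames_def)
      show ?thesis
      proof (rule transverse_rotations[OF cf sub x F z_def])
        show "b * (As ! j) z (field E 6 z) + d * (As ! j) z (field E 7 z) = 0" if "j < length As" for j
        proof -
          have "(\<Sum>a<8. [0, 0, 0, 0, 0, 0, b, d] ! a * (As ! j) z (field E a z)) = 0"
            using \<open>W 0 0 0 0 b d\<close> F base that unfolding W_def annihilated_def z_def by blast
          then show ?thesis unfolding sum8 list8 by simp
        qed
      qed (use good[OF zN] len in auto)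
    qed
    show "W 0 0 1 \<kappa> (- R (p x)) (- R (q x))"
      unfolding W_def by (rule annihilated_cong[OF ann_G[OF x]]) (erule less8_cases; simp add: lists \<kappa>_def)
    show "W 0 (2 * \<kappa>) (R (p x)) (3 * \<kappa> * R (p x)) (\<kappa> * \<kappa> - R (P 1)) (- R (P 2))" using T1 by simp
    show "W (- 2 * \<kappa>) 0 (R (q x)) (3 * \<kappa> * R (q x)) (- R (P 2)) (\<kappa> * \<kappa> - R (Q 2))" using T2 by simp
    show "\<kappa> \<noteq> 0" by (rule \<kappa>0)
    \<comment> \<open>p and q are real numbers, so a vanishing sum of squares kills both even when
      the field is complex.\<close>
    show "R (p x) = 0 \<and> R (q x) = 0" if "R (p x) * R (p x) + R (q x) * R (q x) = 0"
    proof -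
      have "R (p x * p x + q x * q x) = 0" using that by simp
      then have "p x * p x + q x * q x = 0" by (simp only: of_real_eq_0_iff)
      then show ?thesis by (simp add: sum_squares_eq_zero_iff)
    qed
  qed
  have "R (P 1) = R (3 * (p x)\<^sup>2 - K x)" using eqs \<kappa>2 by (simp add: power2_eq_square)
  then have 1: "P 1 = 3 * (p x)\<^sup>2 - K x" by (simp only: of_real_eq_iff)
  have "R (P 2) = R (3 * p x * q x)" using eqs by simp
  then have 2: "P 2 = 3 * p x * q x" by (simp only: of_real_eq_iff)
  have "R (Q 2) = R (3 * (q x)\<^sup>2 - K x)" using eqs \<kappa>2 by (simp add: power2_eq_square)
  then have 3: "Q 2 = 3 * (q x)\<^sup>2 - K x" by (simp only: of_real_eq_iff)
  show "partial i p x = h x $ 1 $ i * (3 * (p x)\<^sup>2 - K x) + h x $ 2 $ i * (3 * p x * q x) - q x * conn h i x"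
    using P[of i] unfolding 1 2 by simp
  show "partial i q x = h x $ 1 $ i * (3 * p x * q x) + h x $ 2 $ i * (3 * (q x)\<^sup>2 - K x) + p x * conn h i x"
    using Q[of i] unfolding sym[symmetric] 2 3 by simp
qed

end

section \<open>Normal forms in a chart\<close>

lemma frechet_derivative_expand:
  fixes f :: "'a::euclidean_space \<Rightarrow> 'b::real_normed_vector"
  assumes "f differentiable (at x)"
  shows "frechet_derivative f (at x) v = (\<Sum>b\<in>Basis. (v \<bullet> b) *\<^sub>R frechet_derivative f (at x) b)"
proof -
  interpret linear "frechet_derivative f (at x)" using assms by (rule linear_frechet_derivative)
  have "frechet_derivative f (at x) v = frechet_derivative f (at x) (\<Sum>b\<in>Basis. (v \<bullet> b) *\<^sub>R b)"
    by (simp add: euclidean_representation)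
  also have "\<dots> = (\<Sum>b\<in>Basis. (v \<bullet> b) *\<^sub>R frechet_derivative f (at x) b)" by (simp add: sum scale)
  finally show ?thesis .
qed

text \<open>The primitive is the integral along rays; by closedness its gradient is the integral of
  \<open>d/dt (t F (a + t (x - a)))\<close>.\<close>

lemma poincare_ball:
  fixes F :: "'a::euclidean_space \<Rightarrow> 'a"
  assumes "smooth_on (ball a e) F"
    and closed: "\<And>x v w. x \<in> ball a e \<Longrightarrow>
      frechet_derivative F (at x) v \<bullet> w = frechet_derivative F (at x) w \<bullet> v"
  obtains f :: "'a \<Rightarrow> real" where "\<And>x. x \<in> ball a e \<Longrightarrow> (f has_derivative (\<lambda>w. F x \<bullet> w)) (at x)"
    "smooth_on (ball a e) f"
proof -
  let ?B = "ball a e"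
  define y where "y x t = a + t *\<^sub>R (x - a)" for x t
  have yB: "y x t \<in> ?B" if "x \<in> ?B" "t \<in> cbox 0 1" for x and t :: real
  proof -
    have "y x t = (1 - t) *\<^sub>R a + t *\<^sub>R x" by (simp add: y_def algebra_simps)
    moreover have "a \<in> ?B" using that(1) by (metis centre_in_ball ball_eq_empty empty_iff not_le)
    ultimately show ?thesis using convexD[OF convex_ball \<open>a \<in> ?B\<close> that(1), of "1 - t" t] that(2) by simp
  qed
  have dF: "(F has_derivative frechet_derivative F (at x)) (at x)" if "x \<in> ?B" for x
    by (rule smooth_on_has_derivative[OF assms(1) that])
  define G where "G x t = t *\<^sub>R frechet_derivative F (at (y x t)) (x - a) + F (y x t)" for x t
  define f where "f x = integral (cbox 0 1) (\<lambda>t. F (y x t) \<bullet> (x - a))" for x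
  have contF: "continuous_on ?B F" by (rule smooth_on_continuous[OF assms(1)])
  have conty: "continuous_on (?B \<times> cbox 0 1) (\<lambda>(x, t). y x t)"
    unfolding y_def split_beta by (intro continuous_intros)
  have contFy: "continuous_on (?B \<times> cbox 0 1) (\<lambda>(x, t). F (y x t))"
    using continuous_on_compose2[OF contF conty] yB by (force simp: split_beta)
  have contDy: "continuous_on (?B \<times> cbox 0 1) (\<lambda>(x, t). frechet_derivative F (at (y x t)) b)" for b
    using continuous_on_compose2[OF smooth_on_continuous[OF smooth_on_frechet[OF assms(1)]] conty] yB
    by (force simp: split_beta)
  have contG: "continuous_on (?B \<times> cbox 0 1) (\<lambda>(x, t). G x t)"
  proof -
    have "continuous_on (?B \<times> cbox 0 1) (\<lambda>(x, t). t *\<^sub>R (\<Sum>b\<in>Basis. ((x - a) \<bullet> b) *\<^sub>R frechet_derivative F (at (y x t)) b) + F (y x t))"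
      unfolding split_beta
      by (intro continuous_intros contFy[unfolded split_beta] contDy[unfolded split_beta])
    moreover have "G x t = t *\<^sub>R (\<Sum>b\<in>Basis. ((x - a) \<bullet> b) *\<^sub>R frechet_derivative F (at (y x t)) b) + F (y x t)"
      if "x \<in> ?B" "t \<in> cbox 0 1" for x t
      unfolding G_def
      by (subst frechet_derivative_expand) (use dF[OF yB[OF that]] in \<open>auto simp: differentiable_def\<close>)
    ultimately show ?thesis
      by (subst continuous_on_cong[OF refl, of _ _ "\<lambda>(x, t). t *\<^sub>R (\<Sum>b\<in>Basis. ((x - a) \<bullet> b) *\<^sub>R frechet_derivative F (at (y x t)) b) + F (y x t)"]) auto
  qed
  have der: "(f has_derivative (\<lambda>w. F x \<bullet> w)) (at x)" if x: "x \<in> ?B" for x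
  proof -
    have 1: "((\<lambda>x. F (y x t) \<bullet> (x - a)) has_derivative blinfun_apply (blinfun_inner_right (G x t))) (at x within ?B)"
      if "x \<in> ?B" "t \<in> cbox 0 1" for x t
    proof -
      have yd: "((\<lambda>x. y x t) has_derivative (\<lambda>w. t *\<^sub>R w)) (at x within ?B)"
        unfolding y_def by (auto intro!: derivative_eq_intros)
      interpret linear "frechet_derivative F (at (y x t))" using dF[OF yB[OF that]] by (rule has_derivative_linear)
      have "((\<lambda>x. F (y x t)) has_derivative (\<lambda>w. frechet_derivative F (at (y x t)) (t *\<^sub>R w))) (at x within ?B)"
        by (rule has_derivative_compose[OF yd dF[OF yB[OF that]]])
      then have "((\<lambda>x. F (y x t) \<bullet> (x - a)) has_derivative
          (\<lambda>w. F (y x t) \<bullet> w + frechet_derivative F (at (y x t)) (t *\<^sub>R w) \<bullet> (x - a))) (at x within ?B)"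
        by (auto intro!: derivative_eq_intros)
      \<comment> \<open>Closedness exchanges w with x - a in the derivative term, so that the whole
        becomes the inner product of w with G.\<close>
      moreover have "F (y x t) \<bullet> w + frechet_derivative F (at (y x t)) (t *\<^sub>R w) \<bullet> (x - a) =
          blinfun_apply (blinfun_inner_right (G x t)) w" for w
        using closed[OF yB[OF that], of w "x - a"] by (simp add: G_def scale inner_add_left)
      ultimately show ?thesis by simp
    qed
    have 2: "(\<lambda>t. F (y x t) \<bullet> (x - a)) integrable_on cbox 0 1" if "x \<in> ?B" for x
    proof (rule integrable_continuous)
      have "continuous_on (cbox 0 1) (\<lambda>t. F (y x t))"
      proof -
        have "Pair x ` cbox 0 1 \<subseteq> ?B \<times> cbox (0::real) 1" using that by auto
        moreover have "continuous_on (cbox (0::real) 1) (Pair x)" by (intro continuous_intros)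
        ultimately show ?thesis
          using continuous_on_compose[of "cbox 0 1" "Pair x" "\<lambda>(x, t). F (y x t)"] continuous_on_subset[OF contFy]
          by (simp add: o_def)
      qed
      then show "continuous_on (cbox 0 1) (\<lambda>t. F (y x t) \<bullet> (x - a))" by (intro continuous_intros)
    qed
    have 3: "continuous_on (?B \<times> cbox 0 1) (\<lambda>(x, t). blinfun_inner_right (G x t))"
      using bounded_linear.continuous_on[OF bounded_linear_blinfun_inner_right contG] by (simp add: split_beta)
    from leibniz_rule[OF 1 2 3 x convex_ball]
    have L: "(f has_derivative blinfun_apply (integral (cbox 0 1) (\<lambda>t. blinfun_inner_right (G x t)))) (at x within ?B)"
      unfolding f_def by simp
    have "((\<lambda>t. t *\<^sub>R F (y x t)) has_vector_derivative G x t) (at t within {0..1})" if "t \<in> {0..1}" for t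
    proof -
      have yd: "((\<lambda>t. y x t) has_derivative (\<lambda>s. s *\<^sub>R (x - a))) (at t within {0..1})"
        unfolding y_def by (auto intro!: derivative_eq_intros)
      have yb: "y x t \<in> ?B" using yB[OF x, of t] that by simp
      interpret linear "frechet_derivative F (at (y x t))" using dF[OF yb] by (rule has_derivative_linear)
      have "((\<lambda>t. F (y x t)) has_derivative (\<lambda>s. frechet_derivative F (at (y x t)) (s *\<^sub>R (x - a)))) (at t within {0..1})"
        by (rule has_derivative_compose[OF yd dF[OF yb]])
      from has_derivative_scaleR[OF has_derivative_ident this]
      show ?thesis by (simp add: has_vector_derivative_def G_def scale scaleR_add_right mult.commute add.commute)
    qed
    from fundamental_theorem_of_calculus[OF _ this]
    have "(G x has_integral F x) (cbox 0 1)" by (simp add: y_def)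
    from has_integral_linear[OF this bounded_linear_blinfun_inner_right]
    have "((\<lambda>t. blinfun_inner_right (G x t)) has_integral blinfun_inner_right (F x)) (cbox 0 1)" by (simp add: o_def)
    then have "integral (cbox 0 1) (\<lambda>t. blinfun_inner_right (G x t)) = blinfun_inner_right (F x)"
      by (rule integral_unique)
    then show ?thesis using L x by (simp add: at_within_open[OF x open_ball] blinfun_inner_right.rep_eq[abs_def])
  qed
  moreover have "smooth_on ?B f"
  proof (rule smooth_on_SucI[OF open_ball der])
    show "smooth_on ?B (\<lambda>x. F x \<bullet> v)" for v
      by (rule smooth_on_linear_compose[OF open_ball bounded_linear_inner_left assms(1)])
  qed
  ultimately show ?thesis by (rule that)
qed

text \<open>The derivative of the inverse G at y is the inverse Jacobian matrix at G y, and that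
  matrix is smooth; hence each order of differentiability of G gives the next.\<close>

lemma smooth_inverse_function:
  fixes \<psi> :: "real^2 \<Rightarrow> real^2"
  assumes "open U" "smooth_on U \<psi>" "x0 \<in> U"
    and jac: "partial 1 (\<lambda>y. \<psi> y $ 1) x0 * partial 2 (\<lambda>y. \<psi> y $ 2) x0 -
       partial 2 (\<lambda>y. \<psi> y $ 1) x0 * partial 1 (\<lambda>y. \<psi> y $ 2) x0 \<noteq> 0"
  obtains V W G where "open V" "V \<subseteq> U" "x0 \<in> V" "open W" "homeomorphism V W \<psi> G" "smooth_on W G"
proof -
  define P where "P i j = partial j (\<lambda>y. \<psi> y $ i)" for i j
  define J where "J x = P 1 1 x * P 2 2 x - P 1 2 x * P 2 1 x" for x
  have Ps: "smooth_on U (P i j)" for i j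
    unfolding P_def by (intro smooth_on_partial smooth_on_nth assms)
  have Js: "smooth_on U J"
    unfolding J_def[abs_def] by (intro smooth_on_diff smooth_on_mult Ps assms)
  define U1 where "U1 = {x\<in>U. J x \<noteq> 0}"
  have "open (U \<inter> J -` (- {0}))"
    by (intro continuous_open_preimage smooth_on_continuous[OF Js] assms) auto
  then have U1: "open U1" by (simp add: U1_def vimage_def Int_def)
  have x0: "x0 \<in> U1" using assms(3) jac by (simp add: U1_def J_def P_def)
  have sub: "U1 \<subseteq> U" by (auto simp: U1_def)
  have D: "(\<psi> has_derivative frechet_derivative \<psi> (at x)) (at x)" if "x \<in> U" for x
    by (rule smooth_on_has_derivative[OF assms(2) that])
  have Dc: "frechet_derivative \<psi> (at x) w $ i = P i 1 x * w $ 1 + P i 2 x * w $ 2" if "x \<in> U" for x w i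
  proof -
    have "((\<lambda>y. \<psi> y $ i) has_derivative (\<lambda>w. frechet_derivative \<psi> (at x) w $ i)) (at x)"
      by (rule bounded_linear.has_derivative[OF bounded_linear_vec_nth D[OF that]])
    moreover from this have "(\<lambda>y. \<psi> y $ i) differentiable (at x)" by (auto simp: differentiable_def)
    ultimately have "(\<lambda>w. frechet_derivative \<psi> (at x) w $ i) = (\<lambda>w. w $ 1 * P i 1 x + w $ 2 * P i 2 x)"
      unfolding P_def by (rule has_derivative_unique[OF _ has_derivative_partial])
    from fun_cong[OF this, of w] show ?thesis by (simp add: mult.commute)
  qed
  define f' where "f' x = Blinfun (frechet_derivative \<psi> (at x))" for x
  have f': "blinfun_apply (f' x) = frechet_derivative \<psi> (at x)" if "x \<in> U" for x
    unfolding f'_def using D[OF that] by (simp add: bounded_linear_Blinfun_apply has_derivative_bounded_linear)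
  have cont: "continuous_on U1 f'"
  proof (rule continuous_on_blinfun_componentwise)
    fix b :: "real^2"
    have "continuous_on U1 (\<lambda>x. frechet_derivative \<psi> (at x) b)"
      by (rule continuous_on_subset[OF smooth_on_continuous[OF smooth_on_frechet[OF assms(2)]] sub])
    then show "continuous_on U1 (\<lambda>x. blinfun_apply (f' x) b)"
      by (subst continuous_on_cong[OF refl, of _ _ "\<lambda>x. frechet_derivative \<psi> (at x) b"]) (use f' sub in auto)
  qed
  \<comment> \<open>The inverse Jacobian by Cramer's rule.\<close>
  define M where "M x v = v $ 1 *\<^sub>R vector [P 2 2 x / J x, - P 2 1 x / J x] +
      v $ 2 *\<^sub>R (vector [- P 1 2 x / J x, P 1 1 x / J x] :: real^2)" for x and v :: "real^2"
  have MD: "M x (frechet_derivative \<psi> (at x) w) = w" and DM: "frechet_derivative \<psi> (at x) (M x w) = w" if "x \<in> U1" for x w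
  proof -
    have J: "J x \<noteq> 0" "x \<in> U" using that by (auto simp: U1_def)
    show "M x (frechet_derivative \<psi> (at x) w) = w"
      using J(1) by (simp add: vec_eq_iff forall_2 M_def Dc[OF J(2)] field_simps)
        (simp add: J_def algebra_simps)
    show "frechet_derivative \<psi> (at x) (M x w) = w"
      using J(1) by (simp add: vec_eq_iff forall_2 M_def Dc[OF J(2)] field_simps)
        (simp add: J_def algebra_simps)
  qed
  have lM: "bounded_linear (M x)" for x
    by (intro linear_conv_bounded_linear[THEN iffD1] linearI) (simp_all add: M_def algebra_simps)
  have inv: "Blinfun (M x0) o\<^sub>L f' x0 = id_blinfun"
    using MD[OF x0] f'[OF subsetD[OF sub x0]]
    by (intro blinfun_eqI) (simp add: bounded_linear_Blinfun_apply[OF lM])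
  have D': "(\<psi> has_derivative blinfun_apply (f' x)) (at x)" if "x \<in> U1" for x
    using D[OF subsetD[OF sub that]] f'[OF subsetD[OF sub that]] by simp
  obtain V W G G' where VW: "open V" "V \<subseteq> U1" "x0 \<in> V" "open W" "homeomorphism V W \<psi> G"
    and G: "\<And>y. y \<in> W \<Longrightarrow> (G has_derivative G' y) (at y)" "\<And>y. y \<in> W \<Longrightarrow> G' y = inv (blinfun_apply (f' (G y)))"
  proof (rule inverse_function_theorem[OF U1 D' cont x0 inv])
    fix V W G G'
    assume "open V" "V \<subseteq> U1" "x0 \<in> V" "open W" "homeomorphism V W \<psi> G"
      "\<And>y. y \<in> W \<Longrightarrow> (G has_derivative G' y) (at y)" "\<And>y. y \<in> W \<Longrightarrow> G' y = inv (blinfun_apply (f' (G y)))"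
    then show thesis by (rule that)
  qed
  have GV: "G y \<in> V" if "y \<in> W" for y using VW(5) that by (auto simp: homeomorphism_def)
  have G'M: "G' y = M (G y)" if "y \<in> W" for y
  proof -
    have g: "G y \<in> U1" using GV that VW(2) by blast
    then have "G y \<in> U" using sub by blast
    then have "G' y = inv (frechet_derivative \<psi> (at (G y)))" using G(2)[OF that] f' by simp
    also have "\<dots> = M (G y)" by (rule inv_unique_comp) (auto simp: fun_eq_iff MD[OF g] DM[OF g])
    finally show ?thesis .
  qed
  have Ms: "smooth_on V (\<lambda>x. M x v)" for v
  proof -
    have PJ: "smooth_on V (\<lambda>x. P i j x / J x)" for i j
      by (rule smooth_on_divide[OF VW(1) smooth_on_subset[OF Ps] smooth_on_subset[OF Js]])
        (use VW(2) sub in \<open>auto simp: U1_def\<close>)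
    have "smooth_on V (\<lambda>x. - P i j x / J x)" for i j
      using smooth_on_uminus[OF VW(1) PJ] by simp
    moreover have "smooth_on V (\<lambda>x. vector [a x, b x] :: real^2)" if "smooth_on V a" "smooth_on V b" for a b
    proof (rule smooth_on_vec[OF VW(1)])
      show "smooth_on V (\<lambda>x. (vector [a x, b x] :: real^2) $ i)" for i
        using exhaust_2[of i] that by auto
    qed
    ultimately have "smooth_on V (\<lambda>x. vector [P 2 2 x / J x, - P 2 1 x / J x] :: real^2)"
      "smooth_on V (\<lambda>x. vector [- P 1 2 x / J x, P 1 1 x / J x] :: real^2)"
      using PJ by blast+
    then show ?thesis unfolding M_def by (intro smooth_on_add smooth_on_scaleR smooth_on_const VW(1))
  qed
  have "Ck_on n W G" for n
  proof (induction n)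
    case 0
    then show ?case using VW(5) by (simp add: homeomorphism_def)
  next
    case (Suc n)
    show ?case
    proof (rule Ck_on_SucI[OF VW(4) G(1)])
      fix v
      have "Ck_on n V (\<lambda>x. M x v)" using Ms[of v] by (simp add: smooth_on_def)
      from Ck_on_compose[OF VW(4,1) GV Suc this]
      have *: "Ck_on n W (\<lambda>y. M (G y) v)" .
      have "M (G y) v = G' y v" if "y \<in> W" for y by (simp only: G'M[OF that])
      from Ck_on_cong[OF VW(4) this *] show "Ck_on n W (\<lambda>y. G' y v)" .
    qed
  qed
  then have "smooth_on W G" by (simp add: smooth_on_def)
  then show ?thesis using that[of V W G] VW sub by blast
qed

lemma smooth_on_exp: "smooth_on UNIV (exp :: real \<Rightarrow> real)"
proof -
  have "Ck_on n UNIV (exp :: real \<Rightarrow> real)" for n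
  proof (induction n)
    case (Suc n)
    show ?case by (rule Ck_on_real_SucI[OF _ _ Suc]) (auto intro!: derivative_eq_intros)
  qed (auto intro!: continuous_intros)
  then show ?thesis by (simp add: smooth_on_def)
qed

text \<open>A metric whose curvature \<open>K = \<sigma> exp (4 f)\<close> satisfies the equations forced by Darboux
  integrability; \<open>p\<close>, \<open>q\<close> are the components of \<open>df\<close> in the coframe \<open>h\<close>.\<close>

locale integrable_metric =
  fixes \<Omega> :: "(real^2) set" and g h :: "real^2 \<Rightarrow> real^2^2" and f p q :: "real^2 \<Rightarrow> real" and \<sigma> :: real
  assumes cf: "coframe_on \<Omega> g h" and fs: "smooth_on \<Omega> f" and ps: "smooth_on \<Omega> p" and qs: "smooth_on \<Omega> q"
    and df: "\<And>x i. x \<in> \<Omega> \<Longrightarrow> partial i f x = h x $ 1 $ i * p x + h x $ 2 $ i * q x"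
    and dp: "\<And>x i. x \<in> \<Omega> \<Longrightarrow> partial i p x =
      h x $ 1 $ i * (3 * (p x)\<^sup>2 - \<sigma> * exp (4 * f x)) + h x $ 2 $ i * (3 * p x * q x) - q x * conn h i x"
    and dq: "\<And>x i. x \<in> \<Omega> \<Longrightarrow> partial i q x =
      h x $ 1 $ i * (3 * p x * q x) + h x $ 2 $ i * (3 * (q x)\<^sup>2 - \<sigma> * exp (4 * f x)) + p x * conn h i x"
begin

section \<open>Curvature radius, first integral and closed coordinate form\<close>

definition r where "r x = exp (- f x)"
definition \<rho> where "\<rho> x = p x * p x + q x * q x"
text \<open>As d\<rho> = 2 (3 \<rho> - K) df and dr = - r df, multiplying \<rho> by r^6 removes the
  first term: d(r^6 \<rho>) = - 2 K r^6 df, which by K r^4 = \<sigma> is the differential of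
  \<sigma> r^2.\<close>

definition level where "level x = r x ^ 6 * \<rho> x - \<sigma> * r x ^ 2"

lemma \<Omega>: "open \<Omega>" by (rule coframe_open[OF cf])

lemma r_pos: "r x > 0" by (simp add: r_def)

lemma K_r: "exp (4 * f x) * r x ^ 4 = 1"
  by (simp add: r_def exp_of_nat_mult[symmetric] exp_add[symmetric])

lemma r_smooth: "smooth_on \<Omega> r"
  unfolding r_def[abs_def]
  by (rule smooth_on_compose[OF \<Omega> open_UNIV _ smooth_on_uminus[OF \<Omega> fs] smooth_on_exp]) simp

lemma \<rho>_smooth: "smooth_on \<Omega> \<rho>"
  unfolding \<rho>_def[abs_def] by (intro smooth_on_add smooth_on_mult ps qs \<Omega>)

lemma level_smooth: "smooth_on \<Omega> level"
  unfolding level_def[abs_def]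
  by (intro smooth_on_diff smooth_on_mult smooth_on_power smooth_on_const r_smooth \<rho>_smooth \<Omega>)

lemmas dif = smooth_on_differentiable

lemma partial_r: assumes "x \<in> \<Omega>" shows "partial i r x = - r x * partial i f x"
proof -
  have "((\<lambda>t. exp (- t)) has_real_derivative - exp (- f x)) (at (f x))"
    by (auto intro!: derivative_eq_intros)
  from partial_chain_real[OF this dif[OF fs assms], of i] show ?thesis by (simp add: r_def[abs_def])
qed

lemma partial_r_power: assumes "x \<in> \<Omega>" shows "partial i (\<lambda>x. r x ^ n) x = - real n * r x ^ n * partial i f x"
proof -
  have "((\<lambda>t. t ^ n) has_real_derivative real n * r x ^ (n - 1)) (at (r x))"
    by (auto intro!: derivative_eq_intros)
  from partial_chain_real[OF this dif[OF r_smooth assms], of i]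
  show ?thesis by (cases n) (simp_all add: partial_r[OF assms] algebra_simps)
qed

text \<open>The connection terms rotate (p, q) and so drop out of its squared length.\<close>

lemma partial_\<rho>:
  assumes "x \<in> \<Omega>"
  shows "partial i \<rho> x = 2 * (3 * \<rho> x - \<sigma> * exp (4 * f x)) * partial i f x"
proof -
  have "partial i \<rho> x = 2 * (p x * partial i p x + q x * partial i q x)"
    unfolding \<rho>_def[abs_def]
    by (simp add: partial_add partial_mult dif[OF ps assms] dif[OF qs assms] differentiable_mult)
  also have "\<dots> = 2 * (3 * \<rho> x - \<sigma> * exp (4 * f x)) * partial i f x"
    unfolding dp[OF assms] dq[OF assms] df[OF assms] \<rho>_def by (simp add: power2_eq_square algebra_simps)
  finally show ?thesis .
qed

lemma differentiable_r_power: "x \<in> \<Omega> \<Longrightarrow> (\<lambda>x. r x ^ n) differentiable (at x)"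
  by (rule dif[OF smooth_on_power[OF \<Omega> r_smooth]])

lemma partial_level:
  assumes "x \<in> \<Omega>"
  shows "partial i level x = 0"
proof -
  have "partial i level x = partial i (\<lambda>x. r x ^ 6) x * \<rho> x + r x ^ 6 * partial i \<rho> x - \<sigma> * partial i (\<lambda>x. r x ^ 2) x"
    unfolding level_def[abs_def]
    using partial_mult[of "\<lambda>_. \<sigma>" x "\<lambda>x. r x ^ 2" i]
    by (simp add: partial_diff partial_mult differentiable_r_power[OF assms] dif[OF \<rho>_smooth assms] differentiable_mult)
  also have "\<dots> = (- 2 * \<sigma> * r x ^ 2 * (exp (4 * f x) * r x ^ 4) + 2 * \<sigma> * r x ^ 2) * partial i f x"
    unfolding partial_r_power[OF assms] partial_\<rho>[OF assms] by (simp add: algebra_simps power_add[symmetric])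
  also have "\<dots> = 0" unfolding K_r by simp
  finally show ?thesis .
qed

definition dv where "dv x = (\<chi> i. (- q x * h x $ 1 $ i + p x * h x $ 2 $ i) * inverse (r x ^ 3 * \<rho> x))"

lemma hs: "smooth_on \<Omega> (\<lambda>x. h x $ i $ j)" by (rule coframe_smooth[OF cf])

lemma dv_smooth:
  assumes "V \<subseteq> \<Omega>" "open V" "\<And>x. x \<in> V \<Longrightarrow> \<rho> x \<noteq> 0"
  shows "smooth_on V dv"
proof (rule smooth_on_vec[OF assms(2)])
  fix i
  show "smooth_on V (\<lambda>x. dv x $ i)"
    unfolding dv_def vec_lambda_beta
    by (intro smooth_on_mult smooth_on_add smooth_on_uminus smooth_on_inverse smooth_on_power assms(2)
        smooth_on_subset[OF qs assms(1)] smooth_on_subset[OF ps assms(1)] smooth_on_subset[OF hs assms(1)]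
        smooth_on_subset[OF r_smooth assms(1)] smooth_on_subset[OF \<rho>_smooth assms(1)])
      (use assms(3) r_pos in \<open>auto simp: less_le\<close>)
qed

text \<open>The Laplacian of f, the trace of the Hessian equation, is 3 \<rho> - 2 K. The same
  factor occurs in d(r^3 \<rho>) = r^3 (3 \<rho> - 2 K) df, so dividing the Hodge dual of df by r^3
  \<rho> makes it closed.\<close>

lemma dv_closed:
  assumes x: "x \<in> \<Omega>" and \<rho>: "\<rho> x \<noteq> 0"
  shows "partial 1 (\<lambda>x. dv x $ 2) x = partial 2 (\<lambda>x. dv x $ 1) x"
proof -
  define w where "w x = r x ^ 3 * \<rho> x" for x
  define \<alpha> where "\<alpha> i x = - q x * h x $ 1 $ i + p x * h x $ 2 $ i" for i x
  have w0: "w x \<noteq> 0" using \<rho> r_pos[of x] by (simp add: w_def)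
  have wd: "w differentiable (at x)"
    unfolding w_def[abs_def] by (intro differentiable_mult differentiable_r_power[OF x] dif[OF \<rho>_smooth x])
  have pw: "partial i w x = r x ^ 3 * (3 * \<rho> x - 2 * \<sigma> * exp (4 * f x)) * partial i f x" for i
    unfolding w_def[abs_def]
    by (simp add: partial_mult differentiable_r_power[OF x] dif[OF \<rho>_smooth x] partial_r_power[OF x] partial_\<rho>[OF x] algebra_simps)
  have "(inverse has_real_derivative - (inverse (w x) * inverse (w x))) (at (w x))"
    using w0 by (auto intro!: derivative_eq_intros simp: power2_eq_square)
  from partial_chain_real[OF this wd]
  have pinv: "partial i (\<lambda>x. inverse (w x)) x = - (inverse (w x) * inverse (w x)) * partial i w x" for i .
  have invd: "(\<lambda>x. inverse (w x)) differentiable (at x)"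
    using wd w0 by (rule differentiable_inverse)
  note d = dif[OF hs x] dif[OF ps x] dif[OF qs x]
  have \<alpha>d: "(\<alpha> i) differentiable (at x)" for i
    unfolding \<alpha>_def[abs_def] by (intro differentiable_add differentiable_mult differentiable_minus d)
  have p\<alpha>: "partial j (\<alpha> i) x = - partial j q x * h x $ 1 $ i - q x * partial j (\<lambda>x. h x $ 1 $ i) x +
      (partial j p x * h x $ 2 $ i + p x * partial j (\<lambda>x. h x $ 2 $ i) x)" for i j
    unfolding \<alpha>_def[abs_def]
    by (simp add: partial_diff partial_mult differentiable_mult d algebra_simps)
  note st = coframe_structure[OF cf x, unfolded curl_def]
  have curl: "partial 1 (\<alpha> 2) x - partial 2 (\<alpha> 1) x = (3 * \<rho> x - 2 * \<sigma> * exp (4 * f x)) * det (h x)"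
  proof -
    have "partial 1 (\<alpha> 2) x - partial 2 (\<alpha> 1) x =
      - q x * (partial 1 (\<lambda>x. h x $ 1 $ 2) x - partial 2 (\<lambda>x. h x $ 1 $ 1) x)
      + p x * (partial 1 (\<lambda>x. h x $ 2 $ 2) x - partial 2 (\<lambda>x. h x $ 2 $ 1) x)
      - (partial 1 q x * h x $ 1 $ 2 - partial 2 q x * h x $ 1 $ 1)
      + (partial 1 p x * h x $ 2 $ 2 - partial 2 p x * h x $ 2 $ 1)"
      unfolding p\<alpha> by (simp add: algebra_simps)
    then show ?thesis
      unfolding st dp[OF x] dq[OF x] \<rho>_def det_2x2 by (simp add: power2_eq_square algebra_simps)
  qed
  have df\<alpha>: "partial 1 f x * \<alpha> 2 x - partial 2 f x * \<alpha> 1 x = \<rho> x * det (h x)"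
    unfolding df[OF x] \<alpha>_def \<rho>_def det_2x2 by (simp add: algebra_simps)
  have pdv: "partial j (\<lambda>x. dv x $ i) x = partial j (\<alpha> i) x * inverse (w x) - \<alpha> i x * (inverse (w x) * inverse (w x)) * partial j w x" for i j
  proof -
    have "(\<lambda>x. dv x $ i) = (\<lambda>x. \<alpha> i x * inverse (w x))" by (simp add: fun_eq_iff dv_def \<alpha>_def w_def)
    then show ?thesis using partial_mult[OF \<alpha>d invd] pinv by simp
  qed
  have "partial 1 (\<lambda>x. dv x $ 2) x - partial 2 (\<lambda>x. dv x $ 1) x =
      inverse (w x) * (partial 1 (\<alpha> 2) x - partial 2 (\<alpha> 1) x)
      - inverse (w x) * inverse (w x) * (r x ^ 3 * (3 * \<rho> x - 2 * \<sigma> * exp (4 * f x))) * (partial 1 f x * \<alpha> 2 x - partial 2 f x * \<alpha> 1 x)"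
    unfolding pdv pw by (simp add: algebra_simps)
  also have "\<dots> = inverse (w x) * (3 * \<rho> x - 2 * \<sigma> * exp (4 * f x)) * det (h x) * (1 - inverse (w x) * (r x ^ 3 * \<rho> x))"
    unfolding curl df\<alpha> by (simp add: algebra_simps)
  also have "\<dots> = 0" using w0 by (simp add: w_def[symmetric])
  finally show ?thesis by simp
qed

text \<open>df and its Hodge dual are orthogonal of squared length \<rho>, so they diagonalize the
  metric.\<close>

lemma metric_eq:
  assumes "x \<in> \<Omega>"
  shows "\<rho> x * (a \<bullet> (g x *v a)) = (a $ 1 * partial 1 f x + a $ 2 * partial 2 f x)\<^sup>2 +
    (a $ 1 * (- q x * h x $ 1 $ 1 + p x * h x $ 2 $ 1) + a $ 2 * (- q x * h x $ 1 $ 2 + p x * h x $ 2 $ 2))\<^sup>2"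
  unfolding coframe_inner[OF cf assms] df[OF assms] \<rho>_def by (simp add: power2_eq_square algebra_simps)

text \<open>The second coordinate is a primitive of the closed form \<^const>\<open>dv\<close>, the first a function of the
  curvature.\<close>

lemma normal_form_coordinates:
  fixes u u' A B :: "real \<Rightarrow> real"
  assumes x0: "x0 \<in> \<Omega>" "\<rho> x0 \<noteq> 0" and I: "open I" "r x0 \<in> I"
    and u: "\<And>t. t \<in> I \<Longrightarrow> (u has_real_derivative u' t) (at t)" "smooth_on I u'"
    and c: "c > 0"
    and T: "\<And>t. t \<in> I \<Longrightarrow> u t \<in> T"
    and A: "\<And>x. x \<in> \<Omega> \<Longrightarrow> r x \<in> I \<Longrightarrow> \<rho> x \<noteq> 0 \<Longrightarrow> \<mu> * A (u (r x)) * (u' (r x))\<^sup>2 * (r x ^ 2 * \<rho> x) = 1"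
    and B: "\<And>x. x \<in> \<Omega> \<Longrightarrow> r x \<in> I \<Longrightarrow> \<rho> x \<noteq> 0 \<Longrightarrow> \<mu> * B (u (r x)) = c\<^sup>2 * (r x ^ 6 * \<rho> x)"
  obtains V W and \<psi> G :: "real^2 \<Rightarrow> real^2" where "open V" "V \<subseteq> \<Omega>" "x0 \<in> V" "open W" "homeomorphism V W \<psi> G" "smooth_on V \<psi>" "smooth_on W G"
    "\<And>x. x \<in> V \<Longrightarrow> \<psi> x $ 1 \<in> T"
    "\<And>x a. x \<in> V \<Longrightarrow> a \<bullet> (g x *v a) = \<mu> * (A (\<psi> x $ 1) * (frechet_derivative \<psi> (at x) a $ 1)\<^sup>2 +
       B (\<psi> x $ 1) * (frechet_derivative \<psi> (at x) a $ 2)\<^sup>2)"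
proof -
  have "open (\<Omega> \<inter> r -` I)" "open (\<Omega> \<inter> \<rho> -` (- {0}))"
    by (intro continuous_open_preimage smooth_on_continuous[OF r_smooth] smooth_on_continuous[OF \<rho>_smooth] \<Omega> I; auto)+
  then have "open ((\<Omega> \<inter> r -` I) \<inter> (\<Omega> \<inter> \<rho> -` (- {0})))" by (rule open_Int)
  moreover have "x0 \<in> (\<Omega> \<inter> r -` I) \<inter> (\<Omega> \<inter> \<rho> -` (- {0}))" using x0 I by auto
  ultimately obtain e where e: "e > 0" "ball x0 e \<subseteq> (\<Omega> \<inter> r -` I) \<inter> (\<Omega> \<inter> \<rho> -` (- {0}))"
    by (meson openE)
  let ?B = "ball x0 e"
  have B\<Omega>: "x \<in> \<Omega>" and BI: "r x \<in> I" and B\<rho>: "\<rho> x \<noteq> 0" if "x \<in> ?B" for x using e(2) that by auto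
  have sub: "?B \<subseteq> \<Omega>" using B\<Omega> by blast
  have dvs: "smooth_on ?B dv" by (rule dv_smooth[OF sub open_ball B\<rho>])
  have dvd: "(\<lambda>x. dv x $ i) differentiable (at x)" if "x \<in> ?B" for x i
    by (rule dif[OF smooth_on_nth[OF open_ball dvs] that])
  have closed: "frechet_derivative dv (at x) v \<bullet> w = frechet_derivative dv (at x) w \<bullet> v" if x: "x \<in> ?B" for x v w
  proof -
    have comp: "frechet_derivative dv (at x) v $ i = v $ 1 * partial 1 (\<lambda>x. dv x $ i) x + v $ 2 * partial 2 (\<lambda>x. dv x $ i) x" for v i
    proof -
      have "((\<lambda>x. dv x $ i) has_derivative (\<lambda>v. frechet_derivative dv (at x) v $ i)) (at x)"
        by (rule bounded_linear.has_derivative[OF bounded_linear_vec_nth smooth_on_has_derivative[OF dvs x]])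
      from has_derivative_unique[OF this has_derivative_partial[OF dvd[OF x]]] show ?thesis by metis
    qed
    show ?thesis
      using dv_closed[OF B\<Omega>[OF x] B\<rho>[OF x]] unfolding inner_vec_def sum_2 comp by (simp add: algebra_simps)
  qed
  obtain v where v: "\<And>x. x \<in> ?B \<Longrightarrow> (v has_derivative (\<lambda>w. dv x \<bullet> w)) (at x)" "smooth_on ?B v"
    using poincare_ball[OF dvs closed] by blast
  \<comment> \<open>The constant c rescales v so that \<open>B\<close> can have the prescribed
    factor; away from zeros of \<rho> the form \<open>dv\<close> is smooth on the ball.\<close>
  define \<psi> :: "real^2 \<Rightarrow> real^2" where "\<psi> x = vector [u (r x), v x / c]" for x
  have \<psi>: "\<psi> x $ 1 = u (r x)" "\<psi> x $ 2 = v x / c" for x by (simp_all add: \<psi>_def)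
  have us: "smooth_on I u" by (rule smooth_on_real_SucI[OF I(1) u])
  have s1: "smooth_on ?B (\<lambda>x. u (r x))"
    by (rule smooth_on_compose[OF open_ball I(1) BI smooth_on_subset[OF r_smooth sub] us])
  have s2: "smooth_on ?B (\<lambda>x. v x / c)"
    by (rule smooth_on_divide[OF open_ball v(2) smooth_on_const]) (use c in simp)
  have \<psi>s: "smooth_on ?B \<psi>"
  proof (rule smooth_on_vec[OF open_ball])
    show "smooth_on ?B (\<lambda>x. \<psi> x $ i)" for i using exhaust_2[of i] s1 s2 by (auto simp: \<psi>)
  qed
  have p1: "partial i (\<lambda>x. \<psi> x $ 1) x = - u' (r x) * r x * partial i f x" if "x \<in> ?B" for x i
    unfolding \<psi> using partial_chain_real[OF u(1)[OF BI[OF that]] dif[OF r_smooth B\<Omega>[OF that]], of i]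
    by (simp add: partial_r[OF B\<Omega>[OF that]])
  have p2: "partial i (\<lambda>x. \<psi> x $ 2) x = dv x $ i / c" if "x \<in> ?B" for x i
  proof -
    have "((\<lambda>x. v x / c) has_derivative (\<lambda>w. (dv x \<bullet> w) / c)) (at x)"
      by (rule bounded_linear.has_derivative[OF bounded_linear_divide v(1)[OF that]])
    from partial_eq[OF this, of i] show ?thesis unfolding \<psi> by (simp add: inner_axis)
  qed
  have x0B: "x0 \<in> ?B" using e(1) by simp
  have dvr: "dv x $ i = (- q x * h x $ 1 $ i + p x * h x $ 2 $ i) / (r x ^ 3 * \<rho> x)" for x i
    by (simp add: dv_def divide_inverse)
  have "partial 1 (\<lambda>y. \<psi> y $ 1) x0 * partial 2 (\<lambda>y. \<psi> y $ 2) x0 -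
       partial 2 (\<lambda>y. \<psi> y $ 1) x0 * partial 1 (\<lambda>y. \<psi> y $ 2) x0 = - u' (r x0) * r x0 * (det (h x0) * \<rho> x0) / (r x0 ^ 3 * \<rho> x0) / c"
    unfolding p1[OF x0B] p2[OF x0B] dvr df[OF x0(1)] det_2x2 \<rho>_def
    by (simp add: diff_divide_distrib[symmetric] add_divide_distrib[symmetric] algebra_simps)
  \<comment> \<open>The product in assumption \<open>A\<close> equals 1, so none of its factors
    vanishes.\<close>
  moreover have "u' (r x0) \<noteq> 0" using A[OF x0(1) I(2) x0(2)] by auto
  ultimately have "partial 1 (\<lambda>y. \<psi> y $ 1) x0 * partial 2 (\<lambda>y. \<psi> y $ 2) x0 -
       partial 2 (\<lambda>y. \<psi> y $ 1) x0 * partial 1 (\<lambda>y. \<psi> y $ 2) x0 \<noteq> 0"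
    using coframe_det[OF cf x0(1)] x0(2) r_pos[of x0] c by simp
  from smooth_inverse_function[OF open_ball \<psi>s x0B this]
  obtain V W G where VW: "open V" "V \<subseteq> ?B" "x0 \<in> V" "open W" "homeomorphism V W \<psi> G" "smooth_on W G"
    by metis
  have met: "a \<bullet> (g x *v a) = \<mu> * (A (\<psi> x $ 1) * (frechet_derivative \<psi> (at x) a $ 1)\<^sup>2 +
       B (\<psi> x $ 1) * (frechet_derivative \<psi> (at x) a $ 2)\<^sup>2)" if "x \<in> V" for x a
  proof -
    have x: "x \<in> ?B" using that VW(2) by blast
    note xs = B\<Omega>[OF x] BI[OF x] B\<rho>[OF x]
    have comp: "frechet_derivative \<psi> (at x) a $ i = a $ 1 * partial 1 (\<lambda>x. \<psi> x $ i) x + a $ 2 * partial 2 (\<lambda>x. \<psi> x $ i) x" for i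
    proof -
      have "((\<lambda>x. \<psi> x $ i) has_derivative (\<lambda>v. frechet_derivative \<psi> (at x) v $ i)) (at x)"
        by (rule bounded_linear.has_derivative[OF bounded_linear_vec_nth smooth_on_has_derivative[OF \<psi>s x]])
      from has_derivative_unique[OF this has_derivative_partial[OF dif[OF smooth_on_nth[OF open_ball \<psi>s] x]]] show ?thesis by metis
    qed
    define X where "X = a $ 1 * partial 1 f x + a $ 2 * partial 2 f x"
    define Y where "Y = a $ 1 * (- q x * h x $ 1 $ 1 + p x * h x $ 2 $ 1) + a $ 2 * (- q x * h x $ 1 $ 2 + p x * h x $ 2 $ 2)"
    have D1: "frechet_derivative \<psi> (at x) a $ 1 = - u' (r x) * r x * X"
      unfolding comp p1[OF x] X_def by (simp add: algebra_simps)
    have D2: "frechet_derivative \<psi> (at x) a $ 2 = Y / (c * (r x ^ 3 * \<rho> x))"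
      unfolding comp p2[OF x] dvr Y_def by (simp add: add_divide_distrib diff_divide_distrib algebra_simps)
    have w: "c * (r x ^ 3 * \<rho> x) \<noteq> 0" using c r_pos[of x] xs(3) by simp
    \<comment> \<open>Assumptions \<open>A\<close> and \<open>B\<close> are precisely what turns the
      squares of the two coordinate differentials into the squares of df and of its dual, both
      divided by \<rho>.\<close>
    have "\<rho> x * (\<mu> * (A (\<psi> x $ 1) * (frechet_derivative \<psi> (at x) a $ 1)\<^sup>2)) =
        (\<mu> * A (u (r x)) * (u' (r x))\<^sup>2 * (r x ^ 2 * \<rho> x)) * X\<^sup>2"
      unfolding D1 \<psi> by (simp add: power2_eq_square algebra_simps)
    also have "\<dots> = X\<^sup>2" unfolding A[OF xs] by simp
    finally have 1: "\<rho> x * (\<mu> * (A (\<psi> x $ 1) * (frechet_derivative \<psi> (at x) a $ 1)\<^sup>2)) = X\<^sup>2" .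
    have "\<rho> x * (\<mu> * (B (\<psi> x $ 1) * (frechet_derivative \<psi> (at x) a $ 2)\<^sup>2)) =
        \<rho> x * (\<mu> * B (u (r x))) * Y\<^sup>2 / (c * (r x ^ 3 * \<rho> x))\<^sup>2"
      unfolding D2 \<psi> by (simp add: power_divide algebra_simps)
    also have "\<dots> = (c * (r x ^ 3 * \<rho> x))\<^sup>2 * Y\<^sup>2 / (c * (r x ^ 3 * \<rho> x))\<^sup>2"
      unfolding B[OF xs] by (simp add: power2_eq_square power3_eq_cube eval_nat_numeral algebra_simps)
    also have "\<dots> = Y\<^sup>2" using w by simp
    finally have 2: "\<rho> x * (\<mu> * (B (\<psi> x $ 1) * (frechet_derivative \<psi> (at x) a $ 2)\<^sup>2)) = Y\<^sup>2" .
    have "\<rho> x * (a \<bullet> (g x *v a)) = X\<^sup>2 + Y\<^sup>2" unfolding metric_eq[OF xs(1)] X_def Y_def ..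
    also have "\<dots> = \<rho> x * (\<mu> * (A (\<psi> x $ 1) * (frechet_derivative \<psi> (at x) a $ 1)\<^sup>2 +
       B (\<psi> x $ 1) * (frechet_derivative \<psi> (at x) a $ 2)\<^sup>2))"
      unfolding 1[symmetric] 2[symmetric] by (simp add: algebra_simps)
    finally show ?thesis using xs(3) by simp
  qed
  show ?thesis
  proof (rule that[OF VW(1) _ VW(3,4,5) _ VW(6) _ met])
    show "V \<subseteq> \<Omega>" using VW(2) sub by blast
    show "smooth_on V \<psi>" by (rule smooth_on_subset[OF \<psi>s VW(2)])
    show "\<psi> x $ 1 \<in> T" if "x \<in> V" for x using T[OF BI] that VW(2) by (auto simp: \<psi>)
  qed
qed

end

section \<open>Zeros of the gradient and chart-independent expressions\<close>

context integrable_metric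
begin

lemma \<rho>_eq_0_iff: "\<rho> x = 0 \<longleftrightarrow> p x = 0 \<and> q x = 0"
  by (simp add: \<rho>_def sum_squares_eq_zero_iff)

lemma \<rho>_nonneg: "\<rho> x \<ge> 0" by (simp add: \<rho>_def)

text \<open>At a zero of df the Hessian equation reduces to - K g, which is nondegenerate. The map
  (p, q) is then a local diffeomorphism and takes the value 0 only once nearby.\<close>

lemma isolated_zero:
  assumes \<sigma>: "\<sigma> \<noteq> 0" and x0: "x0 \<in> \<Omega>"
  obtains V where "open V" "x0 \<in> V" "V \<subseteq> \<Omega>" "\<And>x. x \<in> V \<Longrightarrow> x \<noteq> x0 \<Longrightarrow> \<rho> x \<noteq> 0"
proof (cases "\<rho> x0 = 0")
  case True
  then have 0: "p x0 = 0" "q x0 = 0" by (simp_all add: \<rho>_eq_0_iff)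
  define \<psi> :: "real^2 \<Rightarrow> real^2" where "\<psi> x = vector [p x, q x]" for x
  have \<psi>: "\<psi> x $ 1 = p x" "\<psi> x $ 2 = q x" for x by (simp_all add: \<psi>_def)
  have s: "smooth_on \<Omega> \<psi>"
  proof (rule smooth_on_vec[OF \<Omega>])
    show "smooth_on \<Omega> (\<lambda>x. \<psi> x $ i)" for i using exhaust_2[of i] ps qs by (auto simp: \<psi>)
  qed
  have "partial 1 (\<lambda>y. \<psi> y $ 1) x0 * partial 2 (\<lambda>y. \<psi> y $ 2) x0 -
       partial 2 (\<lambda>y. \<psi> y $ 1) x0 * partial 1 (\<lambda>y. \<psi> y $ 2) x0 = (\<sigma> * exp (4 * f x0))\<^sup>2 * det (h x0)"
    unfolding \<psi> dp[OF x0] dq[OF x0] 0 det_2x2 by (simp add: power2_eq_square algebra_simps)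
  then have "partial 1 (\<lambda>y. \<psi> y $ 1) x0 * partial 2 (\<lambda>y. \<psi> y $ 2) x0 -
       partial 2 (\<lambda>y. \<psi> y $ 1) x0 * partial 1 (\<lambda>y. \<psi> y $ 2) x0 \<noteq> 0"
    using \<sigma> coframe_det[OF cf x0] by simp
  from smooth_inverse_function[OF \<Omega> s x0 this] obtain V W G where
    V: "open V" "V \<subseteq> \<Omega>" "x0 \<in> V" "homeomorphism V W \<psi> G" by metis
  have "\<rho> x \<noteq> 0" if "x \<in> V" "x \<noteq> x0" for x
  proof
    assume "\<rho> x = 0"
    then have "\<psi> x = \<psi> x0" using 0 by (simp add: \<psi>_def \<rho>_eq_0_iff)
    then show False using V(3,4) that by (metis homeomorphism_apply1)
  qed
  then show ?thesis using that V by blast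
next
  case False
  have "open (\<Omega> \<inter> \<rho> -` (- {0}))"
    by (intro continuous_open_preimage smooth_on_continuous[OF \<rho>_smooth] \<Omega>) auto
  then show ?thesis by (rule that) (use False x0 in auto)
qed

lemma level_constant_on_ball:
  assumes "ball x0 e \<subseteq> \<Omega>" "x \<in> ball x0 e"
  shows "level x = level x0"
proof -
  have "(level has_derivative (\<lambda>v. 0)) (at y within ball x0 e)" if "y \<in> ball x0 e" for y
  proof -
    have y: "y \<in> \<Omega>" using that assms(1) by blast
    have "(level has_derivative (\<lambda>v. 0)) (at y)"
      using has_derivative_partial[OF dif[OF level_smooth y]] by (simp add: partial_level[OF y])
    then show ?thesis by (rule has_derivative_at_withinI)
  qed
  moreover have "x0 \<in> ball x0 e" using assms(2) by (simp add: order_le_less_trans[OF zero_le_dist])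
  ultimately show ?thesis
    using has_derivative_zero_unique[OF convex_ball, of x0 e level x x0] assms(2) by blast
qed

lemma critical_iff:
  assumes x: "x \<in> \<Omega>" and \<sigma>: "\<sigma> \<noteq> 0" and K: "\<And>y. y \<in> \<Omega> \<Longrightarrow> K y = \<sigma> * exp (4 * f y)"
  shows "(K has_derivative (\<lambda>_. 0)) (at x) \<longleftrightarrow> \<rho> x = 0"
proof -
  have f: "f differentiable (at x)" by (rule dif[OF fs x])
  have e: "((\<lambda>t. \<sigma> * exp (4 * t)) has_real_derivative 4 * \<sigma> * exp (4 * f x)) (at (f x))"
    by (auto intro!: derivative_eq_intros)
  from partial_chain_real[OF e f]
  have p1: "partial i (\<lambda>y. \<sigma> * exp (4 * f y)) x = 4 * \<sigma> * exp (4 * f x) * partial i f x" for i .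
  have pK: "partial i K x = 4 * \<sigma> * exp (4 * f x) * partial i f x" for i
    using partial_cong_open[OF \<Omega> x K, where i = i] p1 by simp
  have "(\<lambda>y. \<sigma> * exp (4 * f y)) differentiable (at x)"
    using has_derivative_compose[OF f[unfolded frechet_derivative_works] e[unfolded has_field_derivative_def]]
    by (auto simp: differentiable_def)
  then have "\<exists>D. (K has_derivative D) (at x)"
    unfolding differentiable_def
    by (elim ex_forward has_derivative_transform_within_open[OF _ \<Omega> x]) (simp add: K)
  then have Kd: "K differentiable (at x)" by (auto simp: differentiable_def)
  have D: "det (h x) \<noteq> 0" using coframe_det[OF cf x] by simp
  have "(K has_derivative (\<lambda>_. 0)) (at x) \<longleftrightarrow> partial 1 K x = 0 \<and> partial 2 K x = 0"
  proof
    assume "(K has_derivative (\<lambda>_. 0)) (at x)"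
    from partial_eq[OF this] show "partial 1 K x = 0 \<and> partial 2 K x = 0" by simp
  next
    assume "partial 1 K x = 0 \<and> partial 2 K x = 0"
    then show "(K has_derivative (\<lambda>_. 0)) (at x)" using has_derivative_partial[OF Kd] by simp
  qed
  also have "\<dots> \<longleftrightarrow> partial 1 f x = 0 \<and> partial 2 f x = 0" using \<sigma> by (simp add: pK)
  also have "\<dots> \<longleftrightarrow> p x = 0 \<and> q x = 0"
  proof
    assume "partial 1 f x = 0 \<and> partial 2 f x = 0"
    then have e: "h x $ 1 $ 1 * p x + h x $ 2 $ 1 * q x = 0" "h x $ 1 $ 2 * p x + h x $ 2 $ 2 * q x = 0"
      by (simp_all add: df[OF x])
    have "det (h x) * p x = h x $ 2 $ 2 * (h x $ 1 $ 1 * p x + h x $ 2 $ 1 * q x) - h x $ 2 $ 1 * (h x $ 1 $ 2 * p x + h x $ 2 $ 2 * q x)"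
      "det (h x) * q x = h x $ 1 $ 1 * (h x $ 1 $ 2 * p x + h x $ 2 $ 2 * q x) - h x $ 1 $ 2 * (h x $ 1 $ 1 * p x + h x $ 2 $ 1 * q x)"
      unfolding det_2x2 by (simp_all add: algebra_simps)
    from this[unfolded e] show "p x = 0 \<and> q x = 0" using D by simp
  qed (simp add: df[OF x])
  finally show ?thesis by (simp add: \<rho>_eq_0_iff)
qed

text \<open>Expresses the squared length of df by the metric alone; this is what can be compared
  between charts, whose coframes are unrelated.\<close>

lemma gradient_norm:
  assumes "x \<in> \<Omega>"
  shows "\<rho> x = (g x $ 2 $ 2 * (partial 1 f x)\<^sup>2 - 2 * g x $ 1 $ 2 * partial 1 f x * partial 2 f x + g x $ 1 $ 1 * (partial 2 f x)\<^sup>2) / det (g x)"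
proof -
  have D: "det (h x) \<noteq> 0" using coframe_det[OF cf assms] by simp
  have "\<rho> x * (det (h x))\<^sup>2 = g x $ 2 $ 2 * (partial 1 f x)\<^sup>2 - 2 * g x $ 1 $ 2 * partial 1 f x * partial 2 f x + g x $ 1 $ 1 * (partial 2 f x)\<^sup>2"
    unfolding coframe_metric[OF cf assms] df[OF assms] \<rho>_def det_2x2 by (simp add: power2_eq_square algebra_simps)
  then show ?thesis using D unfolding coframe_metric_invertible(2)[OF cf assms] by (simp add: field_simps)
qed

end

text \<open>One of the two singular systems suffices: for each of them \<open>c\<^sup>2 \<bar>K\<bar> = - K\<close>.\<close>

lemma transverse_frobenius_imp_integrable_metric:
  fixes c :: "'k::real_normed_field"
  assumes cf: "coframe_on \<Omega> g h" and \<sigma>: "\<sigma> = 1 \<or> \<sigma> = - 1"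
    and K: "\<And>x. x \<in> \<Omega> \<Longrightarrow> \<sigma> * gauss_curvature g x > 0"
    and c: "c * c = - of_real \<sigma>"
    and ctf: "contains_transverse_frobenius (frame_product \<Omega> g) (singular_system (\<lambda>z. c * of_real (root_curvature g z)) g)
      (map (\<lambda>A z v. of_real (A z v)) (isometric_embedding_system g))"
  defines "f \<equiv> \<lambda>x. ln \<bar>gauss_curvature g x\<bar> / 4"
  shows "integrable_metric \<Omega> g h f (frame_deriv h 1 f) (frame_deriv h 2 f) \<sigma>"
    and "\<And>x. x \<in> \<Omega> \<Longrightarrow> gauss_curvature g x = \<sigma> * exp (4 * f x)"
proof -
  have abs: "\<bar>gauss_curvature g x\<bar> = \<sigma> * gauss_curvature g x" "gauss_curvature g x \<noteq> 0" if "x \<in> \<Omega>" for x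
    using K[OF that] \<sigma> by auto
  show eK: "gauss_curvature g x = \<sigma> * exp (4 * f x)" if "x \<in> \<Omega>" for x
    using abs[OF that] \<sigma> by (auto simp: f_def)
  have cK: "c * c * of_real \<bar>gauss_curvature g x\<bar> = - of_real (gauss_curvature g x)" if "x \<in> \<Omega>" for x
    using \<sigma> unfolding c abs(1)[OF that] by auto
  \<comment> \<open>The subbundle exists only near each point of the frame product, with its own N
    and forms. The equations are pointwise, so one Euclidean frame over each x, here the standard
    one at the origin, is enough.\<close>
  have ex: "\<exists>N As. darboux_chart \<Omega> \<Omega> g h c N As \<and> ((x, dual_frame h x), (0, mat 1)) \<in> N" if x: "x \<in> \<Omega>" for x
  proof -
    have F: "(0, mat 1) \<in> euclidean_frames"
      by (simp add: euclidean_frames_def forall_3 inner_vec_def sum_3 mat_def)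
    have z: "((x, dual_frame h x), (0, mat 1)) \<in> frame_product \<Omega> g"
      using section_frames_sub_frame_product[OF cf order_refl] x F by (auto simp: section_frames_def)
    from bspec[OF ctf[unfolded contains_transverse_frobenius_def] z]
    obtain N As where N: "open N \<and> ((x, dual_frame h x), (0, mat 1)) \<in> N \<and> length As \<ge> 2 \<and> (\<forall>A\<in>set As. smooth_form N A) \<and>
        (\<forall>z\<in>N \<inter> frame_product \<Omega> g. independent_at (frame_product \<Omega> g) z As \<and>
           (\<forall>A\<in>set As. in_span_at (frame_product \<Omega> g) z (singular_system (\<lambda>z. c * of_real (root_curvature g z)) g) A) \<and>
           frobenius_at (frame_product \<Omega> g) z As \<and>
           transverse_at (frame_product \<Omega> g) z As (map (\<lambda>A z v. of_real (A z v)) (isometric_embedding_system g)))"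
      by (elim exE) (rule that)
    note N1 = conjunct1[OF N] and N2 = conjunct1[OF conjunct2[OF N]] and N3 = conjunct1[OF conjunct2[OF conjunct2[OF N]]]
      and N4 = conjunct1[OF conjunct2[OF conjunct2[OF conjunct2[OF N]]]] and N5 = conjunct2[OF conjunct2[OF conjunct2[OF conjunct2[OF N]]]]
    have "darboux_chart \<Omega> \<Omega> g h c N As"
      by (rule darboux_chart.intro[OF cf order_refl abs(2) cK N1 N3 bspec[OF N4] bspec[OF N5]])
    then show ?thesis using N2 by (intro exI conjI)
  qed
  have fs: "smooth_on \<Omega> f"
  proof -
    have "smooth_on \<Omega> (\<lambda>x. \<sigma> * gauss_curvature g x)"
      by (intro smooth_on_mult smooth_on_const curvature_smooth[OF cf] coframe_open[OF cf])
    from smooth_on_ln[OF coframe_open[OF cf] this K]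
    have "smooth_on \<Omega> (\<lambda>x. ln (\<sigma> * gauss_curvature g x) * (1 / 4))"
      by (rule smooth_on_mult[OF coframe_open[OF cf] _ smooth_on_const])
    then show ?thesis by (rule smooth_on_cong[OF coframe_open[OF cf], rotated]) (simp add: f_def abs(1))
  qed
  show "integrable_metric \<Omega> g h f (frame_deriv h 1 f) (frame_deriv h 2 f) \<sigma>"
  proof
    show "coframe_on \<Omega> g h" by (rule cf)
    show "smooth_on \<Omega> f" by (rule fs)
    show "smooth_on \<Omega> (frame_deriv h 1 f)" "smooth_on \<Omega> (frame_deriv h 2 f)"
      by (rule frame_deriv_smooth[OF cf fs])+
    fix x i assume x: "x \<in> \<Omega>"
    show "partial i f x = h x $ 1 $ i * frame_deriv h 1 f x + h x $ 2 $ i * frame_deriv h 2 f x"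
      by (rule partial_frame_deriv[OF cf x])
    obtain N As where d: "darboux_chart \<Omega> \<Omega> g h c N As" "((x, dual_frame h x), (0, mat 1)) \<in> N"
      using ex[OF x] by blast
    show "partial i (frame_deriv h 1 f) x = h x $ 1 $ i * (3 * (frame_deriv h 1 f x)\<^sup>2 - \<sigma> * exp (4 * f x)) +
        h x $ 2 $ i * (3 * frame_deriv h 1 f x * frame_deriv h 2 f x) - frame_deriv h 2 f x * conn h i x"
      using darboux_chart.pde_at(1)[OF d(1) x d(2), of i] unfolding f_def[symmetric] eK[OF x] .
    show "partial i (frame_deriv h 2 f) x = h x $ 1 $ i * (3 * frame_deriv h 1 f x * frame_deriv h 2 f x) +
        h x $ 2 $ i * (3 * (frame_deriv h 2 f x)\<^sup>2 - \<sigma> * exp (4 * f x)) + frame_deriv h 1 f x * conn h i x"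
      using darboux_chart.pde_at(2)[OF d(1) x d(2), of i] unfolding f_def[symmetric] eK[OF x] .
  qed
qed

lemma elliptic_system_eq: "elliptic_system g = singular_system (\<lambda>z. \<i> * of_real (root_curvature g z)) g"
  by (simp add: elliptic_system_def singular_system_def complexify_def[abs_def])

lemma hyperbolic_system_eq: "hyperbolic_system 1 g = singular_system (\<lambda>z. 1 * of_real (root_curvature g z)) g"
  by (simp add: hyperbolic_system_def singular_system_def)

section \<open>Normal forms on the surface\<close>

locale riemannian_surface =
  fixes S :: "'p riem_surface"
  assumes S: "oriented_riemannian_surface S"
begin

section \<open>Charts, transition maps and the metric tensor\<close>

abbreviation dom where "dom c \<equiv> snd c ` fst c"

lemma chart: "c \<in> atlas S \<Longrightarrow> chart_on (space S) c"
  using S unfolding oriented_riemannian_surface_def oriented_smooth_surface_def by blast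

lemma covered: "p \<in> topspace (space S) \<Longrightarrow> \<exists>c\<in>atlas S. p \<in> fst c"
  using S unfolding oriented_riemannian_surface_def oriented_smooth_surface_def by blast

lemma chart_openin: "chart_on X c \<Longrightarrow> openin X (fst c)"
  and chart_open: "chart_on X c \<Longrightarrow> open (snd c ` fst c)"
  and chart_homeo: "chart_on X c \<Longrightarrow> homeomorphic_map (subtopology X (fst c)) (top_of_set (snd c ` fst c)) (snd c)"
  by (auto simp: chart_on_def split: prod.splits)

lemma chart_inj: "chart_on X c \<Longrightarrow> inj_on (snd c) (fst c)"
proof -
  assume c: "chart_on X c"
  have "topspace (subtopology X (fst c)) = fst c"
    using openin_subset[OF chart_openin[OF c]] by auto
  then show ?thesis using chart_homeo[OF c] homeomorphic_imp_injective_map by metis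
qed

lemma chart_image_open:
  assumes c: "chart_on X c" and V: "openin X V" "V \<subseteq> fst c"
  shows "open (snd c ` V)"
proof -
  have "openin (subtopology X (fst c)) V" using V by (simp add: openin_open_subtopology chart_openin[OF c])
  then have "openin (top_of_set (snd c ` fst c)) (snd c ` V)"
    using chart_homeo[OF c] homeomorphic_imp_open_map open_map_def by metis
  then show ?thesis using chart_open[OF c] openin_open_trans by blast
qed

lemma chart_preimage_openin:
  assumes c: "chart_on X c" and W: "open W"
  shows "openin X {q \<in> fst c. snd c q \<in> W}"
proof -
  have "continuous_map (subtopology X (fst c)) (top_of_set (snd c ` fst c)) (snd c)"
    using chart_homeo[OF c] homeomorphic_imp_continuous_map by blast
  then have "continuous_map (subtopology X (fst c)) euclidean (snd c)"
    by (simp add: continuous_map_in_subtopology)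
  then have "openin (subtopology X (fst c)) {q \<in> topspace (subtopology X (fst c)). snd c q \<in> W}"
    by (rule openin_continuous_map_preimage) (use W in simp)
  moreover have "topspace (subtopology X (fst c)) = fst c"
    using openin_subset[OF chart_openin[OF c]] by auto
  ultimately show ?thesis using chart_openin[OF c] openin_trans_full by metis
qed

lemma overlap_eq: "overlap c d = snd c ` (fst c \<inter> fst d)"
  by (simp add: overlap_def split: prod.splits)

lemma transition_eq: "transition c d = snd d \<circ> inv_into (fst c) (snd c)"
  by (simp add: transition_def split: prod.splits)

lemma transition_chart: "chart_on X c \<Longrightarrow> q \<in> fst c \<Longrightarrow> transition c d (snd c q) = snd d q"
  by (simp add: transition_eq inv_into_f_f[OF chart_inj])

lemma overlap_open: "chart_on X c \<Longrightarrow> chart_on X d \<Longrightarrow> open (overlap c d)"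
  unfolding overlap_eq by (rule chart_image_open) (auto intro: chart_openin)

context
  fixes c d assumes c: "c \<in> atlas S" and d: "d \<in> atlas S"
begin

lemma transition_smooth: "smooth_on (overlap c d) (transition c d)"
  using S c d unfolding oriented_riemannian_surface_def oriented_smooth_surface_def smoothly_compatible_def by blast

lemma transition_det: "x \<in> overlap c d \<Longrightarrow> det (matrix (frechet_derivative (transition c d) (at x))) > 0"
  using S c d unfolding oriented_riemannian_surface_def oriented_smooth_surface_def by blast

lemma transition_metric: "x \<in> overlap c d \<Longrightarrow> a \<bullet> (metric S c x *v b) =
    frechet_derivative (transition c d) (at x) a \<bullet> (metric S d (transition c d x) *v frechet_derivative (transition c d) (at x) b)"
  using S c d unfolding oriented_riemannian_surface_def riemannian_metric_def Let_def by blast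

lemma transition_in: "x \<in> overlap c d \<Longrightarrow> transition c d x \<in> dom d"
  by (auto simp: overlap_eq transition_chart[OF chart[OF c]])

lemma overlap_sub: "overlap c d \<subseteq> dom c"
  by (auto simp: overlap_eq)

lemma transition_component:
  "x \<in> overlap c d \<Longrightarrow> frechet_derivative (transition c d) (at x) (axis j 1) $ i = partial j (\<lambda>y. transition c d y $ i) x"
  by (rule partial_eq[symmetric], rule bounded_linear.has_derivative[OF bounded_linear_vec_nth])
    (rule smooth_on_has_derivative[OF transition_smooth])

lemma transition_jacobian:
  assumes "x \<in> overlap c d"
  shows "partial 1 (\<lambda>y. transition c d y $ 1) x * partial 2 (\<lambda>y. transition c d y $ 2) x -
       partial 2 (\<lambda>y. transition c d y $ 1) x * partial 1 (\<lambda>y. transition c d y $ 2) x > 0"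
  using transition_det[OF assms] by (simp add: det_2x2 matrix_def transition_component[OF assms])

lemma transition_metric_component:
  assumes "x \<in> overlap c d"
  shows "metric S c x $ i $ j = (\<Sum>k\<in>UNIV. \<Sum>l\<in>UNIV. partial i (\<lambda>y. transition c d y $ k) x *
     (metric S d (transition c d x) $ k $ l * partial j (\<lambda>y. transition c d y $ l) x))"
proof -
  have "metric S c x $ i $ j = axis i 1 \<bullet> (metric S c x *v axis j 1)"
    by (simp add: inner_axis' matrix_vector_mult_basis column_def)
  then show ?thesis
    unfolding transition_metric[OF assms]
    by (simp add: inner_vec_def matrix_vector_mult_def transition_component[OF assms] sum_distrib_left)
qed

end

lemma metric_coframe:
  assumes "c \<in> atlas S"
  obtains h where "coframe_on (dom c) (metric S c) h"
proof (rule coframe_exists)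
  show "open (dom c)" by (rule chart_open[OF chart[OF assms]])
  have "smooth_on (dom c) (metric S c) \<and> (\<forall>x\<in>dom c. transpose (metric S c x) = metric S c x \<and>
           (\<forall>a. a \<noteq> 0 \<longrightarrow> a \<bullet> (metric S c x *v a) > 0))"
    using S assms unfolding oriented_riemannian_surface_def riemannian_metric_def by blast
  then show "smooth_on (dom c) (metric S c)" "\<And>x. x \<in> dom c \<Longrightarrow> transpose (metric S c x) = metric S c x"
    "\<And>x a. x \<in> dom c \<Longrightarrow> a \<noteq> 0 \<Longrightarrow> a \<bullet> (metric S c x *v a) > 0" by blast+
qed

lemma curvature_transition:
  assumes "c \<in> atlas S" "d \<in> atlas S" "x \<in> overlap c d"
  shows "gauss_curvature (metric S c) x = gauss_curvature (metric S d) (transition c d x)"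
proof -
  obtain h where h: "coframe_on (dom d) (metric S d) h" using metric_coframe[OF assms(2)] .
  show ?thesis
    by (rule pullback_curvature[OF h overlap_open[OF chart chart] transition_smooth transition_in
      transition_jacobian transition_metric_component assms(3)]) (use assms in auto)
qed

end

context riemannian_surface
begin

text \<open>The new chart is c0 cut down to V and followed by \<psi>. Its transitions to any chart
  factor through c0, which gives both smooth compatibility and, by the tensor law, the form of the
  metric in every chart.\<close>

lemma metric_has_form_atI:
  fixes \<psi> G :: "real^2 \<Rightarrow> real^2"
  assumes c0: "c0 \<in> atlas S" and p: "p \<in> fst c0"
    and V: "open V" "V \<subseteq> dom c0" "snd c0 p \<in> V" and W: "open W" and hom: "homeomorphism V W \<psi> G"
    and \<psi>: "smooth_on V \<psi>" and G: "smooth_on W G" and T: "\<And>x. x \<in> V \<Longrightarrow> \<psi> x $ 1 \<in> T"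
    and met: "\<And>x a. x \<in> V \<Longrightarrow> a \<bullet> (metric S c0 x *v a) = \<mu> * (A (\<psi> x $ 1) * (frechet_derivative \<psi> (at x) a $ 1)\<^sup>2 +
       B (\<psi> x $ 1) * (frechet_derivative \<psi> (at x) a $ 2)\<^sup>2)"
  shows "metric_has_form_at S p \<mu> T A B"
proof -
  define V' where "V' = {q \<in> fst c0. snd c0 q \<in> V}"
  define d where "d = (V', \<lambda>q. \<psi> (snd c0 q))"
  have fd: "fst d = V'" and sd: "snd d q = \<psi> (snd c0 q)" for q by (simp_all add: d_def)
  note ch0 = chart[OF c0]
  have V'o: "openin (space S) V'" unfolding V'_def by (rule chart_preimage_openin[OF ch0 V(1)])
  have V'sub: "V' \<subseteq> fst c0" by (auto simp: V'_def)
  have im0: "snd c0 ` V' = V" using V(2) by (auto simp: V'_def)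
  have im: "snd d ` fst d = W"
  proof -
    have "snd d ` fst d = \<psi> ` (snd c0 ` V')" by (auto simp: fd sd)
    then show ?thesis using hom by (simp add: im0 homeomorphism_def)
  qed
  have "homeomorphic_map (subtopology (space S) V') (top_of_set V) (snd c0)"
  proof -
    have t: "topspace (subtopology (space S) (fst c0)) = fst c0"
      using openin_subset[OF chart_openin[OF ch0]] by auto
    have "homeomorphic_map (subtopology (subtopology (space S) (fst c0)) V') (subtopology (top_of_set (dom c0)) V) (snd c0)"
      by (rule homeomorphic_map_subtopologies[OF chart_homeo[OF ch0]])
        (unfold t, use V(2) V'sub im0 in auto)
    then show ?thesis using V(2) V'sub by (simp add: subtopology_subtopology inf.absorb2)
  qed
  moreover have "homeomorphic_map (top_of_set V) (top_of_set W) \<psi>"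
    using hom unfolding homeomorphic_map_maps homeomorphic_maps_def homeomorphism_def
    by (intro exI[of _ G]) (auto simp: continuous_map_in_subtopology)
  ultimately have "homeomorphic_map (subtopology (space S) V') (top_of_set W) (\<psi> \<circ> snd c0)"
    by (rule homeomorphic_map_compose)
  then have chd: "chart_on (space S) d"
    using V'o W im unfolding chart_on_def by (simp add: d_def o_def)
  have ovl: "overlap c d = snd c ` (fst c \<inter> V')" for c by (simp add: overlap_eq fd)
  have tr: "transition c d (snd c q) = \<psi> (transition c c0 (snd c q))" if "c \<in> atlas S" "q \<in> fst c" "q \<in> V'" for c q
    using that by (simp add: transition_chart[OF chart] sd)
  have fwd: "open (overlap c d)" "overlap c d \<subseteq> overlap c c0" "\<And>x. x \<in> overlap c d \<Longrightarrow> transition c c0 x \<in> V"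
    "\<And>x. x \<in> overlap c d \<Longrightarrow> transition c d x = \<psi> (transition c c0 x)" if c: "c \<in> atlas S" for c
  proof -
    show "open (overlap c d)" by (rule overlap_open[OF chart[OF c] chd])
    show "overlap c d \<subseteq> overlap c c0" unfolding ovl unfolding overlap_eq using V'sub by blast
    show "transition c c0 x \<in> V" if x: "x \<in> overlap c d" for x
      using that by (auto simp: ovl transition_chart[OF chart[OF c]] V'_def)
    show "transition c d x = \<psi> (transition c c0 x)" if x: "x \<in> overlap c d" for x
      using that tr[OF c] by (auto simp: ovl)
  qed
  have "smoothly_compatible c d" if c: "c \<in> atlas S" for c
    unfolding smoothly_compatible_def
  proof
    have "smooth_on (overlap c d) (\<lambda>x. \<psi> (transition c c0 x))"
      by (rule smooth_on_compose[OF fwd(1)[OF c] V(1) fwd(3)[OF c] smooth_on_subset[OF transition_smooth[OF c c0] fwd(2)[OF c]] \<psi>])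
    then show "smooth_on (overlap c d) (transition c d)"
      by (rule smooth_on_cong[OF fwd(1)[OF c], rotated]) (simp add: fwd(4)[OF c])
    have ovd: "overlap d c = snd d ` (V' \<inter> fst c)" by (simp add: overlap_eq fd)
    have o: "open (overlap d c)" by (rule overlap_open[OF chd chart[OF c]])
    have Gy: "G (snd d q) = snd c0 q" if "q \<in> V'" for q
      using that hom by (simp add: sd V'_def homeomorphism_def)
    have "overlap d c \<subseteq> W" unfolding im[symmetric] by (auto simp: ovd fd)
    note Gs = smooth_on_subset[OF G this]
    have "G y \<in> overlap c0 c" if "y \<in> overlap d c" for y
      using that Gy V'sub unfolding ovd unfolding overlap_eq by auto
    from smooth_on_compose[OF o overlap_open[OF ch0 chart[OF c]] this Gs transition_smooth[OF c0 c]]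
    have "smooth_on (overlap d c) (\<lambda>y. transition c0 c (G y))" .
    moreover have "transition c0 c (G y) = transition d c y" if y: "y \<in> overlap d c" for y
    proof -
      obtain q where q: "y = snd d q" "q \<in> V'" "q \<in> fst c" using y unfolding ovd by blast
      have "transition d c y = snd c q"
        unfolding q(1) by (rule transition_chart[OF chd]) (simp only: fd q(2))
      moreover have "transition c0 c (G y) = snd c q"
        unfolding q(1) Gy[OF q(2)] by (rule transition_chart[OF ch0 subsetD[OF V'sub q(2)]])
      ultimately show ?thesis by simp
    qed
    ultimately show "smooth_on (overlap d c) (transition d c)"
      by (rule smooth_on_cong[OF o, rotated])
  qed
  then have "coordinate_system S d" using chd by (simp add: coordinate_system_def)
  moreover have "p \<in> fst d" using p V(3) by (simp add: fd V'_def)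
  moreover have "snd d q $ 1 \<in> T" if "q \<in> fst d" for q using T that by (simp add: fd sd V'_def)
  moreover have "a \<bullet> (metric S c x *v a) = \<mu> * (A (transition c d x $ 1) * (frechet_derivative (transition c d) (at x) a $ 1)\<^sup>2 +
      B (transition c d x $ 1) * (frechet_derivative (transition c d) (at x) a $ 2)\<^sup>2)"
    if c: "c \<in> atlas S" and x: "x \<in> overlap c d" for c x a
  proof -
    have x0: "x \<in> overlap c c0" using x fwd(2)[OF c] by blast
    have t: "transition c c0 x \<in> V" by (rule fwd(3)[OF c x])
    have "frechet_derivative (transition c d) (at x) = frechet_derivative (\<lambda>x. \<psi> (transition c c0 x)) (at x)"
      by (rule frechet_derivative_cong_open[OF fwd(1)[OF c] x fwd(4)[OF c]])
    also have "\<dots> = (\<lambda>v. frechet_derivative \<psi> (at (transition c c0 x)) (frechet_derivative (transition c c0) (at x) v))"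
      by (rule frechet_derivative_eq[OF has_derivative_compose[OF
          smooth_on_has_derivative[OF transition_smooth[OF c c0] x0] smooth_on_has_derivative[OF \<psi> t]]])
    finally show ?thesis
      unfolding transition_metric[OF c c0 x0] met[OF t] fwd(4)[OF c x] by simp
  qed
  ultimately show ?thesis unfolding metric_has_form_at_def Let_def by blast
qed

definition curv_log where "curv_log c x = ln \<bar>gauss_curvature (metric S c) x\<bar> / 4"

end

text \<open>A coframe is fixed in every chart; \<open>\<sigma>\<close> is the sign of the curvature.\<close>

locale integrable_surface = riemannian_surface S for S :: "'p riem_surface" +
  fixes H :: "'p chart \<Rightarrow> real^2 \<Rightarrow> real^2^2" and \<sigma> :: real
  assumes conn: "connected_space (space S)" and \<sigma>: "\<sigma> = 1 \<or> \<sigma> = - 1"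
    and im: "\<And>c. c \<in> atlas S \<Longrightarrow> integrable_metric (dom c) (metric S c) (H c) (curv_log c)
      (frame_deriv (H c) 1 (curv_log c)) (frame_deriv (H c) 2 (curv_log c)) \<sigma>"
    and K: "\<And>c x. c \<in> atlas S \<Longrightarrow> x \<in> dom c \<Longrightarrow> gauss_curvature (metric S c) x = \<sigma> * exp (4 * curv_log c x)"
begin

section \<open>Invariance and constancy of the first integral\<close>

abbreviation P where "P c \<equiv> frame_deriv (H c) 1 (curv_log c)"
abbreviation Q where "Q c \<equiv> frame_deriv (H c) 2 (curv_log c)"
abbreviation Rho where "Rho c \<equiv> integrable_metric.\<rho> (P c) (Q c)"
abbreviation Rad where "Rad c \<equiv> integrable_metric.r (curv_log c)"
abbreviation Level where "Level c \<equiv> integrable_metric.level (curv_log c) (P c) (Q c) \<sigma>"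

lemma Level_eq: assumes "c \<in> atlas S" shows "Level c x = Rad c x ^ 6 * Rho c x - \<sigma> * Rad c x ^ 2"
  using integrable_metric.level_def[OF im[OF assms]] .

lemma Rad_eq: assumes "c \<in> atlas S" shows "Rad c x = exp (- curv_log c x)"
  using integrable_metric.r_def[OF im[OF assms]] .

context
  fixes c d x assumes c: "c \<in> atlas S" and d: "d \<in> atlas S" and x: "x \<in> overlap c d"
begin

lemma curv_log_transition: "curv_log c x = curv_log d (transition c d x)"
  unfolding curv_log_def curvature_transition[OF c d x] ..

lemma Rad_transition: "Rad c x = Rad d (transition c d x)"
  unfolding Rad_eq[OF c] Rad_eq[OF d] curv_log_transition ..

end

text \<open>Numerator and denominator in \<open>gradient_norm\<close> both acquire the square of the
  Jacobian.\<close>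

lemma Rho_transition:
  assumes c: "c \<in> atlas S" and d: "d \<in> atlas S" and x: "x \<in> overlap c d"
  shows "Rho c x = Rho d (transition c d x)"
proof -
  let ?\<tau> = "transition c d"
  interpret C: integrable_metric "dom c" "metric S c" "H c" "curv_log c" "P c" "Q c" \<sigma> by (rule im[OF c])
  interpret D: integrable_metric "dom d" "metric S d" "H d" "curv_log d" "P d" "Q d" \<sigma> by (rule im[OF d])
  have xc: "x \<in> dom c" using overlap_sub[OF c d] x by blast
  have xd: "?\<tau> x \<in> dom d" by (rule transition_in[OF c d x])
  have td: "?\<tau> differentiable (at x)" by (rule smooth_on_differentiable[OF transition_smooth[OF c d] x])
  define t where "t i j = partial i (\<lambda>y. ?\<tau> y $ j) x" for i j
  have pf: "partial i (curv_log c) x = partial 1 (curv_log d) (?\<tau> x) * t i 1 + partial 2 (curv_log d) (?\<tau> x) * t i 2" for i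
  proof -
    have "partial i (curv_log c) x = partial i (\<lambda>y. curv_log d (?\<tau> y)) x"
      by (rule partial_cong_open[OF overlap_open[OF chart[OF c] chart[OF d]] x]) (rule curv_log_transition[OF c d])
    then show ?thesis
      unfolding t_def partial_compose[OF td smooth_on_differentiable[OF D.fs xd]] .
  qed
  let ?g = "metric S d (?\<tau> x)" and ?f = "\<lambda>i. partial i (curv_log d) (?\<tau> x)"
  have sym: "?g $ 2 $ 1 = ?g $ 1 $ 2"
    unfolding coframe_metric[OF D.cf xd] by (simp add: mult.commute)
  have g: "metric S c x $ i $ j = t i 1 * (?g $ 1 $ 1 * t j 1 + ?g $ 1 $ 2 * t j 2) + t i 2 * (?g $ 1 $ 2 * t j 1 + ?g $ 2 $ 2 * t j 2)" for i j
    unfolding transition_metric_component[OF c d x] t_def by (simp add: sum_2 sym algebra_simps)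
  define J where "J = t 1 1 * t 2 2 - t 2 1 * t 1 2"
  have J: "J \<noteq> 0" using transition_jacobian[OF c d x] by (simp add: J_def t_def)
  have det: "det (metric S c x) = J\<^sup>2 * det ?g"
    unfolding det_2x2 g J_def sym by (simp add: power2_eq_square algebra_simps)
  have num: "metric S c x $ 2 $ 2 * (partial 1 (curv_log c) x)\<^sup>2 - 2 * metric S c x $ 1 $ 2 * partial 1 (curv_log c) x * partial 2 (curv_log c) x
      + metric S c x $ 1 $ 1 * (partial 2 (curv_log c) x)\<^sup>2 =
      J\<^sup>2 * (?g $ 2 $ 2 * (?f 1)\<^sup>2 - 2 * ?g $ 1 $ 2 * ?f 1 * ?f 2 + ?g $ 1 $ 1 * (?f 2)\<^sup>2)"
    unfolding pf g J_def by (simp add: power2_eq_square algebra_simps)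
  show ?thesis
    unfolding C.gradient_norm[OF xc] D.gradient_norm[OF xd] det num using J by simp
qed

lemma Level_transition:
  assumes "c \<in> atlas S" "d \<in> atlas S" "x \<in> overlap c d"
  shows "Level c x = Level d (transition c d x)"
  unfolding Level_eq[OF assms(1)] Level_eq[OF assms(2)] Rho_transition[OF assms] Rad_transition[OF assms] ..

lemma at_point:
  assumes "c \<in> atlas S" "d \<in> atlas S" "q \<in> fst c" "q \<in> fst d"
  shows "Rho c (snd c q) = Rho d (snd d q)" "Level c (snd c q) = Level d (snd d q)"
proof -
  have "snd c q \<in> overlap c d" using assms by (auto simp: overlap_eq)
  then show "Rho c (snd c q) = Rho d (snd d q)" "Level c (snd c q) = Level d (snd d q)"
    using Rho_transition[OF assms(1,2)] Level_transition[OF assms(1,2)] assms(3)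
    by (simp_all add: transition_chart[OF chart[OF assms(1)]])
qed

text \<open>The level is locally constant in charts and independent of the chart, so on the
  connected surface each level set is open and closed.\<close>

lemma level_constant:
  obtains l where "\<And>c x. c \<in> atlas S \<Longrightarrow> x \<in> dom c \<Longrightarrow> Level c x = l"
proof (cases "topspace (space S) = {}")
  case True
  \<comment> \<open>On the empty surface every value serves.\<close>
  have "fst c = {}" if "c \<in> atlas S" for c
    using openin_subset[OF chart_openin[OF chart[OF that]]] True by simp
  then show ?thesis by (intro that[of 0]) simp
next
  case False
  then obtain p0 where p0: "p0 \<in> topspace (space S)" by blast
  then obtain c0 where c0: "c0 \<in> atlas S" "p0 \<in> fst c0" using covered by blast
  define l where "l = Level c0 (snd c0 p0)"
  \<comment> \<open>Taken for arbitrary sets m of values, so that the complement of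
    \<open>Z {l}\<close> is again of this kind and open for the same reason.\<close>
  define Z where "Z m = {q \<in> topspace (space S). \<exists>c\<in>atlas S. q \<in> fst c \<and> Level c (snd c q) \<in> m}" for m
  have Zo: "openin (space S) (Z m)" for m
  proof (subst openin_subopen, intro ballI)
    fix q assume "q \<in> Z m"
    then obtain c where c: "c \<in> atlas S" "q \<in> fst c" "Level c (snd c q) \<in> m" by (auto simp: Z_def)
    interpret C: integrable_metric "dom c" "metric S c" "H c" "curv_log c" "P c" "Q c" \<sigma> by (rule im[OF c(1)])
    obtain e where e: "e > 0" "ball (snd c q) e \<subseteq> dom c"
      using C.\<Omega> c(2) by (meson imageI openE)
    let ?N = "{q' \<in> fst c. snd c q' \<in> ball (snd c q) e}"
    have "openin (space S) ?N" by (rule chart_preimage_openin[OF chart[OF c(1)] open_ball])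
    moreover have "q \<in> ?N" using c(2) e(1) by simp
    moreover have "?N \<subseteq> Z m"
    proof
      fix q' assume q': "q' \<in> ?N"
      then have "Level c (snd c q') = Level c (snd c q)" using C.level_constant_on_ball[OF e(2)] by blast
      then show "q' \<in> Z m" using q' c openin_subset[OF chart_openin[OF chart[OF c(1)]]] by (auto simp: Z_def)
    qed
    ultimately show "\<exists>T. openin (space S) T \<and> q \<in> T \<and> T \<subseteq> Z m" by blast
  qed
  have uniq: "Level c (snd c q) = Level d (snd d q)" if "c \<in> atlas S" "d \<in> atlas S" "q \<in> fst c" "q \<in> fst d" for c d q
    by (rule at_point(2)[OF that])
  have "topspace (space S) - Z {l} = Z (- {l})"
  proof (intro equalityI subsetI)
    fix q assume q: "q \<in> topspace (space S) - Z {l}"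
    then obtain c where "c \<in> atlas S" "q \<in> fst c" using covered by blast
    then show "q \<in> Z (- {l})" using q unfolding Z_def by blast
  next
    fix q assume "q \<in> Z (- {l})"
    then obtain c where c: "q \<in> topspace (space S)" "c \<in> atlas S" "q \<in> fst c" "Level c (snd c q) \<noteq> l"
      unfolding Z_def by blast
    have "Level d (snd d q) \<noteq> l" if "d \<in> atlas S" "q \<in> fst d" for d
      using uniq[OF c(2) that(1) c(3) that(2)] c(4) by simp
    then show "q \<in> topspace (space S) - Z {l}" using c(1) unfolding Z_def by blast
  qed
  then have "closedin (space S) (Z {l})" using Zo[of "- {l}"] by (simp add: closedin_def Z_def)
  moreover have "Z {l} \<noteq> {}" using p0 c0 by (auto simp: Z_def l_def)
  ultimately have Zl: "Z {l} = topspace (space S)"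
    using conn Zo[of "{l}"] unfolding connected_space_clopen_in by blast
  have *: "Level c (snd c q) = l" if "c \<in> atlas S" "q \<in> fst c" for c q
  proof -
    have "q \<in> Z {l}" using Zl openin_subset[OF chart_openin[OF chart[OF that(1)]]] that by blast
    then obtain d where "d \<in> atlas S" "q \<in> fst d" "Level d (snd d q) = l" unfolding Z_def by blast
    then show ?thesis using uniq[OF that(1) _ that(2)] by simp
  qed
  show ?thesis
  proof (rule that)
    fix c x assume c: "c \<in> atlas S" and "x \<in> dom c"
    then obtain q where "q \<in> fst c" "x = snd c q" by blast
    then show "Level c x = l" using *[OF c] by simp
  qed
qed

lemma critical_iff_Rho:
  assumes "c \<in> atlas S" "q \<in> fst c"
  shows "curvature_critical S q \<longleftrightarrow> Rho c (snd c q) = 0"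
proof -
  have "(gauss_curvature (metric S d) has_derivative (\<lambda>_. 0)) (at (snd d q)) \<longleftrightarrow> Rho d (snd d q) = 0"
    if "d \<in> atlas S" "q \<in> fst d" for d
    using integrable_metric.critical_iff[OF im[OF that(1)], of "snd d q" "gauss_curvature (metric S d)"] K[OF that(1)] \<sigma> that(2)
    by auto
  then show ?thesis using assms at_point(1)[OF assms(1) _ assms(2)] unfolding curvature_critical_def by metis
qed

lemma critical_isolated:
  assumes "p \<in> topspace (space S)"
  shows "\<exists>N. openin (space S) N \<and> p \<in> N \<and> (\<forall>q\<in>N - {p}. \<not> curvature_critical S q)"
proof -
  obtain c where c: "c \<in> atlas S" "p \<in> fst c" using covered[OF assms] by blast
  interpret C: integrable_metric "dom c" "metric S c" "H c" "curv_log c" "P c" "Q c" \<sigma> by (rule im[OF c(1)])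
  have "\<sigma> \<noteq> 0" using \<sigma> by auto
  moreover have "snd c p \<in> dom c" using c(2) by blast
  ultimately obtain V where V: "open V" "snd c p \<in> V" "V \<subseteq> dom c" "\<And>x. x \<in> V \<Longrightarrow> x \<noteq> snd c p \<Longrightarrow> Rho c x \<noteq> 0"
    by (rule C.isolated_zero) blast
  let ?N = "{q \<in> fst c. snd c q \<in> V}"
  have "openin (space S) ?N" by (rule chart_preimage_openin[OF chart[OF c(1)] V(1)])
  moreover have "\<not> curvature_critical S q" if "q \<in> ?N - {p}" for q
  proof -
    have "snd c q \<noteq> snd c p" using chart_inj[OF chart[OF c(1)]] that c(2) by (auto simp: inj_on_def)
    then show ?thesis using that V(4) critical_iff_Rho[OF c(1)] by auto
  qed
  ultimately show ?thesis using c(2) V(2) by blast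
qed

text \<open>With the curvature radius \<open>r = \<bar>K\<bar>\<^sup>-\<^sup>1\<^sup>/\<^sup>4\<close>, the metric is
  \<open>r\<^sup>4 dr\<^sup>2 / (l + \<sigma> r\<^sup>2) + (l + \<sigma> r\<^sup>2) dv\<^sup>2\<close>; \<open>u\<close> uniformizes the square root.\<close>

lemma form_at:
  fixes u u' A B :: "real \<Rightarrow> real"
  assumes l: "\<And>c x. c \<in> atlas S \<Longrightarrow> x \<in> dom c \<Longrightarrow> Level c x = l"
    and p: "p \<in> topspace (space S)" "\<not> curvature_critical S p"
    and I: "open I" "\<And>t. t > 0 \<Longrightarrow> l + \<sigma> * t\<^sup>2 > 0 \<Longrightarrow> t \<in> I"
    and u: "\<And>t. t \<in> I \<Longrightarrow> (u has_real_derivative u' t) (at t)" "smooth_on I u'"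
    and c: "m > 0"
    and T: "\<And>t. t \<in> I \<Longrightarrow> u t \<in> T"
    and A: "\<And>t. t > 0 \<Longrightarrow> l + \<sigma> * t\<^sup>2 > 0 \<Longrightarrow> \<mu> * A (u t) * (u' t)\<^sup>2 * (l + \<sigma> * t\<^sup>2) = t ^ 4"
    and B: "\<And>t. t > 0 \<Longrightarrow> l + \<sigma> * t\<^sup>2 > 0 \<Longrightarrow> \<mu> * B (u t) = m\<^sup>2 * (l + \<sigma> * t\<^sup>2)"
  shows "metric_has_form_at S p \<mu> T A B"
proof -
  obtain c where c: "c \<in> atlas S" "p \<in> fst c" using covered[OF p(1)] by blast
  interpret C: integrable_metric "dom c" "metric S c" "H c" "curv_log c" "P c" "Q c" \<sigma> by (rule im[OF c(1)])
  have x0: "snd c p \<in> dom c" using c(2) by blast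
  \<comment> \<open>r^6 \<rho> = l + \<sigma> r^2, so at noncritical points the right side is
    positive; this confines r to the interval on which u is defined.\<close>
  have lev: "Rad c x ^ 6 * Rho c x = l + \<sigma> * (Rad c x)\<^sup>2" if "x \<in> dom c" for x
    using l[OF c(1) that] Level_eq[OF c(1), of x] by simp
  have lpos: "l + \<sigma> * (Rad c x)\<^sup>2 > 0" if "x \<in> dom c" "Rho c x \<noteq> 0" for x
    unfolding lev[OF that(1), symmetric] using C.r_pos[of x] C.\<rho>_nonneg[of x] that(2) by (simp add: less_le)
  have \<rho>0: "Rho c (snd c p) \<noteq> 0" using p(2) critical_iff_Rho[OF c] by simp
  have rI: "Rad c (snd c p) \<in> I" by (rule I(2)[OF C.r_pos lpos[OF x0 \<rho>0]])
  show ?thesis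
  proof (rule C.normal_form_coordinates[OF x0 \<rho>0 I(1) rI u \<open>m > 0\<close> T])
    fix x assume x: "x \<in> dom c" "Rad c x \<in> I" "Rho c x \<noteq> 0"
    note t = C.r_pos[of x] lpos[OF x(1,3)]
    show "\<mu> * B (u (Rad c x)) = m\<^sup>2 * (Rad c x ^ 6 * Rho c x)"
      unfolding lev[OF x(1)] by (rule B[OF t])
    \<comment> \<open>The factor r^4 completes r^2 \<rho> to r^6 \<rho>, which is a function of r
      alone.\<close>
    have "\<mu> * A (u (Rad c x)) * (u' (Rad c x))\<^sup>2 * ((Rad c x)\<^sup>2 * Rho c x) * Rad c x ^ 4 =
        \<mu> * A (u (Rad c x)) * (u' (Rad c x))\<^sup>2 * (l + \<sigma> * (Rad c x)\<^sup>2)"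
      unfolding lev[OF x(1), symmetric] by (simp add: power_add[symmetric] algebra_simps)
    also have "\<dots> = Rad c x ^ 4" by (rule A[OF t])
    finally show "\<mu> * A (u (Rad c x)) * (u' (Rad c x))\<^sup>2 * ((Rad c x)\<^sup>2 * Rho c x) = 1"
      using C.r_pos[of x] by simp
  next
    fix V W and \<psi> G :: "real^2 \<Rightarrow> real^2"
    assume V: "open V" "V \<subseteq> dom c" "snd c p \<in> V" "open W" "homeomorphism V W \<psi> G" "smooth_on V \<psi>" "smooth_on W G"
      "\<And>x. x \<in> V \<Longrightarrow> \<psi> x $ 1 \<in> T"
      "\<And>x a. x \<in> V \<Longrightarrow> a \<bullet> (metric S c x *v a) = \<mu> * (A (\<psi> x $ 1) * (frechet_derivative \<psi> (at x) a $ 1)\<^sup>2 +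
       B (\<psi> x $ 1) * (frechet_derivative \<psi> (at x) a $ 2)\<^sup>2)"
    show ?thesis by (rule metric_has_form_atI[OF c V])
  qed
qed

end

lemma (in riemannian_surface) integrable_surfaceI:
  fixes b :: "'k::real_normed_field"
  assumes conn: "connected_space (space S)" and \<sigma>: "\<sigma> = 1 \<or> \<sigma> = - 1" and b: "b * b = - of_real \<sigma>"
    and K: "\<And>c x. c \<in> atlas S \<Longrightarrow> x \<in> dom c \<Longrightarrow> \<sigma> * gauss_curvature (metric S c) x > 0"
    and ctf: "\<And>c. c \<in> atlas S \<Longrightarrow> contains_transverse_frobenius (frame_product (dom c) (metric S c))
      (singular_system (\<lambda>z. b * of_real (root_curvature (metric S c) z)) (metric S c))
      (map (\<lambda>A z v. of_real (A z v)) (isometric_embedding_system (metric S c)))"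
  obtains H where "integrable_surface S H \<sigma>"
proof -
  have "\<exists>h. coframe_on (dom c) (metric S c) h" if "c \<in> atlas S" for c
    using metric_coframe[OF that] by metis
  then obtain H where H: "\<And>c. c \<in> atlas S \<Longrightarrow> coframe_on (dom c) (metric S c) (H c)" by metis
  have "integrable_surface S H \<sigma>"
  proof (intro integrable_surface.intro integrable_surface_axioms.intro)
    show "riemannian_surface S" by (rule riemannian_surface_axioms)
    show "connected_space (space S)" by (rule conn)
    show "\<sigma> = 1 \<or> \<sigma> = - 1" by (rule \<sigma>)
    fix c assume c: "c \<in> atlas S"
    have eq: "curv_log c = (\<lambda>x. ln \<bar>gauss_curvature (metric S c) x\<bar> / 4)"
      by (rule ext) (simp only: curv_log_def)
    show "integrable_metric (dom c) (metric S c) (H c) (curv_log c)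
      (frame_deriv (H c) 1 (curv_log c)) (frame_deriv (H c) 2 (curv_log c)) \<sigma>"
      unfolding eq by (rule transverse_frobenius_imp_integrable_metric(1)[OF H[OF c] \<sigma> _ b ctf[OF c]]) (rule K[OF c])
    show "gauss_curvature (metric S c) x = \<sigma> * exp (4 * curv_log c x)" if "x \<in> dom c" for x
      unfolding eq by (rule transverse_frobenius_imp_integrable_metric(2)[OF H[OF c] \<sigma> _ b ctf[OF c] that]) (rule K[OF c])
  qed
  then show ?thesis by (rule that)
qed

section \<open>The four explicit substitutions\<close>

lemma smooth_on_inverse_sqrt:
  fixes F :: "real \<Rightarrow> real"
  assumes "open I" "smooth_on I F" "\<And>t. t \<in> I \<Longrightarrow> F t > 0"
  shows "smooth_on I (\<lambda>t. inverse (sqrt (F t)))"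
proof (rule smooth_on_inverse[OF assms(1) smooth_on_sqrt[OF assms]])
  show "sqrt (F t) \<noteq> 0" if "t \<in> I" for t using assms(3)[OF that] by simp
qed simp_all

context integrable_surface
begin

lemma off_centres:
  assumes "\<And>p. p \<in> topspace (space S) \<Longrightarrow> \<not> curvature_critical S p \<Longrightarrow> metric_has_form_at S p \<mu> T A B"
  shows "metric_has_form_off_centres S \<mu> T A B"
  unfolding metric_has_form_off_centres_def using assms critical_isolated by blast

lemma scaled_derivative:
  assumes "(u has_real_derivative D) (at (t / c))" "c > 0"
  shows "((\<lambda>t. u (t / c)) has_real_derivative D / c) (at t)"
proof -
  have "((\<lambda>t. t / c) has_real_derivative 1 / c) (at t)" by (rule DERIV_cdivide[OF DERIV_ident])
  from DERIV_chain2[OF assms(1) this] show ?thesis by simp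
qed

lemma smooth_quadratic: "open I \<Longrightarrow> smooth_on I (\<lambda>t :: real. a + b * t\<^sup>2)"
  by (intro smooth_on_add smooth_on_mult smooth_on_power smooth_on_const smooth_on_ident)

text \<open>The metric is r^4 dr^2 / (r^2 - m^2) + (r^2 - m^2) dv^2. Substituting r = m cosh u and
  dividing v by m gives the normal form with factor m^4; the excluded centres are the points with r
  = m.\<close>

lemma form_cosh:
  assumes l: "\<And>c x. c \<in> atlas S \<Longrightarrow> x \<in> dom c \<Longrightarrow> Level c x = - m\<^sup>2" and m: "m > 0" and \<sigma>1: "\<sigma> = 1"
  shows "metric_has_form_off_centres S (m ^ 4) {0<..} (\<lambda>u. cosh u ^ 4) (\<lambda>u. (sinh u)\<^sup>2)"
proof (rule off_centres)
  fix p assume p: "p \<in> topspace (space S)" "\<not> curvature_critical S p"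
  have gt: "t / m > 1 \<longleftrightarrow> - m\<^sup>2 + \<sigma> * t\<^sup>2 > 0" if "t > 0" for t
  proof -
    have "m < t \<longleftrightarrow> m\<^sup>2 < t\<^sup>2"
      using power_strict_mono[of m t 2] power_less_imp_less_base[of m 2 t] m that by auto
    then show ?thesis using m by (simp add: \<sigma>1 less_divide_eq)
  qed
  have sq: "sqrt ((t / m)\<^sup>2 - 1) = sqrt (- m\<^sup>2 + t\<^sup>2) / m" if "t / m > 1" for t
  proof -
    have "(t / m)\<^sup>2 - 1 = (- m\<^sup>2 + t\<^sup>2) / m\<^sup>2" using m by (simp add: field_simps)
    then show ?thesis using m by (simp add: real_sqrt_divide)
  qed
  have pos: "- m\<^sup>2 + t\<^sup>2 > 0" if "t / m > 1" for t
    using gt[of t] that m by (simp add: \<sigma>1 less_divide_eq)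
  show "metric_has_form_at S p (m ^ 4) {0<..} (\<lambda>u. cosh u ^ 4) (\<lambda>u. (sinh u)\<^sup>2)"
  proof (rule form_at[OF l p, where I = "{m<..}" and u = "\<lambda>t. arcosh (t / m)" and u' = "\<lambda>t. inverse (sqrt (- m\<^sup>2 + 1 * t\<^sup>2))" and m = m])
    show "((\<lambda>t. arcosh (t / m)) has_real_derivative inverse (sqrt (- m\<^sup>2 + 1 * t\<^sup>2))) (at t)" if "t \<in> {m<..}" for t
    proof -
      have t: "t / m > 1" using that m by simp
      have "(arcosh has_real_derivative 1 / sqrt ((t / m)\<^sup>2 - 1)) (at (t / m))"
        by (rule arcosh_real_has_field_derivative[OF t])
      from scaled_derivative[OF this m] show ?thesis
        unfolding sq[OF t] using m by (simp add: inverse_eq_divide)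
    qed
    show "smooth_on {m<..} (\<lambda>t. inverse (sqrt (- m\<^sup>2 + 1 * t\<^sup>2)))"
      by (rule smooth_on_inverse_sqrt[OF open_greaterThan smooth_quadratic[OF open_greaterThan]]) (use pos m in simp)
    show "t \<in> {m<..}" if "t > 0" "- m\<^sup>2 + \<sigma> * t\<^sup>2 > 0" for t
      using gt[OF that(1)] that(2) m by (simp add: less_divide_eq)
    show "arcosh (t / m) \<in> {0<..}" if "t \<in> {m<..}" for t
      using that m by simp
    fix t :: real assume t: "t > 0" "- m\<^sup>2 + \<sigma> * t\<^sup>2 > 0"
    have t1: "t / m > 1" using gt[OF t(1)] t(2) by simp
    have ch: "cosh (arcosh (t / m)) = t / m" using t1 by simp
    have sh: "(sinh (arcosh (t / m)))\<^sup>2 = (- m\<^sup>2 + t\<^sup>2) / m\<^sup>2"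
      unfolding sinh_square_eq ch using m by (simp add: field_simps)
    have inv: "(inverse (sqrt (- m\<^sup>2 + 1 * t\<^sup>2)))\<^sup>2 * (- m\<^sup>2 + \<sigma> * t\<^sup>2) = 1"
      using pos[OF t1] by (simp add: \<sigma>1 power_inverse)
    have "m ^ 4 * cosh (arcosh (t / m)) ^ 4 * (inverse (sqrt (- m\<^sup>2 + 1 * t\<^sup>2)))\<^sup>2 * (- m\<^sup>2 + \<sigma> * t\<^sup>2) =
       m ^ 4 * (t / m) ^ 4 * ((inverse (sqrt (- m\<^sup>2 + 1 * t\<^sup>2)))\<^sup>2 * (- m\<^sup>2 + \<sigma> * t\<^sup>2))" unfolding ch by (simp only: mult.assoc)
    also have "\<dots> = t ^ 4" unfolding inv using m by (simp add: power_divide)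
    finally show "m ^ 4 * cosh (arcosh (t / m)) ^ 4 * (inverse (sqrt (- m\<^sup>2 + 1 * t\<^sup>2)))\<^sup>2 * (- m\<^sup>2 + \<sigma> * t\<^sup>2) = t ^ 4" .
    show "m ^ 4 * (sinh (arcosh (t / m)))\<^sup>2 = m\<^sup>2 * (- m\<^sup>2 + \<sigma> * t\<^sup>2)"
      unfolding sh using m by (simp add: \<sigma>1 power2_eq_square eval_nat_numeral)
  qed (use m in auto)
qed

text \<open>r^6 \<rho> = l + r^2 is positive, so df has no zero.\<close>

lemma not_critical:
  assumes l: "\<And>c x. c \<in> atlas S \<Longrightarrow> x \<in> dom c \<Longrightarrow> Level c x = l" and "l \<ge> 0" "\<sigma> = 1" "p \<in> topspace (space S)"
  shows "\<not> curvature_critical S p"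
proof -
  obtain c where c: "c \<in> atlas S" "p \<in> fst c" using covered[OF assms(4)] by blast
  have "(Rad c (snd c p))\<^sup>2 > 0" by (simp add: Rad_eq[OF c(1)])
  moreover have "Rad c (snd c p) ^ 6 * Rho c (snd c p) - (Rad c (snd c p))\<^sup>2 = l"
    using l[OF c(1) imageI[OF c(2)]] Level_eq[OF c(1), of "snd c p"] by (simp add: assms(3))
  ultimately have "Rad c (snd c p) ^ 6 * Rho c (snd c p) > 0" using assms(2) by linarith
  then show ?thesis using critical_iff_Rho[OF c] by auto
qed

text \<open>Here l + r^2 = m^2 + r^2 is positive throughout, and r = m sinh u is the substitution;
  the factor m^4 arises as before.\<close>

lemma form_sinh:
  assumes l: "\<And>c x. c \<in> atlas S \<Longrightarrow> x \<in> dom c \<Longrightarrow> Level c x = m\<^sup>2" and m: "m > 0" and \<sigma>1: "\<sigma> = 1"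
  shows "metric_has_form S (m ^ 4) UNIV (\<lambda>u. sinh u ^ 4) (\<lambda>u. (cosh u)\<^sup>2)"
  unfolding metric_has_form_def
proof
  fix p assume p: "p \<in> topspace (space S)"
  have crit: "\<not> curvature_critical S p" by (rule not_critical[OF l _ \<sigma>1 p]) simp_all
  have pos: "m\<^sup>2 + t\<^sup>2 > 0" for t using m by (simp add: add_pos_nonneg)
  have sq: "sqrt ((t / m)\<^sup>2 + 1) = sqrt (m\<^sup>2 + t\<^sup>2) / m" for t
  proof -
    have "(t / m)\<^sup>2 + 1 = (m\<^sup>2 + t\<^sup>2) / m\<^sup>2" using m by (simp add: field_simps)
    then show ?thesis using m by (simp add: real_sqrt_divide)
  qed
  show "metric_has_form_at S p (m ^ 4) UNIV (\<lambda>u. sinh u ^ 4) (\<lambda>u. (cosh u)\<^sup>2)"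
  proof (rule form_at[OF l p crit, where I = UNIV and u = "\<lambda>t. arsinh (t / m)" and u' = "\<lambda>t. inverse (sqrt (m\<^sup>2 + 1 * t\<^sup>2))" and m = m])
    show "((\<lambda>t. arsinh (t / m)) has_real_derivative inverse (sqrt (m\<^sup>2 + 1 * t\<^sup>2))) (at t)" for t
    proof -
      have "(arsinh has_real_derivative 1 / sqrt ((t / m)\<^sup>2 + 1)) (at (t / m))"
        by (rule arsinh_real_has_field_derivative)
      from scaled_derivative[OF this m] show ?thesis
        unfolding sq using m by (simp add: inverse_eq_divide)
    qed
    show "smooth_on UNIV (\<lambda>t. inverse (sqrt (m\<^sup>2 + 1 * t\<^sup>2)))"
      by (rule smooth_on_inverse_sqrt[OF open_UNIV smooth_quadratic[OF open_UNIV]]) (use pos in simp)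
    fix t :: real
    have sh: "sinh (arsinh (t / m)) = t / m" by simp
    have ch: "(cosh (arsinh (t / m)))\<^sup>2 = (m\<^sup>2 + t\<^sup>2) / m\<^sup>2"
      unfolding cosh_square_eq sh using m by (simp add: field_simps)
    have inv: "(inverse (sqrt (m\<^sup>2 + 1 * t\<^sup>2)))\<^sup>2 * (m\<^sup>2 + \<sigma> * t\<^sup>2) = 1"
      using less_imp_neq[OF pos[of t]] by (simp add: \<sigma>1 power_inverse)
    have "m ^ 4 * sinh (arsinh (t / m)) ^ 4 * (inverse (sqrt (m\<^sup>2 + 1 * t\<^sup>2)))\<^sup>2 * (m\<^sup>2 + \<sigma> * t\<^sup>2) =
       m ^ 4 * (t / m) ^ 4 * ((inverse (sqrt (m\<^sup>2 + 1 * t\<^sup>2)))\<^sup>2 * (m\<^sup>2 + \<sigma> * t\<^sup>2))" unfolding sh by (simp only: mult.assoc)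
    also have "\<dots> = t ^ 4" unfolding inv using m by (simp add: power_divide)
    finally show "m ^ 4 * sinh (arsinh (t / m)) ^ 4 * (inverse (sqrt (m\<^sup>2 + 1 * t\<^sup>2)))\<^sup>2 * (m\<^sup>2 + \<sigma> * t\<^sup>2) = t ^ 4" .
    show "m ^ 4 * (cosh (arsinh (t / m)))\<^sup>2 = m\<^sup>2 * (m\<^sup>2 + \<sigma> * t\<^sup>2)"
      unfolding ch using m by (simp add: \<sigma>1 power2_eq_square eval_nat_numeral)
  qed (use m in auto)
qed

text \<open>For l = 0 the radius itself is the coordinate. A constant factor can be absorbed by
  dilating both coordinates, hence the factor 1.\<close>

lemma form_flat:
  assumes l: "\<And>c x. c \<in> atlas S \<Longrightarrow> x \<in> dom c \<Longrightarrow> Level c x = 0" and \<sigma>1: "\<sigma> = 1"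
  shows "metric_has_form S 1 {0<..} (\<lambda>u. u\<^sup>2) (\<lambda>u. u\<^sup>2)"
  unfolding metric_has_form_def
proof
  fix p assume p: "p \<in> topspace (space S)"
  have crit: "\<not> curvature_critical S p" by (rule not_critical[OF l _ \<sigma>1 p]) simp_all
  show "metric_has_form_at S p 1 {0<..} (\<lambda>u. u\<^sup>2) (\<lambda>u. u\<^sup>2)"
    by (rule form_at[OF l p crit, where I = "{0<..}" and u = "\<lambda>t. t" and u' = "\<lambda>t. 1" and m = 1])
      (auto simp: \<sigma>1 power2_eq_square eval_nat_numeral intro: smooth_on_const)
qed

text \<open>The metric is r^4 dr^2 / (m^2 - r^2) + (m^2 - r^2) dv^2 with r between 0 and m. The
  substitution r = m cos u reverses orientation in r, which accounts for the sign of u'.\<close>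

lemma form_cos:
  assumes l: "\<And>c x. c \<in> atlas S \<Longrightarrow> x \<in> dom c \<Longrightarrow> Level c x = m\<^sup>2" and m: "m > 0" and \<sigma>1: "\<sigma> = - 1"
  shows "metric_has_form_off_centres S (m ^ 4) {0<..<pi/2} (\<lambda>u. cos u ^ 4) (\<lambda>u. (sin u)\<^sup>2)"
proof (rule off_centres)
  fix p assume p: "p \<in> topspace (space S)" "\<not> curvature_critical S p"
  have pos: "m\<^sup>2 - t\<^sup>2 > 0" if "t \<in> {0<..<m}" for t
    using that m by (simp add: power_strict_mono)
  have sq: "sqrt (1 - (t / m)\<^sup>2) = sqrt (m\<^sup>2 - t\<^sup>2) / m" for t
  proof -
    have "1 - (t / m)\<^sup>2 = (m\<^sup>2 - t\<^sup>2) / m\<^sup>2" using m by (simp add: field_simps)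
    then show ?thesis using m by (simp add: real_sqrt_divide)
  qed
  have I: "t \<in> {0<..<m}" if "t > 0" "m\<^sup>2 + \<sigma> * t\<^sup>2 > 0" for t
    using that m by (simp add: \<sigma>1 power_less_imp_less_base[of t 2 m])
  show "metric_has_form_at S p (m ^ 4) {0<..<pi/2} (\<lambda>u. cos u ^ 4) (\<lambda>u. (sin u)\<^sup>2)"
  proof (rule form_at[OF l p, where I = "{0<..<m}" and u = "\<lambda>t. arccos (t / m)" and u' = "\<lambda>t. - inverse (sqrt (m\<^sup>2 + - 1 * t\<^sup>2))" and m = m])
    show "((\<lambda>t. arccos (t / m)) has_real_derivative - inverse (sqrt (m\<^sup>2 + - 1 * t\<^sup>2))) (at t)" if "t \<in> {0<..<m}" for t
    proof -
      have t: "- 1 < t / m" "t / m < 1" using that m by (simp_all add: less_divide_eq)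
      from scaled_derivative[OF DERIV_arccos[OF t] m] show ?thesis
        unfolding sq using m by (simp add: inverse_eq_divide)
    qed
    show "smooth_on {0<..<m} (\<lambda>t. - inverse (sqrt (m\<^sup>2 + - 1 * t\<^sup>2)))"
      by (rule smooth_on_uminus[OF open_greaterThanLessThan smooth_on_inverse_sqrt[OF open_greaterThanLessThan
        smooth_quadratic[OF open_greaterThanLessThan]]]) (use pos in simp)
    show "arccos (t / m) \<in> {0<..<pi/2}" if "t \<in> {0<..<m}" for t
    proof -
      have t: "0 < t / m" "t / m < 1" using that m by simp_all
      then have "arccos 1 < arccos (t / m) \<and> arccos (t / m) < pi \<and> arccos (t / m) < arccos 0"
        using arccos_less_mono[of 1 "t / m"] arccos_less_mono[of "t / m" 0] arccos_lt_bounded[of "t / m"] by simp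
      then show ?thesis by simp
    qed
    show "t \<in> {0<..<m}" if "t > 0" "m\<^sup>2 + \<sigma> * t\<^sup>2 > 0" for t by (rule I[OF that])
    fix t :: real assume t: "t > 0" "m\<^sup>2 + \<sigma> * t\<^sup>2 > 0"
    note tI = I[OF t]
    have ch: "cos (arccos (t / m)) = t / m" using tI m by (intro cos_arccos) (simp_all add: le_divide_eq)
    have sh: "(sin (arccos (t / m)))\<^sup>2 = (m\<^sup>2 - t\<^sup>2) / m\<^sup>2"
      unfolding sin_squared_eq ch using m by (simp add: field_simps)
    have inv: "(- inverse (sqrt (m\<^sup>2 + - 1 * t\<^sup>2)))\<^sup>2 * (m\<^sup>2 + \<sigma> * t\<^sup>2) = 1"
      using pos[OF tI] by (simp add: \<sigma>1 power_inverse)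
    have "m ^ 4 * cos (arccos (t / m)) ^ 4 * (- inverse (sqrt (m\<^sup>2 + - 1 * t\<^sup>2)))\<^sup>2 * (m\<^sup>2 + \<sigma> * t\<^sup>2) =
       m ^ 4 * (t / m) ^ 4 * ((- inverse (sqrt (m\<^sup>2 + - 1 * t\<^sup>2)))\<^sup>2 * (m\<^sup>2 + \<sigma> * t\<^sup>2))" unfolding ch by (simp only: mult.assoc)
    also have "\<dots> = t ^ 4" unfolding inv using m by (simp add: power_divide)
    finally show "m ^ 4 * cos (arccos (t / m)) ^ 4 * (- inverse (sqrt (m\<^sup>2 + - 1 * t\<^sup>2)))\<^sup>2 * (m\<^sup>2 + \<sigma> * t\<^sup>2) = t ^ 4" .
    show "m ^ 4 * (sin (arccos (t / m)))\<^sup>2 = m\<^sup>2 * (m\<^sup>2 + \<sigma> * t\<^sup>2)"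
      unfolding sh using m by (simp add: \<sigma>1 power2_eq_square eval_nat_numeral)
  qed (use m in auto)
qed

end

theorem theorem7:
  fixes S :: "'p riem_surface"
  assumes "oriented_riemannian_surface S"
    and "connected_space (space S)"
    and "elliptic S \<or> hyperbolic S"
    and "darboux_integrable S"
  shows "(elliptic S \<longrightarrow>
            (\<exists>c>0. metric_has_form_off_centres S c {0<..} (\<lambda>u. cosh u ^ 4) (\<lambda>u. (sinh u)\<^sup>2)) \<or>
            (\<exists>c>0. metric_has_form S c UNIV (\<lambda>u. sinh u ^ 4) (\<lambda>u. (cosh u)\<^sup>2)) \<or>
            metric_has_form S 1 {0<..} (\<lambda>u. u\<^sup>2) (\<lambda>u. u\<^sup>2)) \<and>
         (hyperbolic S \<longrightarrow>
            (\<exists>c>0. metric_has_form_off_centres S c {0<..<pi/2} (\<lambda>u. cos u ^ 4) (\<lambda>u. (sin u)\<^sup>2)))"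
proof (intro conjI impI)
  interpret riemannian_surface S by unfold_locales (rule assms(1))
  {
    assume ell: "elliptic S"
    have ctf: "contains_transverse_frobenius (frame_product (dom c) (metric S c))
      (singular_system (\<lambda>z. \<i> * of_real (root_curvature (metric S c) z)) (metric S c))
      (map (\<lambda>A z v. of_real (A z v)) (isometric_embedding_system (metric S c)))" if "c \<in> atlas S" for c
    proof -
      have "contains_transverse_frobenius (frame_product (dom c) (metric S c)) (elliptic_system (metric S c))
        (map complexify (isometric_embedding_system (metric S c)))"
        using assms(4) that ell unfolding darboux_integrable_def Let_def by blast
      then show ?thesis unfolding elliptic_system_eq complexify_def[abs_def] .
    qed
    have K: "1 * gauss_curvature (metric S c) x > 0" if "c \<in> atlas S" "x \<in> dom c" for c x
      using ell that unfolding elliptic_def by auto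
    obtain H where "integrable_surface S H 1"
    proof (rule integrable_surfaceI[where \<sigma> = 1 and b = \<i>])
      show "connected_space (space S)" by (rule assms(2))
    qed (use K ctf in simp_all)
    then interpret E: integrable_surface S H 1 .
    obtain l where l: "\<And>c x. c \<in> atlas S \<Longrightarrow> x \<in> dom c \<Longrightarrow> E.Level c x = l"
    proof (rule E.level_constant)
      fix l
      assume "\<And>c x. c \<in> atlas S \<Longrightarrow> x \<in> dom c \<Longrightarrow> E.Level c x = l"
      then show thesis by (rule that)
    qed
    consider "l < 0" | "l = 0" | "l > 0" by linarith
    then show "(\<exists>c>0. metric_has_form_off_centres S c {0<..} (\<lambda>u. cosh u ^ 4) (\<lambda>u. (sinh u)\<^sup>2)) \<or>
            (\<exists>c>0. metric_has_form S c UNIV (\<lambda>u. sinh u ^ 4) (\<lambda>u. (cosh u)\<^sup>2)) \<or>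
            metric_has_form S 1 {0<..} (\<lambda>u. u\<^sup>2) (\<lambda>u. u\<^sup>2)"
    proof cases
      case 1
      \<comment> \<open>With m = sqrt (- l) the level is - m^2, and the scale of the metric is
        l^2.\<close>
      have "metric_has_form_off_centres S (sqrt (- l) ^ 4) {0<..} (\<lambda>u. cosh u ^ 4) (\<lambda>u. (sinh u)\<^sup>2)"
        by (rule E.form_cosh) (use 1 l in simp_all)
      moreover have "sqrt (- l) ^ 4 > 0" using 1 by simp
      ultimately show ?thesis by blast
    next
      case 2
      have "metric_has_form S 1 {0<..} (\<lambda>u. u\<^sup>2) (\<lambda>u. u\<^sup>2)"
        by (rule E.form_flat) (use 2 l in simp_all)
      then show ?thesis by blast
    next
      case 3
      have "metric_has_form S (sqrt l ^ 4) UNIV (\<lambda>u. sinh u ^ 4) (\<lambda>u. (cosh u)\<^sup>2)"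
        by (rule E.form_sinh) (use 3 l in simp_all)
      moreover have "sqrt l ^ 4 > 0" using 3 by simp
      ultimately show ?thesis by blast
    qed
  next
    assume hyp: "hyperbolic S"
    have ctf: "contains_transverse_frobenius (frame_product (dom c) (metric S c))
      (singular_system (\<lambda>z. (1 :: real) * of_real (root_curvature (metric S c) z)) (metric S c))
      (map (\<lambda>A z v. of_real (A z v)) (isometric_embedding_system (metric S c)))" if "c \<in> atlas S" for c
    proof -
      have "contains_transverse_frobenius (frame_product (dom c) (metric S c)) (hyperbolic_system 1 (metric S c))
        (isometric_embedding_system (metric S c))"
        using assms(4) that hyp unfolding darboux_integrable_def Let_def by blast
      moreover have "map (\<lambda>A z v. of_real (A z v)) Fs = Fs" for Fs :: "real form1 list" by simp
      ultimately show ?thesis unfolding hyperbolic_system_eq by (simp only:)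
    qed
    have K: "- 1 * gauss_curvature (metric S c) x > 0" if "c \<in> atlas S" "x \<in> dom c" for c x
      using hyp that unfolding hyperbolic_def by auto
    obtain H where "integrable_surface S H (- 1)"
    proof (rule integrable_surfaceI[where \<sigma> = "- 1" and b = "1 :: real"])
      show "connected_space (space S)" by (rule assms(2))
    qed (use K ctf in simp_all)
    then interpret E: integrable_surface S H "- 1" .
    obtain l where l: "\<And>c x. c \<in> atlas S \<Longrightarrow> x \<in> dom c \<Longrightarrow> E.Level c x = l"
    proof (rule E.level_constant)
      fix l
      assume "\<And>c x. c \<in> atlas S \<Longrightarrow> x \<in> dom c \<Longrightarrow> E.Level c x = l"
      then show thesis by (rule that)
    qed
    show "\<exists>c>0. metric_has_form_off_centres S c {0<..<pi/2} (\<lambda>u. cos u ^ 4) (\<lambda>u. (sin u)\<^sup>2)"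
    proof (cases "topspace (space S) = {}")
      case True
      \<comment> \<open>No points, so any positive scale does.\<close>
      then show ?thesis unfolding metric_has_form_off_centres_def by (intro exI[of _ 1]) simp
    next
      case False
      then obtain q c where c: "c \<in> atlas S" "q \<in> fst c" using covered by blast
      interpret C: integrable_metric "dom c" "metric S c" "H c" "curv_log c" "E.P c" "E.Q c" "- 1" by (rule E.im[OF c(1)])
      \<comment> \<open>For \<sigma> = - 1 the level is r^6 \<rho> + r^2, a sum of a nonnegative and
        a positive term; hence there is only one hyperbolic normal form.\<close>
      have "C.level (snd c q) > 0"
        unfolding C.level_def using C.r_pos[of "snd c q"] C.\<rho>_nonneg[of "snd c q"] by (simp add: add_nonneg_pos)
      then have "l > 0" using l[OF c(1) imageI[OF c(2)]] by simp
      then have "metric_has_form_off_centres S (sqrt l ^ 4) {0<..<pi/2} (\<lambda>u. cos u ^ 4) (\<lambda>u. (sin u)\<^sup>2)"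
        by (intro E.form_cos) (use l in simp_all)
      moreover have "sqrt l ^ 4 > 0" using \<open>l > 0\<close> by simp
      ultimately show ?thesis by blast
    qed
  }
qed

end
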